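(* Let $G$ be a $3$-dimensional unimodular Lie group with Lie algebra $\mathfrak{g}$. There are no odd generalized Einstein metrics $E_-=\{X-g(X)\mid X\in TG\}$ on $G$, defined on Courant algebroids $E_{H,F}$ of type $B_3$ over $G$ with $H,F$ left-invariant and $F\neq0$ and with left-invariant divergence, with the property that the operator $L$ associated to $(\mathfrak{g},g)$ belongs to the second class of canonical forms $L_2$. Here $g$ is the (left-invariant) pseudo-Riemannian metric on $G$ induced by $E_-$.
   Context: The operator $L$. Let $g$ be a non-degenerate scalar product on the $3$-dimensional Lie algebra $\mathfrak{g}$ and fix an orientation. $L\in\mathrm{End}\,\mathfrak{g}$ is defined by $[u,v]=L(u\times v)$, where $\times$ is the cross product of $g$ and the orientation (in an oriented $g$-orthonormal basis $(v_a)$ with $\epsilon_a=g(v_a,v_a)$: $v_1\times v_2=\epsilon_3v_3$, $v_2\times v_3=\epsilon_1v_1$, $v_3\times v_1=\epsilon_2v_2$); $L$ is determined up to sign by $(\mathfrak{g},g)$. "$L$ belongs to the second class of canonical forms" means: there is a $g$-orthonormal basis $(v_a)$ of $\mathfrak{g}$ with $\epsilon_1=\epsilon_2=-\epsilon_3$ in which $$L=L_2(\alpha,\beta,\gamma)=\begin{pmatrix}\gamma&0&0\\0&\alpha&-\beta\\0&\beta&\alpha\end{pmatrix},\qquad\alpha,\beta,\gamma\in\mathbb{R},\ \beta\neq0,$$ with the convention $L(v_a)=\sum_bL_{ba}v_b$. Equivalently $[v_1,v_2]=\epsilon_3L(v_3)$, $[v_2,v_3]=\epsilon_1L(v_1)$,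 $[v_3,v_1]=\epsilon_2L(v_2)$. Unimodular means $\mathrm{tr}\,\mathrm{ad}_u=0$ for all $u\in\mathfrak{g}$. Courant algebroid of type $B_3$: for left-invariant $H\in\Omega^3(G)$, $F\in\Omega^2(G)$ with $dF=0$, $E=E_{H,F}$ is the bundle $TG\oplus T^*G\oplus\mathbb{R}$ with anchor $\pi$ the projection to $TG$, scalar product $\langle X+\xi+\lambda,Y+\eta+\mu\rangle=\frac12(\xi(Y)+\eta(X))+\lambda\mu$ and Dorfman bracket $$[X+\xi+\lambda,Y+\eta+\mu]_{H,F}=\mathcal{L}_X(Y+\eta)-i_Yd\xi+2\mu\,d\lambda+i_Xi_YH-2(\mu\, i_XF-\lambda\, i_YF)+X(\mu)-Y(\lambda)+F(X,Y).$$ Left-invariant sections of $E$ (for the action of $G$ by left translations, trivial on the $\mathbb{R}$-fibre) form $\tilde E=\mathfrak{g}\oplus\mathfrak{g}^*\oplus\mathbb{R}$. For $E_-=\{X-g(X)\mid X\in TG\}$, $g(X)=g(X,\cdot)$, put $E_+=E_-^\perp$. A generalized connection is a linear map $D:\Gamma(E)\to\Gamma(E^*\otimes E)$ with $D_u(fv)=\pi(u)(f)v+fD_uv$ and $\pi(u)\langle v,w\rangle=\langle D_uv,w\rangle+\langle v,D_uw\rangle$. Its torsion is $T^D(u,v,w)=\langle D_uv-D_vu-[u,v]_{H,F},w\rangle+\langle v,D_wu\rangle$; $D$ is Levi-Civita for $E_-$ if $T^D=0$ and $D_u\Gamma(E_-)\subset\Gamma(E_-)$ for all $u$. A divergence operator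 is an additive map $\delta:\Gamma(E)\to C^\infty(G)$ with $\delta(fu)=\pi(u)(f)+f\delta(u)$; it is left-invariant if constant on left-invariant sections, and is then identified with an element of $\tilde E^*$; $\delta^D(u)=\mathrm{tr}\,Du$. For a Levi-Civita generalized connection $D$ of $E_-$ with $\delta^D=\delta$, put $R^D(u,v)w=D_uD_vw-D_vD_uw-D_{[u,v]_{H,F}}w$ and $\mathrm{Ric}^{\delta,+}(u,v)=\mathrm{tr}(E_+\ni w\mapsto R^D(w,u)v)$ ($u\in E_-,v\in E_+$), $\mathrm{Ric}^{\delta,-}(u,v)=\mathrm{tr}(E_-\ni w\mapsto R^D(w,u)v)$ ($u\in E_+,v\in E_-$). These are tensors depending only on $(E_-,\delta)$. $E_-$ is odd generalized Einstein with (left-invariant) divergence $\delta$ if $\mathrm{Ric}^{\delta,+}=0$ and $\mathrm{Ric}^{\delta,-}=0$. *)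

theory Defs
  imports "HOL-Analysis.Analysis" "HOL-Library.Function_Algebras" "HOL-Library.FuncSet"
begin

section \<open>Smooth maps between Euclidean spaces\<close>

primrec Ck_on :: "nat \<Rightarrow> 'e::real_normed_vector set \<Rightarrow> ('e \<Rightarrow> 'f::real_normed_vector) \<Rightarrow> bool" where
  "Ck_on 0 S f = continuous_on S f"
| "Ck_on (Suc k) S f =
     (\<exists>f'. (\<forall>x\<in>S. (f has_derivative f' x) (at x)) \<and> (\<forall>v. Ck_on k S (\<lambda>x. f' x v)))"

text \<open>Only used for open sets \<open>S\<close> in finite-dimensional spaces.\<close>

definition smooth_on :: "'e::real_normed_vector set \<Rightarrow> ('e \<Rightarrow> 'f::real_normed_vector) \<Rightarrow> bool" where
  "smooth_on S f \<longleftrightarrow> (\<forall>k. Ck_on k S f)"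


section \<open>Three-dimensional Lie groups\<close>

text \<open>The underlying topological space of the group is the type \<open>'a\<close>; the smooth structure is
  given by an atlas, which need not be maximal.\<close>

record 'a lie_data =
  gmult :: "'a \<Rightarrow> 'a \<Rightarrow> 'a"
  gone :: 'a
  ginv :: "'a \<Rightarrow> 'a"
  charts :: "('a set \<times> ('a \<Rightarrow> real^3)) set"

definition smooth_atlas :: "('a::topological_space set \<times> ('a \<Rightarrow> real^3)) set \<Rightarrow> bool" where
  "smooth_atlas A \<longleftrightarrow>
     (\<Union>(U, \<phi>)\<in>A. U) = UNIV \<and>
     (\<forall>(U, \<phi>)\<in>A. open U \<and> open (\<phi> ` U) \<and> homeomorphism U (\<phi> ` U) \<phi> (inv_into U \<phi>)) \<and>
     (\<forall>(U, \<phi>)\<in>A. \<forall>(V, \<psi>)\<in>A. smooth_on (\<phi> ` (U \<inter> V)) (\<psi> \<circ> inv_into U \<phi>))"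

definition lie_group3 :: "'a::{t2_space, second_countable_topology} lie_data \<Rightarrow> bool" where
  "lie_group3 G \<longleftrightarrow>
     group (gmult G) (gone G) (ginv G) \<and>
     smooth_atlas (charts G) \<and>
     continuous_on UNIV (\<lambda>(x, y). gmult G x y) \<and>
     continuous_on UNIV (ginv G) \<and>
     (\<forall>(U, \<phi>)\<in>charts G. \<forall>(V, \<psi>)\<in>charts G. \<forall>(W, \<theta>)\<in>charts G.
        smooth_on {(\<phi> x, \<psi> y) | x y. x \<in> U \<and> y \<in> V \<and> gmult G x y \<in> W}
          (\<lambda>(s, t). \<theta> (gmult G (inv_into U \<phi> s) (inv_into V \<psi> t)))) \<and>
     (\<forall>(U, \<phi>)\<in>charts G. \<forall>(V, \<psi>)\<in>charts G.
        smooth_on {\<phi> x | x. x \<in> U \<and> ginv G x \<in> V} (\<lambda>s. \<psi> (ginv G (inv_into U \<phi> s))))"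


section \<open>Functions, vector fields and forms\<close>

definition smooth_fun_on :: "'a::topological_space lie_data \<Rightarrow> 'a set \<Rightarrow> ('a \<Rightarrow> real) \<Rightarrow> bool" where
  "smooth_fun_on G U f \<longleftrightarrow>
     (\<forall>(V, \<phi>)\<in>charts G. smooth_on (\<phi> ` (U \<inter> V)) (f \<circ> inv_into V \<phi>))"

definition cinf :: "'a::topological_space lie_data \<Rightarrow> ('a \<Rightarrow> real) set" where
  "cinf G = {f. smooth_fun_on G UNIV f}"

definition smooth_near :: "'a::topological_space lie_data \<Rightarrow> 'a \<Rightarrow> ('a \<Rightarrow> real) \<Rightarrow> bool" where
  "smooth_near G p f \<longleftrightarrow> (\<exists>U. open U \<and> p \<in> U \<and> smooth_fun_on G U f)"

text \<open>A tangent vector at \<open>p\<close> acts on functions which are smooth near \<open>p\<close> as a directional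
  derivative in a chart. To have a unique representation, it is set to be 0 on all other functions;
  the same convention is in force for vector fields.\<close>

definition tangent_vector :: "'a::topological_space lie_data \<Rightarrow> 'a \<Rightarrow> (('a \<Rightarrow> real) \<Rightarrow> real) \<Rightarrow> bool" where
  "tangent_vector G p v \<longleftrightarrow>
     (\<exists>(U, \<phi>)\<in>charts G. p \<in> U \<and>
        (\<exists>w. \<forall>f. v f =
           (if smooth_near G p f then frechet_derivative (f \<circ> inv_into U \<phi>) (at (\<phi> p)) w else 0)))"

type_synonym 'a vfield = "('a \<Rightarrow> real) \<Rightarrow> 'a \<Rightarrow> real"

definition vfields :: "'a::topological_space lie_data \<Rightarrow> 'a vfield set" where
  "vfields G = {X. (\<forall>p. tangent_vector G p (\<lambda>f. X f p)) \<and>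
                   (\<forall>U f. open U \<and> smooth_fun_on G U f \<longrightarrow> smooth_fun_on G U (X f))}"

definition lie_bracket :: "'a::topological_space lie_data \<Rightarrow> 'a vfield \<Rightarrow> 'a vfield \<Rightarrow> 'a vfield" where
  "lie_bracket G X Y = (\<lambda>f p. if smooth_near G p f then X (Y f) p - Y (X f) p else 0)"

text \<open>Differential forms and covariant tensors are \<open>C\<^sup>\<infinity>(G)\<close>-multilinear maps on vector fields.
  As 1-forms occur as components of sections, they are made unique by being 0 off \<open>vfields G\<close>.\<close>

type_synonym 'a form1 = "'a vfield \<Rightarrow> 'a \<Rightarrow> real"
type_synonym 'a form2 = "'a vfield \<Rightarrow> 'a form1"
type_synonym 'a form3 = "'a vfield \<Rightarrow> 'a form2"

definition smul :: "('a \<Rightarrow> real) \<Rightarrow> ('b \<Rightarrow> 'a \<Rightarrow> real) \<Rightarrow> 'b \<Rightarrow> 'a \<Rightarrow> real" where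
  "smul f T = (\<lambda>x. f * T x)"

definition cinf_linear :: "'a::topological_space lie_data \<Rightarrow> 'a form1 \<Rightarrow> bool" where
  "cinf_linear G \<xi> \<longleftrightarrow>
     (\<forall>X\<in>vfields G. \<xi> X \<in> cinf G) \<and>
     (\<forall>X\<in>vfields G. \<forall>Y\<in>vfields G. \<xi> (X + Y) = \<xi> X + \<xi> Y) \<and>
     (\<forall>f\<in>cinf G. \<forall>X\<in>vfields G. \<xi> (smul f X) = f * \<xi> X)"

definition form1_of :: "'a::topological_space lie_data \<Rightarrow> 'a form1 \<Rightarrow> 'a form1" where
  "form1_of G \<xi> = (\<lambda>X. if X \<in> vfields G then \<xi> X else 0)"

definition forms1 :: "'a::topological_space lie_data \<Rightarrow> 'a form1 set" where
  "forms1 G = {\<xi>. cinf_linear G \<xi> \<and> (\<forall>X. X \<notin> vfields G \<longrightarrow> \<xi> X = 0)}"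

definition forms2 :: "'a::topological_space lie_data \<Rightarrow> 'a form2 set" where
  "forms2 G = {F. (\<forall>X\<in>vfields G. cinf_linear G (F X)) \<and>
                  (\<forall>X\<in>vfields G. \<forall>Y\<in>vfields G. F X Y = - F Y X)}"

definition forms3 :: "'a::topological_space lie_data \<Rightarrow> 'a form3 set" where
  "forms3 G = {H. (\<forall>X\<in>vfields G. H X \<in> forms2 G) \<and>
                  (\<forall>X\<in>vfields G. \<forall>Y\<in>vfields G. \<forall>Z\<in>vfields G. H X Y Z = - H Y X Z)}"

definition d1 :: "'a::topological_space lie_data \<Rightarrow> 'a form1 \<Rightarrow> 'a form2" where
  "d1 G \<xi> X Y = X (\<xi> Y) - Y (\<xi> X) - \<xi> (lie_bracket G X Y)"

definition d2 :: "'a::topological_space lie_data \<Rightarrow> 'a form2 \<Rightarrow> 'a form3" where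
  "d2 G F X Y Z = X (F Y Z) - Y (F X Z) + Z (F X Y)
     - F (lie_bracket G X Y) Z + F (lie_bracket G X Z) Y - F (lie_bracket G Y Z) X"

definition lie_der1 :: "'a::topological_space lie_data \<Rightarrow> 'a vfield \<Rightarrow> 'a form1 \<Rightarrow> 'a form1" where
  "lie_der1 G X \<eta> = (\<lambda>Y. X (\<eta> Y) - \<eta> (lie_bracket G X Y))"


section \<open>Left-invariance\<close>

definition push :: "'a lie_data \<Rightarrow> 'a \<Rightarrow> 'a vfield \<Rightarrow> 'a vfield" where
  "push G a X = (\<lambda>f p. X (\<lambda>q. f (gmult G a q)) (gmult G (ginv G a) p))"

definition lie_alg :: "'a::topological_space lie_data \<Rightarrow> 'a vfield set" where
  "lie_alg G = {X \<in> vfields G. \<forall>a. push G a X = X}"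

definition left_inv1 :: "'a::topological_space lie_data \<Rightarrow> 'a form1 \<Rightarrow> bool" where
  "left_inv1 G \<xi> \<longleftrightarrow> (\<forall>a p. \<forall>X\<in>vfields G. \<xi> (push G a X) (gmult G a p) = \<xi> X p)"

definition left_inv2 :: "'a::topological_space lie_data \<Rightarrow> 'a form2 \<Rightarrow> bool" where
  "left_inv2 G F \<longleftrightarrow> (\<forall>a p. \<forall>X\<in>vfields G. \<forall>Y\<in>vfields G.
     F (push G a X) (push G a Y) (gmult G a p) = F X Y p)"

definition left_inv3 :: "'a::topological_space lie_data \<Rightarrow> 'a form3 \<Rightarrow> bool" where
  "left_inv3 G H \<longleftrightarrow> (\<forall>a p. \<forall>X\<in>vfields G. \<forall>Y\<in>vfields G. \<forall>Z\<in>vfields G.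
     H (push G a X) (push G a Y) (push G a Z) (gmult G a p) = H X Y Z p)"

definition left_inv_metric :: "'a::topological_space lie_data \<Rightarrow> 'a form2 \<Rightarrow> bool" where
  "left_inv_metric G g \<longleftrightarrow>
     (\<forall>X\<in>vfields G. cinf_linear G (g X)) \<and>
     (\<forall>X\<in>vfields G. \<forall>Y\<in>vfields G. g X Y = g Y X) \<and>
     (\<forall>X\<in>vfields G. \<forall>p. (\<forall>Y\<in>vfields G. g X Y p = 0) \<longrightarrow> (\<forall>f. X f p = 0)) \<and>
     left_inv2 G g"


section \<open>Bases and traces over a ring of scalars\<close>

text \<open>\<open>M\<close> is a module over the ring \<open>R\<close> with scalar multiplication \<open>scl\<close>. This is used for the
  real vector space \<open>lie_alg G\<close> and for the \<open>C\<^sup>\<infinity>(G)\<close>-modules of sections of the (trivial)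
  bundles \<open>E\<close>, \<open>E\<^sub>+\<close>, \<open>E\<^sub>-\<close>, for which a basis is a global frame and the trace of a bundle
  endomorphism is a function on \<open>G\<close>.\<close>

definition is_basis ::
  "('s \<Rightarrow> 'v \<Rightarrow> 'v::comm_monoid_add) \<Rightarrow> 's set \<Rightarrow> 'v set \<Rightarrow> 'i set \<Rightarrow> ('i \<Rightarrow> 'v) \<Rightarrow> bool" where
  "is_basis scl R M I e \<longleftrightarrow> finite I \<and> (\<forall>i\<in>I. e i \<in> M) \<and>
     (\<forall>x\<in>M. \<exists>!c. c \<in> I \<rightarrow>\<^sub>E R \<and> x = (\<Sum>i\<in>I. scl (c i) (e i)))"

definition module_trace ::
  "('s::comm_monoid_add \<Rightarrow> 'v \<Rightarrow> 'v::comm_monoid_add) \<Rightarrow> 's set \<Rightarrow> 'v set \<Rightarrow> ('v \<Rightarrow> 'v) \<Rightarrow> 's" where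
  "module_trace scl R M T = (THE t. \<exists>(n::nat) e A.
     is_basis scl R M {..<n} e \<and>
     (\<forall>i<n. \<forall>j<n. A i j \<in> R) \<and>
     (\<forall>j<n. T (e j) = (\<Sum>i<n. scl (A i j) (e i))) \<and>
     t = (\<Sum>i<n. A i i))"


section \<open>The Lie algebra and the operator \<open>L\<close>\<close>

definition rscl :: "real \<Rightarrow> 'a vfield \<Rightarrow> 'a vfield" where
  "rscl c X = smul (\<lambda>_. c) X"

definition unimodular :: "'a::topological_space lie_data \<Rightarrow> bool" where
  "unimodular G \<longleftrightarrow> (\<forall>u\<in>lie_alg G. module_trace rscl UNIV (lie_alg G) (lie_bracket G u) = 0)"

text \<open>The index type \<open>3\<close> has the elements \<open>1, 2, 3\<close>.\<close>

definition orthonormal_basis ::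
  "'a::topological_space lie_data \<Rightarrow> 'a form2 \<Rightarrow> (3 \<Rightarrow> 'a vfield) \<Rightarrow> (3 \<Rightarrow> real) \<Rightarrow> bool" where
  "orthonormal_basis G g v \<epsilon> \<longleftrightarrow>
     is_basis rscl UNIV (lie_alg G) UNIV v \<and>
     (\<forall>a. \<epsilon> a = 1 \<or> \<epsilon> a = -1) \<and>
     (\<forall>a b. g (v a) (v b) = (\<lambda>_. if a = b then \<epsilon> a else 0))"

definition endo :: "'a::topological_space lie_data \<Rightarrow> ('a vfield \<Rightarrow> 'a vfield) \<Rightarrow> bool" where
  "endo G L \<longleftrightarrow>
     (\<forall>u\<in>lie_alg G. L u \<in> lie_alg G) \<and>
     (\<forall>u\<in>lie_alg G. \<forall>v\<in>lie_alg G. L (u + v) = L u + L v) \<and>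
     (\<forall>c. \<forall>u\<in>lie_alg G. L (rscl c u) = rscl c (L u))"

text \<open>An orientation of the Lie algebra is given by a non-zero determinant form \<open>\<omega>\<close>: the oriented
  bases \<open>v\<close> are those with \<open>\<omega> (v 1) (v 2) (v 3) > 0\<close>.\<close>

definition orientation_form ::
  "'a::topological_space lie_data \<Rightarrow> ('a vfield \<Rightarrow> 'a vfield \<Rightarrow> 'a vfield \<Rightarrow> real) \<Rightarrow> bool" where
  "orientation_form G \<omega> \<longleftrightarrow>
     (\<forall>u\<in>lie_alg G. \<forall>v\<in>lie_alg G. \<forall>w\<in>lie_alg G. \<forall>x\<in>lie_alg G. \<forall>c.
        \<omega> u v (w + x) = \<omega> u v w + \<omega> u v x \<and> \<omega> u v (rscl c w) = c * \<omega> u v w \<and>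
        \<omega> u v w = - \<omega> v u w \<and> \<omega> u v w = - \<omega> u w v) \<and>
     (\<exists>u\<in>lie_alg G. \<exists>v\<in>lie_alg G. \<exists>w\<in>lie_alg G. \<omega> u v w \<noteq> 0)"

definition cross_product ::
  "'a::topological_space lie_data \<Rightarrow> 'a form2 \<Rightarrow> ('a vfield \<Rightarrow> 'a vfield \<Rightarrow> 'a vfield \<Rightarrow> real) \<Rightarrow>
   ('a vfield \<Rightarrow> 'a vfield \<Rightarrow> 'a vfield) \<Rightarrow> bool" where
  "cross_product G g \<omega> cr \<longleftrightarrow>
     (\<forall>u\<in>lie_alg G. endo G (cr u)) \<and>
     (\<forall>u\<in>lie_alg G. \<forall>v\<in>lie_alg G. cr u v = - cr v u) \<and>
     (\<forall>v \<epsilon>. orthonormal_basis G g v \<epsilon> \<and> \<omega> (v 1) (v 2) (v 3) > 0 \<longrightarrow>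
        cr (v 1) (v 2) = rscl (\<epsilon> 3) (v 3) \<and>
        cr (v 2) (v 3) = rscl (\<epsilon> 1) (v 1) \<and>
        cr (v 3) (v 1) = rscl (\<epsilon> 2) (v 2))"

definition bracket_operator ::
  "'a::topological_space lie_data \<Rightarrow> 'a form2 \<Rightarrow> ('a vfield \<Rightarrow> 'a vfield \<Rightarrow> 'a vfield \<Rightarrow> real) \<Rightarrow>
   ('a vfield \<Rightarrow> 'a vfield) \<Rightarrow> bool" where
  "bracket_operator G g \<omega> L \<longleftrightarrow> endo G L \<and>
     (\<exists>cr. cross_product G g \<omega> cr \<and>
           (\<forall>u\<in>lie_alg G. \<forall>v\<in>lie_alg G. lie_bracket G u v = L (cr u v)))"

definition L2 :: "real \<Rightarrow> real \<Rightarrow> real \<Rightarrow> real^3^3" where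
  "L2 \<alpha> \<beta> \<gamma> = vector [vector [\<gamma>, 0, 0], vector [0, \<alpha>, - \<beta>], vector [0, \<beta>, \<alpha>]]"

definition second_class ::
  "'a::topological_space lie_data \<Rightarrow> 'a form2 \<Rightarrow> ('a vfield \<Rightarrow> 'a vfield) \<Rightarrow> bool" where
  "second_class G g L \<longleftrightarrow>
     (\<exists>v \<epsilon> \<alpha> \<beta> \<gamma>. orthonormal_basis G g v \<epsilon> \<and> \<epsilon> 1 = \<epsilon> 2 \<and> \<epsilon> 2 = - \<epsilon> 3 \<and> \<beta> \<noteq> 0 \<and>
        (\<forall>a. L (v a) = (\<Sum>b\<in>UNIV. rscl (L2 \<alpha> \<beta> \<gamma> $ b $ a) (v b))))"


section \<open>The Courant algebroid \<open>E\<^bsub>H,F\<^esub>\<close>\<close>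

type_synonym 'a sect = "'a vfield \<times> 'a form1 \<times> ('a \<Rightarrow> real)"

definition sections :: "'a::topological_space lie_data \<Rightarrow> 'a sect set" where
  "sections G = vfields G \<times> forms1 G \<times> cinf G"

fun smul_sect :: "('a \<Rightarrow> real) \<Rightarrow> 'a sect \<Rightarrow> 'a sect" where
  "smul_sect f (X, \<xi>, l) = (smul f X, smul f \<xi>, f * l)"

fun anchor :: "'a sect \<Rightarrow> 'a vfield" where
  "anchor (X, \<xi>, l) = X"

fun pairing :: "'a sect \<Rightarrow> 'a sect \<Rightarrow> 'a \<Rightarrow> real" where
  "pairing (X, \<xi>, l) (Y, \<eta>, m) = (\<lambda>p. (\<xi> Y p + \<eta> X p) / 2 + l p * m p)"

text \<open>The interior products are \<open>i\<^sub>X i\<^sub>Y H = H(Y, X, \<cdot>)\<close> and \<open>i\<^sub>X F = F(X, \<cdot>)\<close>.\<close>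

fun dorfman :: "'a::topological_space lie_data \<Rightarrow> 'a form3 \<Rightarrow> 'a form2 \<Rightarrow> 'a sect \<Rightarrow> 'a sect \<Rightarrow> 'a sect" where
  "dorfman G H F (X, \<xi>, l) (Y, \<eta>, m) =
     (lie_bracket G X Y,
      form1_of G (\<lambda>Z. lie_der1 G X \<eta> Z - d1 G \<xi> Y Z + 2 * m * Z l + H Y X Z
                       - 2 * (m * F X Z - l * F Y Z)),
      X m - Y l + F X Y)"

definition left_inv_sections :: "'a::topological_space lie_data \<Rightarrow> 'a sect set" where
  "left_inv_sections G = {(X, \<xi>, l) \<in> sections G.
     X \<in> lie_alg G \<and> left_inv1 G \<xi> \<and> (\<forall>a p. l (gmult G a p) = l p)}"

definition E_minus :: "'a::topological_space lie_data \<Rightarrow> 'a form2 \<Rightarrow> 'a sect set" where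
  "E_minus G g = {(X, form1_of G (- g X), 0) | X. X \<in> vfields G}"

definition E_plus :: "'a::topological_space lie_data \<Rightarrow> 'a form2 \<Rightarrow> 'a sect set" where
  "E_plus G g = {u \<in> sections G. \<forall>w\<in>E_minus G g. pairing u w = 0}"


section \<open>Generalized connections and the odd generalized Einstein condition\<close>

definition gen_connection :: "'a::topological_space lie_data \<Rightarrow> ('a sect \<Rightarrow> 'a sect \<Rightarrow> 'a sect) \<Rightarrow> bool" where
  "gen_connection G D \<longleftrightarrow>
     (\<forall>u\<in>sections G. \<forall>v\<in>sections G. D u v \<in> sections G) \<and>
     (\<forall>u\<in>sections G. \<forall>v\<in>sections G. \<forall>w\<in>sections G.
        D (u + v) w = D u w + D v w \<and> D u (v + w) = D u v + D u w) \<and>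
     (\<forall>f\<in>cinf G. \<forall>u\<in>sections G. \<forall>v\<in>sections G.
        D (smul_sect f u) v = smul_sect f (D u v) \<and>
        D u (smul_sect f v) = smul_sect (anchor u f) v + smul_sect f (D u v)) \<and>
     (\<forall>u\<in>sections G. \<forall>v\<in>sections G. \<forall>w\<in>sections G.
        anchor u (pairing v w) = pairing (D u v) w + pairing v (D u w))"

definition torsion ::
  "'a::topological_space lie_data \<Rightarrow> 'a form3 \<Rightarrow> 'a form2 \<Rightarrow> ('a sect \<Rightarrow> 'a sect \<Rightarrow> 'a sect) \<Rightarrow>
   'a sect \<Rightarrow> 'a sect \<Rightarrow> 'a sect \<Rightarrow> 'a \<Rightarrow> real" where
  "torsion G H F D u v w = pairing (D u v - D v u - dorfman G H F u v) w + pairing v (D w u)"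

definition levi_civita ::
  "'a::topological_space lie_data \<Rightarrow> 'a form3 \<Rightarrow> 'a form2 \<Rightarrow> 'a form2 \<Rightarrow>
   ('a sect \<Rightarrow> 'a sect \<Rightarrow> 'a sect) \<Rightarrow> bool" where
  "levi_civita G H F g D \<longleftrightarrow> gen_connection G D \<and>
     (\<forall>u\<in>sections G. \<forall>v\<in>sections G. \<forall>w\<in>sections G. torsion G H F D u v w = 0) \<and>
     (\<forall>u\<in>sections G. \<forall>v\<in>E_minus G g. D u v \<in> E_minus G g)"

definition divergence_operator :: "'a::topological_space lie_data \<Rightarrow> ('a sect \<Rightarrow> 'a \<Rightarrow> real) \<Rightarrow> bool" where
  "divergence_operator G \<delta> \<longleftrightarrow>
     (\<forall>u\<in>sections G. \<delta> u \<in> cinf G) \<and>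
     (\<forall>u\<in>sections G. \<forall>v\<in>sections G. \<delta> (u + v) = \<delta> u + \<delta> v) \<and>
     (\<forall>f\<in>cinf G. \<forall>u\<in>sections G. \<delta> (smul_sect f u) = anchor u f + f * \<delta> u)"

definition left_inv_divergence :: "'a::topological_space lie_data \<Rightarrow> ('a sect \<Rightarrow> 'a \<Rightarrow> real) \<Rightarrow> bool" where
  "left_inv_divergence G \<delta> \<longleftrightarrow> divergence_operator G \<delta> \<and>
     (\<forall>u\<in>left_inv_sections G. \<exists>c. \<delta> u = (\<lambda>_. c))"

definition div_of :: "'a::topological_space lie_data \<Rightarrow> ('a sect \<Rightarrow> 'a sect \<Rightarrow> 'a sect) \<Rightarrow> 'a sect \<Rightarrow> 'a \<Rightarrow> real" where
  "div_of G D u = module_trace smul_sect (cinf G) (sections G) (\<lambda>w. D w u)"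

definition curvature ::
  "'a::topological_space lie_data \<Rightarrow> 'a form3 \<Rightarrow> 'a form2 \<Rightarrow> ('a sect \<Rightarrow> 'a sect \<Rightarrow> 'a sect) \<Rightarrow>
   'a sect \<Rightarrow> 'a sect \<Rightarrow> 'a sect \<Rightarrow> 'a sect" where
  "curvature G H F D u v w = D u (D v w) - D v (D u w) - D (dorfman G H F u v) w"

definition ric_plus ::
  "'a::topological_space lie_data \<Rightarrow> 'a form3 \<Rightarrow> 'a form2 \<Rightarrow> 'a form2 \<Rightarrow>
   ('a sect \<Rightarrow> 'a sect \<Rightarrow> 'a sect) \<Rightarrow> 'a sect \<Rightarrow> 'a sect \<Rightarrow> 'a \<Rightarrow> real" where
  "ric_plus G H F g D u v =
     module_trace smul_sect (cinf G) (E_plus G g) (\<lambda>w. curvature G H F D w u v)"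

definition ric_minus ::
  "'a::topological_space lie_data \<Rightarrow> 'a form3 \<Rightarrow> 'a form2 \<Rightarrow> 'a form2 \<Rightarrow>
   ('a sect \<Rightarrow> 'a sect \<Rightarrow> 'a sect) \<Rightarrow> 'a sect \<Rightarrow> 'a sect \<Rightarrow> 'a \<Rightarrow> real" where
  "ric_minus G H F g D u v =
     module_trace smul_sect (cinf G) (E_minus G g) (\<lambda>w. curvature G H F D w u v)"

text \<open>The two Ricci tensors do not depend on the choice of the Levi-Civita generalized connection
  with the prescribed divergence, and such a connection exists. Hence the choice of quantifier for
  \<open>D\<close> is immaterial.\<close>

definition odd_generalized_einstein ::
  "'a::topological_space lie_data \<Rightarrow> 'a form3 \<Rightarrow> 'a form2 \<Rightarrow> 'a form2 \<Rightarrow> ('a sect \<Rightarrow> 'a \<Rightarrow> real) \<Rightarrow> bool" where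
  "odd_generalized_einstein G H F g \<delta> \<longleftrightarrow>
     (\<exists>D. levi_civita G H F g D \<and> (\<forall>u\<in>sections G. div_of G D u = \<delta> u) \<and>
          (\<forall>u\<in>E_minus G g. \<forall>v\<in>E_plus G g. ric_plus G H F g D u v = 0) \<and>
          (\<forall>u\<in>E_plus G g. \<forall>v\<in>E_minus G g. ric_minus G H F g D u v = 0))"

end

theory Submission
  imports Defs
begin

text \<open>
  The Einstein condition is turned into polynomial equations between finitely many constants, and
  for an operator \<open>L\<close> of the second class these equations force \<open>F = 0\<close>.

  Let \<open>v\<close> be the orthonormal basis in which \<open>L = L2 \<alpha> \<beta> \<gamma>\<close>. The sections \<open>v\<^sub>a + g(v\<^sub>a)\<close> and \<open>1\<close>
  form a frame of \<open>E\<^sub>+\<close> and the sections \<open>v\<^sub>a - g(v\<^sub>a)\<close> form a frame of \<open>E\<^sub>-\<close>. Together they are a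
  pseudo-orthonormal frame \<open>e\<close> of \<open>E\<close> with signs \<open>\<sigma>\<close>. The numbers
  \<open>B(A,A',A'') = \<langle>[e\<^sub>A, e\<^sub>A'], e\<^sub>A''\<rangle>\<close> are constant and totally antisymmetric, and they are expressed by
  the components of the Lie bracket, of \<open>H\<close> and of \<open>F\<close> (\<open>dorfman_frame_pairing\<close>).

  A Levi-Civita generalized connection \<open>D\<close> with given divergence \<open>\<delta>\<close> is neither unique nor
  left-invariant, so its components are functions about which little is known. But \<open>T\<^sup>D = 0\<close>
  determines \<open>D\<^sub>u x\<close> when \<open>u\<close> and \<open>x\<close> lie in different halves of \<open>E = E\<^sub>+ \<oplus> E\<^sub>-\<close>: it is the
  projection of \<open>[u, x]\<close> (\<open>\<Gamma>_mixed\<close>). When the trace of the curvature is expanded, every other component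
  cancels or combines to a divergence (\<open>ricci_frame\<close>). If \<open>S\<close> indexes the frame of one half, then for
  \<open>u\<close> not in \<open>S\<close> and \<open>x\<close> in \<open>S\<close>
  \<open>Ric(u, x) = (\<Sum>k\<in>S. \<sigma>\<^sub>k B(u,x,k) \<delta>(e\<^sub>k)) - (\<Sum>i\<in>S. \<Sum>j\<notin>S. \<sigma>\<^sub>i \<sigma>\<^sub>j B(i,u,j) B(j,x,i))\<close>.
  The double sums of \<open>Ric\<^sup>+\<close> and \<open>Ric\<^sup>-\<close> agree, so that there are two expressions for the same quantity
  \<open>Q(u, x)\<close>, one with the divergences on \<open>E\<^sub>+\<close> and one with those on \<open>E\<^sub>-\<close>.

  Twelve of these equations suffice (\<open>second_class_equations\<close>). The entries \<open>(2,3)\<close> and \<open>(3,2)\<close> of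
  the symmetric matrix \<open>Q\<close> are opposite multiples of \<open>s m\<^sub>1\<close>, where \<open>m\<^sub>1 = \<delta>(v\<^sub>1 - g(v\<^sub>1))\<close> and \<open>2 s\<close> is
  \<open>- \<gamma> - H(v\<^sub>1,v\<^sub>2,v\<^sub>3)\<close>. Hence \<open>m\<^sub>1 = 0\<close> or \<open>s = 0\<close>. In the first case the diagonal entries give
  \<open>F\<^sub>3\<^sub>1\<^sup>2 + F\<^sub>1\<^sub>2\<^sup>2 = 0\<close>, and \<open>F\<^sub>2\<^sub>3 \<noteq> 0\<close> would imply \<open>s = 0\<close> and then \<open>\<beta> = 0\<close> by the entry \<open>(1,1)\<close>.
  In the second case the entries in the first row and column show \<open>F\<^sub>2\<^sub>3 = 0\<close>, an entry of \<open>Ric\<^sup>+\<close> shows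
  \<open>\<gamma> = H(v\<^sub>1,v\<^sub>2,v\<^sub>3)\<close>, and the diagonal entries then contradict \<open>\<beta> \<noteq> 0\<close>.

  What has to be prepared is that \<open>v\<close> is a frame of the module of all vector fields, so that traces over
  \<open>C\<^sup>\<infinity>(G)\<close> can be computed in \<open>e\<close>. At each point the \<open>v\<^sub>a\<close> are independent because a left-invariant
  vector field with a zero vanishes, and the coefficients of a vector field are smooth by Cramer's rule in
  a chart.
\<close>

section \<open>Continuously differentiable functions\<close>

lemma Ck_on_subset: "Ck_on k S f \<Longrightarrow> T \<subseteq> S \<Longrightarrow> Ck_on k T f"
proof (induction k arbitrary: f)
  case 0 then show ?case by (auto intro: continuous_on_subset)
next
  case (Suc k)
  then show ?case by (simp add: subset_iff) metis
qed

lemma Ck_on_imp_continuous_on: "Ck_on k S f \<Longrightarrow> continuous_on S f"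
  by (cases k) (auto intro!: continuous_at_imp_continuous_on dest: has_derivative_continuous)

lemma Ck_on_SucD: "Ck_on (Suc k) S f \<Longrightarrow> Ck_on k S f"
proof (induction k arbitrary: f)
  case 0 then show ?case using Ck_on_imp_continuous_on by (metis Ck_on.simps(1))
next
  case (Suc k)
  from Suc.prems obtain f' where f': "\<forall>x\<in>S. (f has_derivative f' x) (at x)" "\<forall>v. Ck_on (Suc k) S (\<lambda>x. f' x v)"
    by (subst (asm) Ck_on.simps) blast
  then show ?case using Suc.IH by (auto simp del: Ck_on.simps simp: Ck_on.simps(2)[of k])
qed

lemma Ck_on_cong:
  assumes "open S" "\<And>x. x \<in> S \<Longrightarrow> f x = g x" "Ck_on k S f"
  shows "Ck_on k S g"
proof (cases k)
  case 0 with assms show ?thesis by (metis Ck_on.simps(1) continuous_on_cong)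
next
  case (Suc n)
  with assms(3) obtain f' where f': "\<forall>x\<in>S. (f has_derivative f' x) (at x)" "\<forall>v. Ck_on n S (\<lambda>x. f' x v)"
    by auto
  have "(g has_derivative f' x) (at x)" if "x \<in> S" for x
    using f'(1) that assms by (metis has_derivative_transform_within_open)
  with f'(2) Suc show ?thesis by auto
qed

lemma Ck_on_const: "Ck_on k S (\<lambda>x. c)"
proof (induction k arbitrary: c)
  case (Suc k)
  have "\<forall>x\<in>S. ((\<lambda>x. c) has_derivative (\<lambda>v. 0)) (at x)" by simp
  with Suc[of 0] show ?case by (auto intro!: exI[of _ "\<lambda>x v. 0"])
qed simp

lemma Ck_on_bounded_linear:
  assumes "bounded_linear h" shows "Ck_on k S f \<Longrightarrow> Ck_on k S (\<lambda>x. h (f x))"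
proof (induction k arbitrary: f)
  case 0 then show ?case using assms by (auto intro: bounded_linear.continuous_on)
next
  case (Suc k)
  then obtain f' where f': "\<forall>x\<in>S. (f has_derivative f' x) (at x)" "\<forall>v. Ck_on k S (\<lambda>x. f' x v)"
    by auto
  with Suc.IH show ?case
    by (auto intro!: exI[of _ "\<lambda>x v. h (f' x v)"] bounded_linear.has_derivative[OF assms])
qed

lemma Ck_on_add: "Ck_on k S f \<Longrightarrow> Ck_on k S g \<Longrightarrow> Ck_on k S (\<lambda>x. f x + g x)"
proof (induction k arbitrary: f g)
  case 0 then show ?case by (auto intro: continuous_intros)
next
  case (Suc k)
  then obtain f' g' where f': "\<forall>x\<in>S. (f has_derivative f' x) (at x)" "\<forall>v. Ck_on k S (\<lambda>x. f' x v)"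
    and g': "\<forall>x\<in>S. (g has_derivative g' x) (at x)" "\<forall>v. Ck_on k S (\<lambda>x. g' x v)"
    by auto
  with Suc.IH show ?case
    by (auto intro!: exI[of _ "\<lambda>x v. f' x v + g' x v"] derivative_intros)
qed

lemma Ck_on_mult:
  fixes f g :: "_ \<Rightarrow> real"
  shows "Ck_on k S f \<Longrightarrow> Ck_on k S g \<Longrightarrow> Ck_on k S (\<lambda>x. f x * g x)"
proof (induction k arbitrary: f g)
  case 0 then show ?case by (auto intro: continuous_intros)
next
  case (Suc k)
  from Suc.prems have low: "Ck_on k S f" "Ck_on k S g" by (auto intro: Ck_on_SucD simp del: Ck_on.simps)
  from Suc.prems obtain f' g' where f': "\<forall>x\<in>S. (f has_derivative f' x) (at x)" "\<forall>v. Ck_on k S (\<lambda>x. f' x v)"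
    and g': "\<forall>x\<in>S. (g has_derivative g' x) (at x)" "\<forall>v. Ck_on k S (\<lambda>x. g' x v)"
    by auto
  with Suc.IH low show ?case
    by (auto intro!: exI[of _ "\<lambda>x v. f x * g' x v + f' x v * g x"] derivative_eq_intros Ck_on_add)
qed

text \<open>The derivative \<open>- f' / f\<^sup>2\<close> is of class \<open>C\<^sup>k\<close> as soon as \<open>1 / f\<close> is, which closes the induction on \<open>k\<close>.\<close>

lemma Ck_on_inverse:
  fixes f :: "_ \<Rightarrow> real"
  assumes nz: "\<And>x. x \<in> S \<Longrightarrow> f x \<noteq> 0"
  shows "Ck_on k S f \<Longrightarrow> Ck_on k S (\<lambda>x. inverse (f x))"
proof (induction k)
  case 0 then show ?case using nz by (auto intro: continuous_intros)
next
  case (Suc k)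
  from Suc have low: "Ck_on k S (\<lambda>x. inverse (f x))" by (auto intro: Ck_on_SucD simp del: Ck_on.simps)
  from Suc.prems obtain f' where f': "\<forall>x\<in>S. (f has_derivative f' x) (at x)" "\<forall>v. Ck_on k S (\<lambda>x. f' x v)"
    by auto
  let ?d = "\<lambda>x v. - 1 * (inverse (f x) * f' x v * inverse (f x))"
  have "\<forall>x\<in>S. ((\<lambda>x. inverse (f x)) has_derivative ?d x) (at x)"
    using f'(1) nz by (auto intro!: derivative_eq_intros)
  moreover have "\<forall>v. Ck_on k S (\<lambda>x. ?d x v)"
    using f'(2) low by (intro allI Ck_on_mult Ck_on_const) auto
  ultimately show ?case unfolding Ck_on.simps by (intro exI[of _ ?d] conjI)
qed

text \<open>Smoothness is a local property, since the derivative at a point is determined by the germ.\<close>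

lemma Ck_on_local:
  assumes "\<And>x. x \<in> S \<Longrightarrow> \<exists>T. open T \<and> x \<in> T \<and> Ck_on k T f"
  shows "Ck_on k S f"
  using assms
proof (induction k arbitrary: f)
  case 0
  then show ?case
    by (metis Ck_on.simps(1) continuous_at_imp_continuous_on continuous_on_eq_continuous_at)
next
  case (Suc k)
  let ?d = "\<lambda>x. frechet_derivative f (at x)"
  have *: "(f has_derivative ?d x) (at x) \<and> (\<exists>T. open T \<and> x \<in> T \<and> (\<forall>v. Ck_on k T (\<lambda>x. ?d x v)))" if x: "x \<in> S" for x
  proof -
    from Suc.prems[OF x] obtain T f' where T: "open T" "x \<in> T"
      and f': "\<forall>x\<in>T. (f has_derivative f' x) (at x)" "\<forall>v. Ck_on k T (\<lambda>x. f' x v)" by auto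
    have eq: "?d y = f' y" if "y \<in> T" for y using f'(1) that frechet_derivative_at by metis
    have "Ck_on k T (\<lambda>x. ?d x v)" for v
      by (rule Ck_on_cong[OF T(1) _ f'(2)[rule_format, of v]]) (simp add: eq)
    with T f'(1) eq show ?thesis by auto
  qed
  have "\<forall>v. Ck_on k S (\<lambda>x. ?d x v)" using * by (intro allI Suc.IH) blast
  with * show ?case unfolding Ck_on.simps by (intro exI[of _ ?d]) blast
qed

section \<open>The trace in a basis over a ring\<close>

text \<open>Coordinates are functions extended by \<open>undefined\<close> off the index set, so uniqueness can only be
  read off on that set.\<close>

lemma is_basisD:
  assumes "is_basis scl R M J f"
    and "(\<Sum>i\<in>J. scl (c i) (f i)) = (\<Sum>i\<in>J. scl (c' i) (f i))" "(\<Sum>i\<in>J. scl (c i) (f i)) \<in> M"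
    and "\<And>i. i \<in> J \<Longrightarrow> c i \<in> R" "\<And>i. i \<in> J \<Longrightarrow> c' i \<in> R" and "i \<in> J"
  shows "c i = c' i"
proof -
  let ?x = "\<Sum>i\<in>J. scl (c i) (f i)"
  let ?P = "\<lambda>c. c \<in> J \<rightarrow>\<^sub>E R \<and> ?x = (\<Sum>i\<in>J. scl (c i) (f i))"
  have ex: "\<exists>!c. ?P c" using assms(1,3) unfolding is_basis_def by blast
  have "?P (restrict c J)" using assms(4) by (auto intro!: sum.cong)
  moreover have "?P (restrict c' J)" unfolding assms(2) using assms(5) by (auto intro!: sum.cong)
  ultimately have "restrict c J = restrict c' J" using ex by blast
  then show ?thesis using \<open>i \<in> J\<close> by (metis restrict_apply')
qed

lemma is_basis_coeffs:
  assumes "is_basis scl R M J f" "x \<in> M"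
  obtains c where "\<And>i. i \<in> J \<Longrightarrow> c i \<in> R" "x = (\<Sum>i\<in>J. scl (c i) (f i))"
  using assms unfolding is_basis_def by (metis PiE_mem)

text \<open>The trace does not depend on the basis: if \<open>P\<close> and \<open>Q\<close> are the mutually inverse matrices of the
  change to a basis in which \<open>T\<close> has the matrix \<open>A'\<close>, then \<open>P A' = A P\<close>, so that
  \<open>tr A' = tr (Q P A') = tr (Q A P) = tr (A P Q) = tr A\<close>. The matrices need not be square for this, hence
  bases of different lengths are covered. The linearity of \<open>T\<close> is asked for only on combinations of the
  given basis.\<close>

lemma module_trace_eq:
  fixes scl :: "'s::comm_ring_1 \<Rightarrow> 'v \<Rightarrow> 'v::ab_group_add" and e :: "'i \<Rightarrow> 'v"
  assumes mod: "module scl"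
    and R: "0 \<in> R" "1 \<in> R" "\<And>x y. x \<in> R \<Longrightarrow> y \<in> R \<Longrightarrow> x + y \<in> R" "\<And>x y. x \<in> R \<Longrightarrow> y \<in> R \<Longrightarrow> x * y \<in> R"
    and e: "is_basis scl R M I e"
    and A: "\<And>i j. i \<in> I \<Longrightarrow> j \<in> I \<Longrightarrow> A i j \<in> R"
    and Te: "\<And>j. j \<in> I \<Longrightarrow> T (e j) = (\<Sum>i\<in>I. scl (A i j) (e i))"
    and T: "\<And>c. (\<And>i. i \<in> I \<Longrightarrow> c i \<in> R) \<Longrightarrow> T (\<Sum>i\<in>I. scl (c i) (e i)) = (\<Sum>i\<in>I. scl (c i) (T (e i)))"
    and TM: "\<And>x. x \<in> M \<Longrightarrow> T x \<in> M"
  shows "module_trace scl R M T = (\<Sum>i\<in>I. A i i)"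
proof -
  interpret module scl by (rule mod)
  have fin: "finite I" and eM: "\<And>i. i \<in> I \<Longrightarrow> e i \<in> M" using e by (auto simp: is_basis_def)
  have sumR: "(\<Sum>i\<in>J. f i) \<in> R" if "\<And>i. i \<in> J \<Longrightarrow> f i \<in> R" for J and f :: "'j \<Rightarrow> 's"
    using that by (induction J rule: infinite_finite_induct) (auto simp: R)
  have swap: "(\<Sum>i\<in>J. scl (a i) (\<Sum>k\<in>K. scl (b k i) (f k))) = (\<Sum>k\<in>K. scl (\<Sum>i\<in>J. b k i * a i) (f k))"
    for J K a b and f :: "'k \<Rightarrow> 'v"
    unfolding scale_sum_right scale_scale scale_sum_left
    by (subst sum.swap) (simp add: mult.commute)
  have invariant: "(\<Sum>i\<in>J. A' i i) = (\<Sum>i\<in>I. A i i)"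
    if e': "is_basis scl R M J e'" and A': "\<And>i j. i \<in> J \<Longrightarrow> j \<in> J \<Longrightarrow> A' i j \<in> R"
      and Te': "\<And>j. j \<in> J \<Longrightarrow> T (e' j) = (\<Sum>i\<in>J. scl (A' i j) (e' i))"
    for J :: "nat set" and e' A'
  proof -
    have e'M: "\<And>i. i \<in> J \<Longrightarrow> e' i \<in> M" using e' by (auto simp: is_basis_def)
    \<comment> \<open>The two matrices of the change of basis.\<close>
    have "\<exists>P. \<forall>j\<in>J. (\<forall>i\<in>I. P i j \<in> R) \<and> e' j = (\<Sum>i\<in>I. scl (P i j) (e i))"
    proof -
      have "\<forall>j\<in>J. \<exists>p. (\<forall>i\<in>I. p i \<in> R) \<and> e' j = (\<Sum>i\<in>I. scl (p i) (e i))"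
        by (metis is_basis_coeffs[OF e] e'M)
      then obtain p where "\<forall>j\<in>J. (\<forall>i\<in>I. p j i \<in> R) \<and> e' j = (\<Sum>i\<in>I. scl (p j i) (e i))"
        by metis
      then show ?thesis by (intro exI[of _ "\<lambda>i j. p j i"])
    qed
    then obtain P where P: "\<And>i j. i \<in> I \<Longrightarrow> j \<in> J \<Longrightarrow> P i j \<in> R"
      and e'P: "\<And>j. j \<in> J \<Longrightarrow> e' j = (\<Sum>i\<in>I. scl (P i j) (e i))" by metis
    have "\<exists>Q. \<forall>j\<in>I. (\<forall>i\<in>J. Q i j \<in> R) \<and> e j = (\<Sum>i\<in>J. scl (Q i j) (e' i))"
    proof -
      have "\<forall>j\<in>I. \<exists>p. (\<forall>i\<in>J. p i \<in> R) \<and> e j = (\<Sum>i\<in>J. scl (p i) (e' i))"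
        by (metis is_basis_coeffs[OF e'] eM)
      then obtain p where "\<forall>j\<in>I. (\<forall>i\<in>J. p j i \<in> R) \<and> e j = (\<Sum>i\<in>J. scl (p j i) (e' i))"
        by metis
      then show ?thesis by (intro exI[of _ "\<lambda>i j. p j i"])
    qed
    then obtain Q where Q: "\<And>i j. i \<in> J \<Longrightarrow> j \<in> I \<Longrightarrow> Q i j \<in> R"
      and eQ: "\<And>j. j \<in> I \<Longrightarrow> e j = (\<Sum>i\<in>J. scl (Q i j) (e' i))" by metis
    have QP: "(\<Sum>i\<in>I. Q k i * P i j) = (if k = j then 1 else 0)" if "k \<in> J" "j \<in> J" for k j
    proof (rule is_basisD[OF e' _ _ _ _ that(1)])
      have "(\<Sum>k\<in>J. scl (\<Sum>i\<in>I. Q k i * P i j) (e' k)) = (\<Sum>i\<in>I. scl (P i j) (e i))"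
        by (simp add: swap[symmetric] eQ)
      also have "\<dots> = e' j" using e'P that by simp
      finally have *: "(\<Sum>k\<in>J. scl (\<Sum>i\<in>I. Q k i * P i j) (e' k)) = e' j" .
      also have "\<dots> = (\<Sum>k\<in>J. scl (if k = j then 1 else 0) (e' k))"
        using that e' by (subst sum.remove[of _ j]) (auto simp: is_basis_def intro!: sum.neutral[symmetric])
      finally show "(\<Sum>k\<in>J. scl (\<Sum>i\<in>I. Q k i * P i j) (e' k)) = (\<Sum>k\<in>J. scl (if k = j then 1 else 0) (e' k))" .
      show "(\<Sum>k\<in>J. scl (\<Sum>i\<in>I. Q k i * P i j) (e' k)) \<in> M" using * e'M that by simp
    qed (use that in \<open>auto intro!: sumR R Q P\<close>)
    have PQ: "(\<Sum>k\<in>J. P m k * Q k i) = (if m = i then 1 else 0)" if "m \<in> I" "i \<in> I" for m i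
    proof (rule is_basisD[OF e _ _ _ _ that(1)])
      have "(\<Sum>m\<in>I. scl (\<Sum>k\<in>J. P m k * Q k i) (e m)) = (\<Sum>k\<in>J. scl (Q k i) (e' k))"
        by (simp add: swap[symmetric] e'P)
      also have "\<dots> = e i" using eQ that by simp
      finally have *: "(\<Sum>m\<in>I. scl (\<Sum>k\<in>J. P m k * Q k i) (e m)) = e i" .
      also have "\<dots> = (\<Sum>m\<in>I. scl (if m = i then 1 else 0) (e m))"
        using that fin by (subst sum.remove[of _ i]) (auto intro!: sum.neutral[symmetric])
      finally show "(\<Sum>m\<in>I. scl (\<Sum>k\<in>J. P m k * Q k i) (e m)) = (\<Sum>m\<in>I. scl (if m = i then 1 else 0) (e m))" .
      show "(\<Sum>m\<in>I. scl (\<Sum>k\<in>J. P m k * Q k i) (e m)) \<in> M" using * eM that by simp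
    qed (use that in \<open>auto intro!: sumR R Q P\<close>)
    have intertwine: "(\<Sum>k\<in>J. P i k * A' k j) = (\<Sum>m\<in>I. A i m * P m j)" if "i \<in> I" "j \<in> J" for i j
    proof (rule is_basisD[OF e _ _ _ _ that(1)])
      have "(\<Sum>i\<in>I. scl (\<Sum>k\<in>J. P i k * A' k j) (e i)) = T (e' j)"
        by (simp add: swap[symmetric] e'P[symmetric] Te' that)
      moreover have "T (e' j) = (\<Sum>i\<in>I. scl (\<Sum>m\<in>I. A i m * P m j) (e i))"
        using that P T[of "\<lambda>i. P i j"] by (simp add: swap[symmetric] Te[symmetric] e'P)
      moreover have "T (e' j) \<in> M" using TM e'M that by blast
      ultimately show "(\<Sum>i\<in>I. scl (\<Sum>k\<in>J. P i k * A' k j) (e i)) = (\<Sum>i\<in>I. scl (\<Sum>m\<in>I. A i m * P m j) (e i))"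
        and "(\<Sum>i\<in>I. scl (\<Sum>k\<in>J. P i k * A' k j) (e i)) \<in> M"
        by simp_all
    qed (use that in \<open>auto intro!: sumR R Q P A A'\<close>)
    have finJ: "finite J" using e' by (simp add: is_basis_def)
    have "(\<Sum>j\<in>J. A' j j) = (\<Sum>j\<in>J. \<Sum>k\<in>J. (if j = k then 1 else 0) * A' k j)"
      using finJ by (simp add: if_distrib[of "\<lambda>x. x * _"] sum.delta cong: if_cong)
    also have "\<dots> = (\<Sum>j\<in>J. \<Sum>k\<in>J. (\<Sum>i\<in>I. Q j i * P i k) * A' k j)" by (simp add: QP)
    also have "\<dots> = (\<Sum>j\<in>J. \<Sum>i\<in>I. Q j i * (\<Sum>k\<in>J. P i k * A' k j))"
      unfolding sum_distrib_left sum_distrib_right by (subst (2) sum.swap) (simp add: mult.assoc)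
    also have "\<dots> = (\<Sum>j\<in>J. \<Sum>i\<in>I. Q j i * (\<Sum>m\<in>I. A i m * P m j))" by (simp add: intertwine)
    also have "\<dots> = (\<Sum>i\<in>I. \<Sum>j\<in>J. \<Sum>m\<in>I. A i m * (P m j * Q j i))"
      unfolding sum_distrib_left by (subst sum.swap) (simp add: ac_simps)
    also have "\<dots> = (\<Sum>i\<in>I. \<Sum>m\<in>I. A i m * (\<Sum>j\<in>J. P m j * Q j i))"
      unfolding sum_distrib_left by (rule sum.cong[OF refl], rule sum.swap)
    also have "\<dots> = (\<Sum>i\<in>I. \<Sum>m\<in>I. A i m * (if m = i then 1 else 0))" by (simp add: PQ)
    also have "\<dots> = (\<Sum>i\<in>I. A i i)"
      using fin by (simp add: if_distrib[of "\<lambda>x. _ * x"] sum.delta cong: if_cong)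
    finally show ?thesis .
  qed
  obtain b where b: "bij_betw b {..<card I} I"
    using fin ex_bij_betw_nat_finite by (metis lessThan_atLeast0)
  have reindex: "(\<Sum>i<card I. f (b i)) = (\<Sum>i\<in>I. f i)" for f :: "'i \<Rightarrow> 'w::comm_monoid_add"
    by (rule sum.reindex_bij_betw[OF b])
  have bI: "b i \<in> I" if "i < card I" for i using b that by (auto simp: bij_betw_def)
  have basis: "is_basis scl R M {..<card I} (\<lambda>i. e (b i))"
    unfolding is_basis_def
  proof (intro conjI ballI)
    fix x assume x: "x \<in> M"
    from is_basis_coeffs[OF e x] obtain c where c: "\<And>i. i \<in> I \<Longrightarrow> c i \<in> R" "x = (\<Sum>i\<in>I. scl (c i) (e i))"
      by metis
    show "\<exists>!c. c \<in> {..<card I} \<rightarrow>\<^sub>E R \<and> x = (\<Sum>i<card I. scl (c i) (e (b i)))"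
    proof (rule ex1I)
      have "(\<Sum>i<card I. scl (restrict (c \<circ> b) {..<card I} i) (e (b i))) = (\<Sum>i<card I. scl (c (b i)) (e (b i)))"
        by (rule sum.cong) auto
      also have "\<dots> = x" using c(2) reindex[of "\<lambda>i. scl (c i) (e i)"] by simp
      finally show "restrict (c \<circ> b) {..<card I} \<in> {..<card I} \<rightarrow>\<^sub>E R \<and>
          x = (\<Sum>i<card I. scl (restrict (c \<circ> b) {..<card I} i) (e (b i)))"
        using c(1) bI by (simp add: restrict_PiE_iff)
    next
      fix d assume dd: "d \<in> {..<card I} \<rightarrow>\<^sub>E R \<and> x = (\<Sum>i<card I. scl (d i) (e (b i)))"
      then have dR: "d \<in> {..<card I} \<rightarrow>\<^sub>E R" and dx: "x = (\<Sum>i<card I. scl (d i) (e (b i)))" by blast+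
      let ?d = "\<lambda>i. d (inv_into {..<card I} b i)"
      have inv: "inv_into {..<card I} b (b i) = i" if "i < card I" for i
        using b that by (auto simp: bij_betw_def inv_into_f_f)
      have eq: "c i = ?d i" if "i \<in> I" for i
      proof (rule is_basisD[OF e _ _ c(1) _ that])
        have "x = (\<Sum>i<card I. scl (?d (b i)) (e (b i)))" using dx inv by simp
        then show "(\<Sum>i\<in>I. scl (c i) (e i)) = (\<Sum>i\<in>I. scl (?d i) (e i))"
          using c(2) reindex[of "\<lambda>i. scl (?d i) (e i)"] by simp
        show "(\<Sum>i\<in>I. scl (c i) (e i)) \<in> M" using c(2) x by simp
        show "?d i \<in> R" if "i \<in> I" for i
        proof -
          have "inv_into {..<card I} b i \<in> {..<card I}" using b that by (metis bij_betw_imp_surj_on inv_into_into)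
          then show ?thesis using dR by (rule PiE_mem[rotated])
        qed
      qed
      show "d = restrict (c \<circ> b) {..<card I}"
      proof
        fix i show "d i = restrict (c \<circ> b) {..<card I} i"
          using PiE_arb[OF dR, of i] inv[of i] bI[of i] eq[of "b i"] by (cases "i < card I") simp_all
      qed
    qed
  qed (use bI eM in auto)
  show ?thesis
    unfolding module_trace_def
  proof (rule the_equality)
    show "\<exists>(n::nat) e' A'. is_basis scl R M {..<n} e' \<and> (\<forall>i<n. \<forall>j<n. A' i j \<in> R) \<and>
         (\<forall>j<n. T (e' j) = (\<Sum>i<n. scl (A' i j) (e' i))) \<and> (\<Sum>i\<in>I. A i i) = (\<Sum>i<n. A' i i)"
    proof (intro exI[of _ "card I"] exI[of _ "\<lambda>i. e (b i)"] exI[of _ "\<lambda>i j. A (b i) (b j)"] conjI allI impI)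
      show "T (e (b j)) = (\<Sum>i<card I. scl (A (b i) (b j)) (e (b i)))" if "j < card I" for j
        using Te[OF bI[OF that]] reindex[of "\<lambda>i. scl (A i (b j)) (e i)"] by simp
    qed (use basis bI A reindex[of "\<lambda>i. A i i"] in auto)
  next
    fix t
    assume "\<exists>(n::nat) e' A'. is_basis scl R M {..<n} e' \<and> (\<forall>i<n. \<forall>j<n. A' i j \<in> R) \<and>
         (\<forall>j<n. T (e' j) = (\<Sum>i<n. scl (A' i j) (e' i))) \<and> t = (\<Sum>i<n. A' i i)"
    then obtain n :: nat and e' A' where *: "is_basis scl R M {..<n} e'" "\<forall>i<n. \<forall>j<n. A' i j \<in> R"
       "\<forall>j<n. T (e' j) = (\<Sum>i<n. scl (A' i j) (e' i))" "t = (\<Sum>i<n. A' i i)"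
      by blast
    show "t = (\<Sum>i\<in>I. A i i)" unfolding *(4) by (rule invariant[OF *(1)]) (use * in auto)
  qed
qed


section \<open>Smooth functions on a manifold\<close>

lemma smooth_fun_onD:
  "smooth_fun_on G U f \<Longrightarrow> (V, \<phi>) \<in> charts G \<Longrightarrow> Ck_on k (\<phi> ` (U \<inter> V)) (f \<circ> inv_into V \<phi>)"
  unfolding smooth_fun_on_def smooth_on_def by blast

lemma smooth_fun_onI:
  "(\<And>V \<phi> k. (V, \<phi>) \<in> charts G \<Longrightarrow> Ck_on k (\<phi> ` (U \<inter> V)) (f \<circ> inv_into V \<phi>)) \<Longrightarrow> smooth_fun_on G U f"
  unfolding smooth_fun_on_def smooth_on_def by blast

lemma smooth_fun_on_subset: "smooth_fun_on G U f \<Longrightarrow> V \<subseteq> U \<Longrightarrow> smooth_fun_on G V f"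
  by (rule smooth_fun_onI, rule Ck_on_subset[OF smooth_fun_onD]) auto

locale smooth_manifold =
  fixes G :: "'a::{t2_space, second_countable_topology} lie_data"
  assumes atlas: "smooth_atlas (charts G)"
begin

lemma chart_at: obtains U \<phi> where "(U, \<phi>) \<in> charts G" "p \<in> U"
proof -
  have "p \<in> (\<Union>(U, \<phi>)\<in>charts G. U)" using atlas unfolding smooth_atlas_def by simp
  then show thesis using that by auto
qed

lemma
  assumes "(U, \<phi>) \<in> charts G"
  shows open_chart: "open U" and open_chart_image: "open V \<Longrightarrow> open (\<phi> ` (V \<inter> U))"
    and inj_on_chart: "inj_on \<phi> U" and continuous_on_chart: "continuous_on U \<phi>"
proof -
  have *: "open U" "open (\<phi> ` U)" "homeomorphism U (\<phi> ` U) \<phi> (inv_into U \<phi>)"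
    using atlas assms unfolding smooth_atlas_def by auto
  show "open U" by fact
  show "inj_on \<phi> U" using *(3) by (metis homeomorphism_apply1 inj_on_inverseI)
  show "continuous_on U \<phi>" using *(3) by (simp add: homeomorphism_def)
  show "open (\<phi> ` (V \<inter> U))" if "open V"
    using homeomorphism_imp_open_map[OF *(3), of "V \<inter> U"] that *(1,2) openin_open_trans
    by (metis Int_lower2 open_Int openin_open_eq)
qed

lemma smooth_fun_on_local:
  assumes "\<And>p. p \<in> S \<Longrightarrow> \<exists>U. open U \<and> p \<in> U \<and> smooth_fun_on G U f"
  shows "smooth_fun_on G S f"
proof (rule smooth_fun_onI, rule Ck_on_local)
  fix V \<phi> k x assume ch: "(V, \<phi>) \<in> charts G" and "x \<in> \<phi> ` (S \<inter> V)"
  then obtain p where p: "p \<in> S" "p \<in> V" "x = \<phi> p" by auto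
  from assms[OF p(1)] obtain U where U: "open U" "p \<in> U" "smooth_fun_on G U f" by blast
  then show "\<exists>T. open T \<and> x \<in> T \<and> Ck_on k T (f \<circ> inv_into V \<phi>)"
    using p open_chart_image[OF ch U(1)] smooth_fun_onD[OF U(3) ch] by blast
qed

lemma cinf_iff_smooth_near: "f \<in> cinf G \<longleftrightarrow> (\<forall>p. smooth_near G p f)"
proof
  assume "f \<in> cinf G" then show "\<forall>p. smooth_near G p f" unfolding cinf_def smooth_near_def by blast
next
  assume "\<forall>p. smooth_near G p f"
  then show "f \<in> cinf G"
    using smooth_fun_on_local[of UNIV f] unfolding cinf_def smooth_near_def by simp
qed

text \<open>Smoothness near a point depends only on the germ.\<close>

lemma smooth_near_eqI:
  assumes "smooth_near G p f" "open W" "p \<in> W" "\<And>q. q \<in> W \<Longrightarrow> f q = g q"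
  shows "smooth_near G p g"
proof -
  from assms(1) obtain U where U: "open U" "p \<in> U" "smooth_fun_on G U f" by (auto simp: smooth_near_def)
  have "smooth_fun_on G (U \<inter> W) g"
  proof (rule smooth_fun_onI)
    fix V \<phi> k assume ch: "(V, \<phi>) \<in> charts G"
    have "Ck_on k (\<phi> ` (U \<inter> W \<inter> V)) (f \<circ> inv_into V \<phi>)"
      by (rule Ck_on_subset[OF smooth_fun_onD[OF U(3) ch]]) auto
    then show "Ck_on k (\<phi> ` (U \<inter> W \<inter> V)) (g \<circ> inv_into V \<phi>)"
      by (rule Ck_on_cong[rotated 2]) (use open_chart_image[OF ch open_Int[OF U(1) assms(2)]] assms inj_on_chart[OF ch] in auto)
  qed
  moreover have "open (U \<inter> W)" "p \<in> U \<inter> W" using U(1,2) assms(2,3) by auto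
  ultimately show ?thesis unfolding smooth_near_def by blast
qed

lemma smooth_near_const: "smooth_near G p (\<lambda>_. c)"
  unfolding smooth_near_def by (intro exI[of _ UNIV]) (auto intro!: smooth_fun_onI simp: o_def Ck_on_const)

lemma smooth_near_combine:
  assumes "\<And>k S (u::real^3 \<Rightarrow> real) v. Ck_on k S u \<Longrightarrow> Ck_on k S v \<Longrightarrow> Ck_on k S (\<lambda>x. h (u x) (v x))"
    and "smooth_near G p f" "smooth_near G p g"
  shows "smooth_near G p (\<lambda>q. h (f q) (g q))"
proof -
  from assms obtain U W where "open U" "p \<in> U" "smooth_fun_on G U f" "open W" "p \<in> W" "smooth_fun_on G W g"
    by (auto simp: smooth_near_def)
  then have "open (U \<inter> W)" "p \<in> U \<inter> W" "smooth_fun_on G (U \<inter> W) f" "smooth_fun_on G (U \<inter> W) g"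
    by (auto intro: smooth_fun_on_subset)
  then show ?thesis unfolding smooth_near_def
  proof (intro exI[of _ "U \<inter> W"] conjI smooth_fun_onI)
    fix V \<phi> k assume "(V, \<phi>) \<in> charts G"
    then show "Ck_on k (\<phi> ` (U \<inter> W \<inter> V)) ((\<lambda>q. h (f q) (g q)) \<circ> inv_into V \<phi>)"
      using assms(1)[OF smooth_fun_onD smooth_fun_onD] \<open>smooth_fun_on G (U \<inter> W) f\<close> \<open>smooth_fun_on G (U \<inter> W) g\<close>
      by (simp add: o_def)
  qed auto
qed

lemma smooth_near_add: "smooth_near G p f \<Longrightarrow> smooth_near G p g \<Longrightarrow> smooth_near G p (f + g)"
  using smooth_near_combine[of "(+)"] Ck_on_add by (auto simp: plus_fun_def)

lemma smooth_near_mult: "smooth_near G p f \<Longrightarrow> smooth_near G p g \<Longrightarrow> smooth_near G p (f * g)"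
  using smooth_near_combine[of "(*)"] Ck_on_mult by (auto simp: times_fun_def)

text \<open>The function stays nonzero on a neighbourhood because it is continuous in a chart.\<close>

lemma smooth_near_inverse:
  assumes f: "smooth_near G p f" and nz: "f p \<noteq> 0" shows "smooth_near G p (\<lambda>q. inverse (f q))"
proof -
  from f obtain U where U: "open U" "p \<in> U" "smooth_fun_on G U f" by (auto simp: smooth_near_def)
  from chart_at[of p] obtain V \<phi> where ch: "(V, \<phi>) \<in> charts G" "p \<in> V" .
  define W where "W = {q \<in> U \<inter> V. f q \<noteq> 0}"
  have "continuous_on (\<phi> ` (U \<inter> V)) (f \<circ> inv_into V \<phi>)"
    using smooth_fun_onD[OF U(3) ch(1)] Ck_on_imp_continuous_on by blast
  moreover have "continuous_on (U \<inter> V) \<phi>"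
    using continuous_on_chart[OF ch(1)] by (rule continuous_on_subset) auto
  ultimately have "continuous_on (U \<inter> V) ((f \<circ> inv_into V \<phi>) \<circ> \<phi>)"
    by (rule continuous_on_compose[rotated])
  then have "continuous_on (U \<inter> V) f"
    by (rule continuous_on_eq) (use inj_on_chart[OF ch(1)] in auto)
  then have "open ((U \<inter> V) \<inter> f -` (- {0}))"
    using U open_chart[OF ch(1)] by (intro continuous_open_preimage) auto
  then have W: "open W" "p \<in> W"
    using U ch nz by (auto simp: W_def vimage_def Int_def)
  have "smooth_fun_on G W (\<lambda>q. inverse (f q))"
    unfolding o_def
  proof (rule smooth_fun_onI, unfold o_def, rule Ck_on_inverse)
    fix Y \<psi> k assume Y: "(Y, \<psi>) \<in> charts G"
    show "Ck_on k (\<psi> ` (W \<inter> Y)) (\<lambda>x. f (inv_into Y \<psi> x))"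
      by (rule Ck_on_subset[OF smooth_fun_onD[OF U(3) Y, unfolded o_def]]) (auto simp: W_def)
    show "f (inv_into Y \<psi> x) \<noteq> 0" if "x \<in> \<psi> ` (W \<inter> Y)" for x
      using that inj_on_chart[OF Y] by (auto simp: W_def)
  qed
  with W show ?thesis by (auto simp: smooth_near_def)
qed

lemma smooth_near_zero: "smooth_near G p 0"
  using smooth_near_const[of p 0] unfolding zero_fun_def .

lemma smooth_near_sum: "(\<And>i. i \<in> I \<Longrightarrow> smooth_near G p (f i)) \<Longrightarrow> smooth_near G p (\<Sum>i\<in>I. f i)"
proof (induction I rule: infinite_finite_induct)
  case (insert i I)
  have "smooth_near G p (f i + (\<Sum>i\<in>I. f i))"
    by (rule smooth_near_add) (use insert in blast)+
  with insert.hyps show ?case by (simp only: sum.insert not_False_eq_True)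
qed (simp_all add: smooth_near_zero)

lemma smooth_near_cmult: "smooth_near G p f \<Longrightarrow> smooth_near G p (\<lambda>q. c * f q)"
  using smooth_near_mult[OF smooth_near_const[of p c], of f] by (simp add: times_fun_def)

lemma smooth_near_diff: "smooth_near G p f \<Longrightarrow> smooth_near G p g \<Longrightarrow> smooth_near G p (f - g)"
  using smooth_near_add[of p f "\<lambda>q. (-1) * g q"] smooth_near_cmult[of p g "-1"]
  by (simp add: fun_diff_def plus_fun_def)

lemma smooth_near_coordinate:
  assumes "(U, \<phi>) \<in> charts G" "p \<in> U"
  shows "smooth_near G p (\<lambda>q. \<phi> q \<bullet> w)"
  unfolding smooth_near_def
proof (intro exI[of _ U] conjI)
  show "smooth_fun_on G U (\<lambda>q. \<phi> q \<bullet> w)"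
  proof (rule smooth_fun_onI)
    fix V \<psi> k assume "(V, \<psi>) \<in> charts G"
    then have "Ck_on k (\<psi> ` (V \<inter> U)) (\<phi> \<circ> inv_into V \<psi>)"
      using atlas assms(1) unfolding smooth_atlas_def smooth_on_def by blast
    then show "Ck_on k (\<psi> ` (U \<inter> V)) ((\<lambda>q. \<phi> q \<bullet> w) \<circ> inv_into V \<psi>)"
      using Ck_on_bounded_linear[OF bounded_linear_inner_left, of k _ _ w] by (simp add: o_def Int_commute)
  qed
qed (use assms open_chart in auto)

lemma cinf_const: "(\<lambda>_. c) \<in> cinf G"
  and cinf_zero: "0 \<in> cinf G"
  and cinf_one: "1 \<in> cinf G"
  using smooth_near_const by (auto simp: cinf_iff_smooth_near zero_fun_def one_fun_def)

lemma cinf_add: "f \<in> cinf G \<Longrightarrow> g \<in> cinf G \<Longrightarrow> f + g \<in> cinf G"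
  and cinf_mult: "f \<in> cinf G \<Longrightarrow> g \<in> cinf G \<Longrightarrow> f * g \<in> cinf G"
  and cinf_diff: "f \<in> cinf G \<Longrightarrow> g \<in> cinf G \<Longrightarrow> f - g \<in> cinf G"
  by (auto simp: cinf_iff_smooth_near intro: smooth_near_add smooth_near_mult smooth_near_diff)

lemma cinf_minus: "f \<in> cinf G \<Longrightarrow> - f \<in> cinf G"
  using cinf_diff[OF cinf_zero] by force

lemma cinf_sum: "(\<And>i. i \<in> I \<Longrightarrow> f i \<in> cinf G) \<Longrightarrow> (\<Sum>i\<in>I. f i) \<in> cinf G"
  by (auto simp: cinf_iff_smooth_near intro: smooth_near_sum)


section \<open>Vector fields\<close>

lemma smooth_near_differentiable:
  assumes "smooth_near G p f" "(U, \<phi>) \<in> charts G" "p \<in> U"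
  shows "((f \<circ> inv_into U \<phi>) has_derivative frechet_derivative (f \<circ> inv_into U \<phi>) (at (\<phi> p))) (at (\<phi> p))"
proof -
  from assms(1) obtain W where W: "p \<in> W" "smooth_fun_on G W f" by (auto simp: smooth_near_def)
  with assms have "Ck_on (Suc 0) (\<phi> ` (W \<inter> U)) (f \<circ> inv_into U \<phi>)"
    by (metis smooth_fun_onD)
  moreover have "\<phi> p \<in> \<phi> ` (W \<inter> U)" using W assms by auto
  ultimately have "(f \<circ> inv_into U \<phi>) differentiable at (\<phi> p)"
    unfolding differentiable_def Ck_on.simps by blast
  then show ?thesis by (simp add: frechet_derivative_works)
qed

lemma transition_differentiable:
  assumes "(U, \<phi>) \<in> charts G" "(V, \<psi>) \<in> charts G" "p \<in> U" "p \<in> V"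
  shows "(\<psi> \<circ> inv_into U \<phi>) differentiable at (\<phi> p)"
proof -
  have "Ck_on (Suc 0) (\<phi> ` (U \<inter> V)) (\<psi> \<circ> inv_into U \<phi>)"
    using atlas assms(1,2) unfolding smooth_atlas_def smooth_on_def by blast
  moreover have "\<phi> p \<in> \<phi> ` (U \<inter> V)" using assms by auto
  ultimately show ?thesis unfolding differentiable_def Ck_on.simps by blast
qed

text \<open>By the chain rule a tangent vector is a directional derivative in every chart around its
  foot point.\<close>

lemma tangent_vector_in_chart:
  assumes "tangent_vector G p v" and V: "(V, \<psi>) \<in> charts G" "p \<in> V"
  obtains w where "\<And>f. v f = (if smooth_near G p f then frechet_derivative (f \<circ> inv_into V \<psi>) (at (\<psi> p)) w else 0)"
proof -
  from assms(1) obtain U \<phi> u where U: "(U, \<phi>) \<in> charts G" "p \<in> U"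
    and u: "\<And>f. v f = (if smooth_near G p f then frechet_derivative (f \<circ> inv_into U \<phi>) (at (\<phi> p)) u else 0)"
    unfolding tangent_vector_def by blast
  let ?t = "\<psi> \<circ> inv_into U \<phi>"
  have t: "(?t has_derivative frechet_derivative ?t (at (\<phi> p))) (at (\<phi> p))"
    using transition_differentiable[OF U(1) V(1) U(2) V(2)] by (simp add: frechet_derivative_works)
  have "frechet_derivative (f \<circ> inv_into U \<phi>) (at (\<phi> p)) u =
      frechet_derivative (f \<circ> inv_into V \<psi>) (at (\<psi> p)) (frechet_derivative ?t (at (\<phi> p)) u)"
    if f: "smooth_near G p f" for f
  proof -
    have tp: "?t (\<phi> p) = \<psi> p" using inj_on_chart[OF U(1)] U(2) by simp
    have "((f \<circ> inv_into V \<psi>) has_derivative frechet_derivative (f \<circ> inv_into V \<psi>) (at (\<psi> p))) (at (?t (\<phi> p)))"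
      unfolding tp by (rule smooth_near_differentiable[OF f V])
    from diff_chain_at[OF t this]
    have "((f \<circ> inv_into V \<psi>) \<circ> ?t has_derivative
        frechet_derivative (f \<circ> inv_into V \<psi>) (at (\<psi> p)) \<circ> frechet_derivative ?t (at (\<phi> p))) (at (\<phi> p))" .
    then have "((f \<circ> inv_into U \<phi>) has_derivative
        frechet_derivative (f \<circ> inv_into V \<psi>) (at (\<psi> p)) \<circ> frechet_derivative ?t (at (\<phi> p))) (at (\<phi> p))"
      by (rule has_derivative_transform_within_open[OF _ open_chart_image[OF U(1) open_chart[OF V(1)]]])
        (use U V inj_on_chart[OF U(1)] inj_on_chart[OF V(1)] in auto)
    then show ?thesis by (metis comp_apply frechet_derivative_at)
  qed
  with u that show thesis by metis
qed

lemma tangent_vectorI: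
  assumes "(U, \<phi>) \<in> charts G" "p \<in> U"
    and "\<And>f. v f = (if smooth_near G p f then frechet_derivative (f \<circ> inv_into U \<phi>) (at (\<phi> p)) w else 0)"
  shows "tangent_vector G p v"
  unfolding tangent_vector_def using assms by blast

lemma tangent_vector_add:
  assumes "tangent_vector G p v" "tangent_vector G p v'"
  shows "tangent_vector G p (\<lambda>f. v f + v' f)"
proof -
  from chart_at[of p] obtain U \<phi> where U: "(U, \<phi>) \<in> charts G" "p \<in> U" .
  obtain w where "\<And>f. v f = (if smooth_near G p f then frechet_derivative (f \<circ> inv_into U \<phi>) (at (\<phi> p)) w else 0)"
    using tangent_vector_in_chart[OF assms(1) U] by blast
  moreover obtain w' where "\<And>f. v' f = (if smooth_near G p f then frechet_derivative (f \<circ> inv_into U \<phi>) (at (\<phi> p)) w' else 0)"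
    using tangent_vector_in_chart[OF assms(2) U] by blast
  ultimately show ?thesis
    by (intro tangent_vectorI[OF U, of _ "w + w'"])
      (auto simp: linear_add[OF has_derivative_linear[OF smooth_near_differentiable[OF _ U]]])
qed

lemma tangent_vector_scale:
  assumes "tangent_vector G p v" shows "tangent_vector G p (\<lambda>f. c * v f)"
proof -
  from chart_at[of p] obtain U \<phi> where U: "(U, \<phi>) \<in> charts G" "p \<in> U" .
  obtain w where "\<And>f. v f = (if smooth_near G p f then frechet_derivative (f \<circ> inv_into U \<phi>) (at (\<phi> p)) w else 0)"
    using tangent_vector_in_chart[OF assms U] by blast
  moreover have "frechet_derivative (f \<circ> inv_into U \<phi>) (at (\<phi> p)) (c *\<^sub>R w) =
      c * frechet_derivative (f \<circ> inv_into U \<phi>) (at (\<phi> p)) w" if "smooth_near G p f" for f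
    using linear_scale[OF has_derivative_linear[OF smooth_near_differentiable[OF that U]], of c w] by simp
  ultimately show ?thesis by (intro tangent_vectorI[OF U, of _ "c *\<^sub>R w"]) simp
qed

context
  fixes X assumes X: "X \<in> vfields G"
begin

lemma vfield_tangent: "tangent_vector G p (\<lambda>f. X f p)"
  using X by (simp add: vfields_def)

lemma vfield_in_chart:
  assumes U: "(U, \<phi>) \<in> charts G" "p \<in> U"
  obtains w where
    "\<And>f D. smooth_near G p f \<Longrightarrow> ((f \<circ> inv_into U \<phi>) has_derivative D) (at (\<phi> p)) \<Longrightarrow> X f p = D w"
proof -
  from tangent_vector_in_chart[OF vfield_tangent U] obtain w where
    w: "\<And>f. X f p = (if smooth_near G p f then frechet_derivative (f \<circ> inv_into U \<phi>) (at (\<phi> p)) w else 0)" by blast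
  show thesis
  proof (rule that)
    fix f D assume f: "smooth_near G p f" and D: "((f \<circ> inv_into U \<phi>) has_derivative D) (at (\<phi> p))"
    show "X f p = D w" unfolding w[of f] frechet_derivative_at[OF D] using f by simp
  qed
qed

lemma vfield_not_smooth: "\<not> smooth_near G p f \<Longrightarrow> X f p = 0"
  using vfield_tangent[of p] unfolding tangent_vector_def by auto

lemma smooth_near_vfield: "smooth_near G p f \<Longrightarrow> smooth_near G p (X f)"
  using X unfolding vfields_def smooth_near_def by blast

lemma vfield_cinf: "f \<in> cinf G \<Longrightarrow> X f \<in> cinf G"
  using smooth_near_vfield by (auto simp: cinf_iff_smooth_near)

lemma
  assumes "smooth_near G p f" "smooth_near G p g"
  shows vfield_add_near: "X (f + g) p = X f p + X g p"
    and vfield_mult_near: "X (f * g) p = f p * X g p + X f p * g p"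
proof -
  from chart_at[of p] obtain U \<phi> where U: "(U, \<phi>) \<in> charts G" "p \<in> U" .
  obtain w where w: "\<And>f D. smooth_near G p f \<Longrightarrow> ((f \<circ> inv_into U \<phi>) has_derivative D) (at (\<phi> p)) \<Longrightarrow> X f p = D w"
    using vfield_in_chart[OF U] by blast
  note f = smooth_near_differentiable[OF assms(1) U] and g = smooth_near_differentiable[OF assms(2) U]
  have "((f + g) \<circ> inv_into U \<phi>) = (\<lambda>x. (f \<circ> inv_into U \<phi>) x + (g \<circ> inv_into U \<phi>) x)" by auto
  then show "X (f + g) p = X f p + X g p"
    using w[OF smooth_near_add[OF assms]] has_derivative_add[OF f g] w[OF assms(1) f] w[OF assms(2) g] by simp
  have "((f * g) \<circ> inv_into U \<phi>) = (\<lambda>x. (f \<circ> inv_into U \<phi>) x * (g \<circ> inv_into U \<phi>) x)" by auto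
  then show "X (f * g) p = f p * X g p + X f p * g p"
    using w[OF smooth_near_mult[OF assms]] has_derivative_mult[OF f g] w[OF assms(1) f] w[OF assms(2) g]
      inj_on_chart[OF U(1)] U(2) by simp
qed

lemma vfield_const: "X (\<lambda>_. c) = 0"
proof
  fix p
  from chart_at[of p] obtain U \<phi> where U: "(U, \<phi>) \<in> charts G" "p \<in> U" .
  obtain w where "\<And>f D. smooth_near G p f \<Longrightarrow> ((f \<circ> inv_into U \<phi>) has_derivative D) (at (\<phi> p)) \<Longrightarrow> X f p = D w"
    using vfield_in_chart[OF U] by blast
  from this[OF smooth_near_const, of c "\<lambda>_. 0"] show "X (\<lambda>_. c) p = 0 p" by (simp add: o_def)
qed

lemma vfield_add: "f \<in> cinf G \<Longrightarrow> g \<in> cinf G \<Longrightarrow> X (f + g) = X f + X g"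
  and vfield_mult: "f \<in> cinf G \<Longrightarrow> g \<in> cinf G \<Longrightarrow> X (f * g) = f * X g + X f * g"
  by (rule ext, simp add: cinf_iff_smooth_near vfield_add_near vfield_mult_near)+

lemma vfield_sum: "finite I \<Longrightarrow> (\<And>i. i \<in> I \<Longrightarrow> f i \<in> cinf G) \<Longrightarrow> X (\<Sum>i\<in>I. f i) = (\<Sum>i\<in>I. X (f i))"
  by (induction I rule: finite_induct) (simp_all add: vfield_const[of 0, folded zero_fun_def] vfield_add cinf_sum)

end

lemma vfieldsI:
  assumes "\<And>p. tangent_vector G p (\<lambda>f. X f p)" and "\<And>f p. smooth_near G p f \<Longrightarrow> smooth_near G p (X f)"
  shows "X \<in> vfields G"
  unfolding vfields_def
proof (clarsimp simp: assms(1))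
  fix U f assume "open U" "smooth_fun_on G U f"
  then show "smooth_fun_on G U (X f)"
    by (intro smooth_fun_on_local) (use assms(2) in \<open>auto simp: smooth_near_def\<close>)
qed

lemma vfields_add: "X \<in> vfields G \<Longrightarrow> Y \<in> vfields G \<Longrightarrow> X + Y \<in> vfields G"
  by (rule vfieldsI) (simp_all add: plus_fun_def[of X Y] plus_fun_def[of "X _" "Y _", symmetric]
    tangent_vector_add vfield_tangent smooth_near_add smooth_near_vfield)

lemma vfields_smul: "f \<in> cinf G \<Longrightarrow> X \<in> vfields G \<Longrightarrow> smul f X \<in> vfields G"
  by (rule vfieldsI) (simp_all add: smul_def tangent_vector_scale vfield_tangent smooth_near_mult
    smooth_near_vfield cinf_iff_smooth_near)

end


section \<open>A left-invariant frame\<close>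

lemma smul_apply: "smul f T x p = f p * T x p"
  by (simp add: smul_def)

lemma module_smul: "module (smul :: ('a \<Rightarrow> real) \<Rightarrow> ('b \<Rightarrow> 'a \<Rightarrow> real) \<Rightarrow> 'b \<Rightarrow> 'a \<Rightarrow> real)"
  by unfold_locales (auto simp: smul_def fun_eq_iff algebra_simps)

interpretation smul: module smul by (rule module_smul)

lemma sum_fun_apply: "(\<Sum>i\<in>I. f i) x = (\<Sum>i\<in>I. f i x)"
  by (induction I rule: infinite_finite_induct) auto

context smooth_manifold
begin

lemma vfields_zero: "0 \<in> vfields G"
proof (rule vfieldsI)
  fix p
  from chart_at[of p] obtain U \<phi> where U: "(U, \<phi>) \<in> charts G" "p \<in> U" .
  have "frechet_derivative (f \<circ> inv_into U \<phi>) (at (\<phi> p)) 0 = 0" if "smooth_near G p f" for f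
    using linear_0[OF has_derivative_linear[OF smooth_near_differentiable[OF that U]]] .
  then show "tangent_vector G p (\<lambda>f. 0 f p)"
    by (intro tangent_vectorI[OF U, of _ 0]) simp
qed (simp add: smooth_near_zero)

lemma vfields_minus: "X \<in> vfields G \<Longrightarrow> - X \<in> vfields G"
  using vfields_smul[OF cinf_minus[OF cinf_one], of X] by (simp add: smul.scale_minus_left)

lemma vfields_diff: "X \<in> vfields G \<Longrightarrow> Y \<in> vfields G \<Longrightarrow> X - Y \<in> vfields G"
  using vfields_add[OF _ vfields_minus, of X Y] by simp

lemma vfields_sum: "(\<And>i. i \<in> I \<Longrightarrow> X i \<in> vfields G) \<Longrightarrow> (\<Sum>i\<in>I. X i) \<in> vfields G"
proof (induction I rule: infinite_finite_induct)
  case (insert i I)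
  have "X i + (\<Sum>i\<in>I. X i) \<in> vfields G" by (rule vfields_add) (use insert in blast)+
  with insert.hyps show ?case by (simp only: sum.insert not_False_eq_True)
qed (simp_all add: vfields_zero)

lemma smooth_near_det:
  fixes M :: "'a \<Rightarrow> real^3^3"
  assumes "\<And>i j. smooth_near G p (\<lambda>q. M q $ i $ j)"
  shows "smooth_near G p (\<lambda>q. det (M q))"
proof -
  note rules = smooth_near_add[unfolded plus_fun_def] smooth_near_diff[unfolded fun_diff_def]
    smooth_near_mult[unfolded times_fun_def]
  show ?thesis unfolding det_3 by (intro rules assms)
qed

text \<open>The values of a vector field on the coordinate functions of a chart are its components.\<close>

lemma vfield_coordinates:
  assumes X: "X \<in> vfields G" and U: "(U, \<phi>) \<in> charts G" "q \<in> U"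
    and f: "smooth_near G q f" "((f \<circ> inv_into U \<phi>) has_derivative D) (at (\<phi> q))"
  shows "X f q = D (\<chi> i. X (\<lambda>q. \<phi> q \<bullet> axis i 1) q)"
proof -
  from vfield_in_chart[OF X U] obtain w where
    w: "\<And>f D. smooth_near G q f \<Longrightarrow> ((f \<circ> inv_into U \<phi>) has_derivative D) (at (\<phi> q)) \<Longrightarrow> X f q = D w"
    by blast
  have "X (\<lambda>q. \<phi> q \<bullet> axis i 1) q = w $ i" for i
  proof -
    have "((\<lambda>x. x \<bullet> axis i 1) has_derivative (\<lambda>h. h \<bullet> axis i 1)) (at (\<phi> q))"
      by (intro bounded_linear.has_derivative[OF bounded_linear_inner_left]) simp
    then have "(((\<lambda>q. \<phi> q \<bullet> axis i 1) \<circ> inv_into U \<phi>) has_derivative (\<lambda>h. h \<bullet> axis i 1)) (at (\<phi> q))"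
      by (rule has_derivative_transform_within_open[OF _ open_chart_image[OF U(1) open_UNIV]])
        (use U(2) in \<open>auto simp: f_inv_into_f\<close>)
    from w[OF smooth_near_coordinate[OF U] this] show ?thesis by (simp add: inner_axis)
  qed
  then have "(\<chi> i. X (\<lambda>q. \<phi> q \<bullet> axis i 1) q) = w" by (simp add: vec_eq_iff)
  with w[OF f] show ?thesis by simp
qed

context
  fixes v :: "3 \<Rightarrow> 'a vfield"
  assumes v: "\<And>a. v a \<in> vfields G"
    and indep: "\<And>c p. (\<And>f. (\<Sum>a\<in>UNIV. c a * v a f p) = 0) \<Longrightarrow> c = (\<lambda>_. 0)"
begin

text \<open>In a chart the components of the frame form a matrix \<open>A\<close>, which is invertible because the frame is
  independent. The coefficients of a vector field \<open>X\<close> solve a linear system with this matrix, and Cramer's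
  rule writes them as quotients of determinants with smooth entries.\<close>

lemma frame_coeffs_local:
  assumes X: "X \<in> vfields G"
  shows "\<exists>c W. open W \<and> p \<in> W \<and> (\<forall>a. smooth_near G p (c a)) \<and>
    (\<forall>q\<in>W. \<forall>f. X f q = (\<Sum>a\<in>UNIV. c a q * v a f q))"
proof -
  from chart_at[of p] obtain U \<phi> where U: "(U, \<phi>) \<in> charts G" "p \<in> U" .
  define x where "x i = (\<lambda>q. \<phi> q \<bullet> axis i 1)" for i :: 3
  have x: "smooth_near G q (x i)" if "q \<in> U" for q i
    unfolding x_def by (rule smooth_near_coordinate[OF U(1) that])
  define A where "A q = (\<chi> i a. v a (x i) q)" for q
  define b where "b q = (\<chi> i. X (x i) q)" for q
  define c where "c q = (\<chi> k. det (\<chi> i j. if j = k then b q $ i else A q $ i $ j) / det (A q))" for q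
  have frame: "(\<Sum>a\<in>UNIV. t $ a * v a f q) = D (A q *v t)"
    if q: "q \<in> U" and f: "smooth_near G q f" "((f \<circ> inv_into U \<phi>) has_derivative D) (at (\<phi> q))" for q f D t
  proof -
    have lin: "linear D" by (rule has_derivative_linear[OF f(2)])
    have "A q *v t = (\<Sum>a\<in>UNIV. t $ a *\<^sub>R (\<chi> i. v a (x i) q))"
      by (simp add: vec_eq_iff matrix_vector_mult_def A_def mult.commute)
    then have "D (A q *v t) = (\<Sum>a\<in>UNIV. t $ a * D (\<chi> i. v a (x i) q))"
      by (simp add: linear_sum[OF lin] linear_scale[OF lin])
    also have "\<dots> = (\<Sum>a\<in>UNIV. t $ a * v a f q)"
      using vfield_coordinates[OF v U(1) q f] by (simp add: x_def)
    finally show ?thesis ..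
  qed
  have det: "det (A q) \<noteq> 0" if q: "q \<in> U" for q
  proof
    assume "det (A q) = 0"
    then obtain t where t: "A q *v t = 0" "t \<noteq> 0"
      using matrix_nonfull_linear_equations_eq[of "A q"] by (metis det_eq_0_rank rank_dim_range less_irrefl)
    have "(\<Sum>a\<in>UNIV. t $ a * v a f q) = 0" for f
    proof (cases "smooth_near G q f")
      case True
      note D = smooth_near_differentiable[OF True U(1) q]
      show ?thesis unfolding frame[OF q True D] t(1) by (rule linear_0[OF has_derivative_linear[OF D]])
    qed (simp add: vfield_not_smooth[OF v])
    from indep[OF this] have "t = 0" by (simp add: vec_eq_iff fun_eq_iff)
    with t show False by simp
  qed
  have "X f q = (\<Sum>a\<in>UNIV. c q $ a * v a f q)" if q: "q \<in> U" for q f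
  proof (cases "smooth_near G q f")
    case True
    have "A q *v c q = b q" using cramer[OF det[OF q], of "c q" "b q"] by (simp add: c_def)
    with frame[OF q True smooth_near_differentiable[OF True U(1) q], of "c q"] show ?thesis
      using vfield_coordinates[OF X U(1) q True smooth_near_differentiable[OF True U(1) q]]
      by (simp add: b_def x_def)
  qed (simp add: vfield_not_smooth[OF v] vfield_not_smooth[OF X])
  moreover have "smooth_near G p (\<lambda>q. c q $ a)" for a
  proof -
    have A: "smooth_near G p (\<lambda>q. A q $ i $ j)" and b: "smooth_near G p (\<lambda>q. b q $ i)" for i j
      using smooth_near_vfield[OF v x[OF U(2)], of j i] smooth_near_vfield[OF X x[OF U(2)], of i]
      by (simp_all add: A_def b_def)
    have "smooth_near G p (\<lambda>q. det (\<chi> i j. if j = a then b q $ i else A q $ i $ j))"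
    proof (rule smooth_near_det)
      show "smooth_near G p (\<lambda>q. (\<chi> i j. if j = a then b q $ i else A q $ i $ j) $ i $ j)" for i j
        by (cases "j = a") (simp_all add: A b)
    qed
    moreover have "smooth_near G p (\<lambda>q. inverse (det (A q)))"
      by (rule smooth_near_inverse[OF smooth_near_det[OF A] det[OF U(2)]])
    ultimately show ?thesis
      using smooth_near_mult unfolding times_fun_def c_def by (simp add: divide_inverse)
  qed
  ultimately show ?thesis using open_chart[OF U(1)] U(2)
    by (intro exI[of _ "\<lambda>a q. c q $ a"] exI[of _ U]) simp
qed

lemma frame_coeffs_unique:
  assumes "\<And>f. (\<Sum>a\<in>UNIV. c a * v a f p) = (\<Sum>a\<in>UNIV. c' a * v a f p)"
  shows "c = c'"
proof -
  have "(\<Sum>a\<in>UNIV. (c a - c' a) * v a f p) = 0" for f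
    using assms[of f] by (simp add: left_diff_distrib sum_subtractf)
  from indep[OF this] show ?thesis by (simp add: fun_eq_iff)
qed

text \<open>The local coefficients fit together because they are unique at each point.\<close>

lemma frame_coeffs:
  assumes X: "X \<in> vfields G"
  obtains c where "\<And>a. c a \<in> cinf G" "X = (\<Sum>a\<in>UNIV. smul (c a) (v a))"
proof -
  have "\<forall>p. \<exists>c. \<forall>f. X f p = (\<Sum>a\<in>UNIV. c a * v a f p)"
  proof
    fix p
    from frame_coeffs_local[OF X, of p] obtain c W where "p \<in> W" "\<forall>q\<in>W. \<forall>f. X f q = (\<Sum>a\<in>UNIV. c a q * v a f q)"
      by blast
    then show "\<exists>c. \<forall>f. X f p = (\<Sum>a\<in>UNIV. c a * v a f p)" by (intro exI[of _ "\<lambda>a. c a p"]) blast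
  qed
  then obtain C where C: "\<And>p f. X f p = (\<Sum>a\<in>UNIV. C p a * v a f p)" by metis
  have "(\<lambda>p. C p a) \<in> cinf G" for a
    unfolding cinf_iff_smooth_near
  proof
    fix p
    from frame_coeffs_local[OF X, of p] obtain c W where W: "open W" "p \<in> W" "smooth_near G p (c a)"
      and c: "\<And>q f. q \<in> W \<Longrightarrow> X f q = (\<Sum>a\<in>UNIV. c a q * v a f q)" by blast
    have "C q = (\<lambda>a. c a q)" if "q \<in> W" for q
      by (rule frame_coeffs_unique[of _ q]) (use C[of _ q] c[OF that] in simp)
    then show "smooth_near G p (\<lambda>p. C p a)"
      by (intro smooth_near_eqI[OF W(3,1,2)]) simp
  qed
  moreover have "X = (\<Sum>a\<in>UNIV. smul (\<lambda>p. C p a) (v a))"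
    by (intro ext) (simp add: C sum_fun_apply smul_apply)
  ultimately show thesis by (rule that)
qed

end

lemma
  assumes X: "X \<in> vfields G" and Y: "Y \<in> vfields G"
  shows lie_bracket_anti: "lie_bracket G X Y = - lie_bracket G Y X"
    and lie_bracket_add_left: "Z \<in> vfields G \<Longrightarrow> lie_bracket G (X + Z) Y = lie_bracket G X Y + lie_bracket G Z Y"
    and lie_bracket_smul_left: "h \<in> cinf G \<Longrightarrow> lie_bracket G (smul h X) Y = smul h (lie_bracket G X Y) - smul (Y h) X"
proof -
  show "lie_bracket G X Y = - lie_bracket G Y X" by (intro ext) (simp add: lie_bracket_def)
  show "lie_bracket G (X + Z) Y = lie_bracket G X Y + lie_bracket G Z Y" if Z: "Z \<in> vfields G"
    by (intro ext) (simp add: lie_bracket_def vfield_add_near[OF Y] smooth_near_vfield X Z)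
  show "lie_bracket G (smul h X) Y = smul h (lie_bracket G X Y) - smul (Y h) X" if h: "h \<in> cinf G"
  proof (intro ext)
    fix f p
    show "lie_bracket G (smul h X) Y f p = (smul h (lie_bracket G X Y) - smul (Y h) X) f p"
    proof (cases "smooth_near G p f")
      case True
      have "smul h X f = h * X f" by (simp add: smul_def)
      then show ?thesis
        using True vfield_mult_near[OF Y, of p h "X f"] h
        by (simp add: lie_bracket_def smul_apply smooth_near_vfield[OF X] cinf_iff_smooth_near algebra_simps)
    qed (simp add: lie_bracket_def smul_apply vfield_not_smooth[OF X])
  qed
qed

lemma lie_bracket_zero_left: "Y \<in> vfields G \<Longrightarrow> lie_bracket G 0 Y = 0"
  by (intro ext) (simp add: lie_bracket_def vfield_const[of Y 0, folded zero_fun_def])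

lemma lie_bracket_zero_right: "X \<in> vfields G \<Longrightarrow> lie_bracket G X 0 = 0"
  using lie_bracket_anti[OF _ vfields_zero] lie_bracket_zero_left by force

lemma
  assumes X: "X \<in> vfields G" and Y: "Y \<in> vfields G" and closed: "lie_bracket G X Y \<in> vfields G"
  shows lie_bracket_closed_flip: "lie_bracket G Y X \<in> vfields G"
    and lie_bracket_closed_smul: "h \<in> cinf G \<Longrightarrow> lie_bracket G (smul h X) Y \<in> vfields G"
proof -
  show "lie_bracket G Y X \<in> vfields G"
    using lie_bracket_anti[OF Y X] vfields_minus[OF closed] by simp
  show "lie_bracket G (smul h X) Y \<in> vfields G" if "h \<in> cinf G"
    unfolding lie_bracket_smul_left[OF X Y that]
    by (intro vfields_diff vfields_smul that closed X vfield_cinf[OF Y])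
qed

lemma lie_bracket_closed_sum:
  assumes "finite I" "Y \<in> vfields G" "\<And>i. i \<in> I \<Longrightarrow> X i \<in> vfields G" "\<And>i. i \<in> I \<Longrightarrow> lie_bracket G (X i) Y \<in> vfields G"
  shows "lie_bracket G (\<Sum>i\<in>I. X i) Y \<in> vfields G"
  using assms(1,3,4)
proof (induction I rule: finite_induct)
  case (insert i I)
  have "lie_bracket G (X i) Y + lie_bracket G (\<Sum>i\<in>I. X i) Y \<in> vfields G"
    by (rule vfields_add) (use insert in blast)+
  moreover have "lie_bracket G (X i + (\<Sum>i\<in>I. X i)) Y = lie_bracket G (X i) Y + lie_bracket G (\<Sum>i\<in>I. X i) Y"
    by (rule lie_bracket_add_left) (use insert assms(2) vfields_sum in blast)+
  ultimately show ?case using insert.hyps by (simp only: sum.insert not_False_eq_True)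
qed (simp add: lie_bracket_zero_left assms(2) vfields_zero)

end

text \<open>The existence of a basis of left-invariant vector fields and the closedness of the bracket on it are
  hypotheses of the locale. They will come from an orthonormal basis and from \<open>[u,v] = L(u \<times> v)\<close> with an
  endomorphism \<open>L\<close>.\<close>

locale left_inv_frame = smooth_manifold G for G :: "'a::{t2_space, second_countable_topology} lie_data" +
  fixes v :: "3 \<Rightarrow> 'a vfield"
  assumes group_G: "group (gmult G) (gone G) (ginv G)"
    and lie_basis: "is_basis rscl UNIV (lie_alg G) UNIV v"
    and bracket_closed: "\<And>a b. lie_bracket G (v a) (v b) \<in> lie_alg G"
begin

sublocale grp: group "gmult G" "gone G" "ginv G" by (rule group_G)

lemma translate_cancel:
  "gmult G (ginv G b) (gmult G b p) = p" "gmult G b (gmult G (ginv G b) p) = p"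
  by (simp_all add: grp.assoc[symmetric])

lemma v_lie_alg: "v a \<in> lie_alg G"
  using lie_basis by (auto simp: is_basis_def)

lemma v_vfield: "v a \<in> vfields G"
  using v_lie_alg by (simp add: lie_alg_def)

lemma lie_alg_translate:
  assumes "X \<in> lie_alg G" shows "X f (gmult G b p) = X (\<lambda>q. f (gmult G b q)) p"
proof -
  have "X f (gmult G b p) = push G b X f (gmult G b p)" using assms by (simp add: lie_alg_def)
  then show ?thesis by (simp add: push_def translate_cancel)
qed

text \<open>A linear combination of left-invariant vector fields that vanishes at one point vanishes everywhere,
  since every point is a translate of \<open>p\<close>.\<close>

lemma v_independent:
  assumes "\<And>f. (\<Sum>a\<in>UNIV. c a * v a f p) = 0"
  shows "c = (\<lambda>_. 0)"
proof
  fix a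
  have sum: "(\<Sum>a\<in>UNIV. rscl (c a) (v a)) = 0"
  proof (intro ext)
    fix f q
    let ?b = "gmult G q (ginv G p)"
    have q: "q = gmult G ?b p" by (simp add: grp.assoc)
    have "(\<Sum>a\<in>UNIV. c a * v a f q) = (\<Sum>a\<in>UNIV. c a * v a (\<lambda>q. f (gmult G ?b q)) p)"
      by (subst q) (simp only: lie_alg_translate[OF v_lie_alg])
    with assms show "(\<Sum>a\<in>UNIV. rscl (c a) (v a)) f q = 0 f q"
      by (simp add: sum_fun_apply rscl_def smul_apply)
  qed
  have zero: "(\<Sum>a\<in>UNIV. rscl 0 (v a)) = 0"
    by (intro ext) (simp add: sum_fun_apply rscl_def smul_apply)
  have "0 \<in> lie_alg G" using vfields_zero by (auto simp: lie_alg_def push_def fun_eq_iff)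
  then show "c a = 0"
    using is_basisD[OF lie_basis, of c "\<lambda>_. 0" a] sum zero by simp
qed

lemma vfield_coeffs:
  assumes "X \<in> vfields G"
  obtains c where "\<And>a. c a \<in> cinf G" "X = (\<Sum>a\<in>UNIV. smul (c a) (v a))"
proof (rule frame_coeffs[of v X])
  show "c = (\<lambda>_. 0)" if "\<And>f. (\<Sum>a\<in>UNIV. c a * v a f p) = 0" for c p
    by (rule v_independent[OF that])
qed (use v_vfield assms that in auto)

text \<open>By the Leibniz rule it suffices to know that the bracket is closed on the frame; the two arguments are
  expanded one after the other.\<close>

lemma lie_bracket_vfields:
  assumes X: "X \<in> vfields G" and Y: "Y \<in> vfields G"
  shows "lie_bracket G X Y \<in> vfields G"
proof -
  have base: "lie_bracket G X (v b) \<in> vfields G" if "X \<in> vfields G" for X b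
  proof -
    from vfield_coeffs[OF that] obtain c where c: "\<And>a. c a \<in> cinf G" "X = (\<Sum>a\<in>UNIV. smul (c a) (v a))" by blast
    show ?thesis unfolding c(2)
      by (intro lie_bracket_closed_sum v_vfield lie_bracket_closed_smul vfields_smul c(1))
        (use bracket_closed in \<open>auto simp: lie_alg_def\<close>)
  qed
  from vfield_coeffs[OF Y] obtain c where c: "\<And>a. c a \<in> cinf G" "Y = (\<Sum>a\<in>UNIV. smul (c a) (v a))" by blast
  have "lie_bracket G Y X \<in> vfields G" unfolding c(2)
    by (intro lie_bracket_closed_sum v_vfield lie_bracket_closed_smul vfields_smul c(1) X finite
        lie_bracket_closed_flip[OF X v_vfield base[OF X]])
  then show ?thesis by (rule lie_bracket_closed_flip[OF Y X])
qed

text \<open>Vector fields vanish by convention on functions that are not smooth, and this replaces an argument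
  with charts for the multiplication. If \<open>v\<^sub>1 h \<noteq> 0\<close> at \<open>b p\<close>, then by left-invariance \<open>v\<^sub>1\<close> does not vanish
  at \<open>p\<close> on the translate of \<open>h\<close>, which is therefore smooth near \<open>p\<close>. Such an \<open>h\<close> exists, and if
  \<open>v\<^sub>1 f = 0\<close> at \<open>b p\<close>, then the argument applies to \<open>f + h\<close> and \<open>h\<close>, whose difference is \<open>f\<close>.\<close>

lemma smooth_near_translate:
  assumes f: "smooth_near G (gmult G b p) f"
  shows "smooth_near G p (\<lambda>q. f (gmult G b q))"
proof -
  let ?q = "gmult G b p"
  have *: "smooth_near G p (\<lambda>q. h (gmult G b q))" if "v 1 h ?q \<noteq> 0" for h
    using that vfield_not_smooth[OF v_vfield] by (metis lie_alg_translate[OF v_lie_alg])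
  obtain h where h: "v 1 h ?q \<noteq> 0"
  proof (rule ccontr)
    assume "\<not> thesis"
    then have "(\<Sum>a\<in>UNIV. (if a = 1 then 1 else 0) * v a h ?q) = 0" for h
      using that by (simp add: if_distrib[of "\<lambda>x. x * _"] cong: if_cong) blast
    from v_independent[OF this] show False by (metis zero_neq_one)
  qed
  have hs: "smooth_near G ?q h" using h vfield_not_smooth[OF v_vfield] by blast
  show ?thesis
  proof (cases "v 1 f ?q = 0")
    case True
    then have "v 1 (f + h) ?q \<noteq> 0" using h vfield_add_near[OF v_vfield f hs] by simp
    from smooth_near_diff[OF *[OF this] *[OF h]] show ?thesis by (simp add: fun_diff_def)
  qed (rule *)
qed

lemma cinf_translate: "f \<in> cinf G \<Longrightarrow> (\<lambda>q. f (gmult G b q)) \<in> cinf G"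
  by (simp add: cinf_iff_smooth_near smooth_near_translate)

text \<open>Push-forward multiplies the left-invariant frame by the translated coefficients.\<close>

lemma push_vfields:
  assumes X: "X \<in> vfields G" shows "push G b X \<in> vfields G"
proof -
  from vfield_coeffs[OF X] obtain c where c: "\<And>a. c a \<in> cinf G" "X = (\<Sum>a\<in>UNIV. smul (c a) (v a))" by blast
  have "push G b X = (\<Sum>a\<in>UNIV. smul (\<lambda>p. c a (gmult G (ginv G b) p)) (v a))"
    by (intro ext) (simp add: c(2) push_def sum_fun_apply smul_apply translate_cancel
        lie_alg_translate[OF v_lie_alg, symmetric])
  moreover have "\<dots> \<in> vfields G" by (intro vfields_sum vfields_smul v_vfield cinf_translate c(1))
  ultimately show ?thesis by simp
qed

end


section \<open>Forms and sections\<close>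

lemma numeral_fun_apply: "(numeral n :: 'a \<Rightarrow> real) p = numeral n"
  by (metis of_nat_fun_apply of_nat_numeral)

lemma
  assumes "cinf_linear G \<xi>"
  shows cinf_linear_cinf: "X \<in> vfields G \<Longrightarrow> \<xi> X \<in> cinf G"
    and cinf_linear_add: "X \<in> vfields G \<Longrightarrow> Y \<in> vfields G \<Longrightarrow> \<xi> (X + Y) = \<xi> X + \<xi> Y"
    and cinf_linear_smul: "f \<in> cinf G \<Longrightarrow> X \<in> vfields G \<Longrightarrow> \<xi> (smul f X) = f * \<xi> X"
  using assms unfolding cinf_linear_def by blast+

lemma forms1_linear: "\<xi> \<in> forms1 G \<Longrightarrow> cinf_linear G \<xi>"
  by (simp add: forms1_def)

lemma forms2_linear: "F \<in> forms2 G \<Longrightarrow> X \<in> vfields G \<Longrightarrow> cinf_linear G (F X)"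
  and forms2_anti: "F \<in> forms2 G \<Longrightarrow> X \<in> vfields G \<Longrightarrow> Y \<in> vfields G \<Longrightarrow> F X Y = - F Y X"
  unfolding forms2_def by blast+

lemma forms3_forms2: "H \<in> forms3 G \<Longrightarrow> X \<in> vfields G \<Longrightarrow> H X \<in> forms2 G"
  and forms3_anti: "H \<in> forms3 G \<Longrightarrow> X \<in> vfields G \<Longrightarrow> Y \<in> vfields G \<Longrightarrow> Z \<in> vfields G \<Longrightarrow> H X Y Z = - H Y X Z"
  unfolding forms3_def by blast+

lemma smul_sect_simp: "smul_sect f s = (smul f (fst s), smul f (fst (snd s)), f * snd (snd s))"
  by (cases s) simp

lemma module_smul_sect: "module (smul_sect :: ('a \<Rightarrow> real) \<Rightarrow> 'a sect \<Rightarrow> 'a sect)"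
  by unfold_locales (auto simp: smul_sect_simp prod_eq_iff smul.scale_right_distrib smul.scale_left_distrib algebra_simps)

interpretation sect: module smul_sect by (rule module_smul_sect)

context smooth_manifold
begin

lemma cinf_linear_zero: assumes "cinf_linear G \<xi>" shows "\<xi> 0 = 0"
  using cinf_linear_smul[OF assms cinf_zero vfields_zero] by simp

lemma cinf_linear_minus: assumes "cinf_linear G \<xi>" "X \<in> vfields G" shows "\<xi> (- X) = - \<xi> X"
  using cinf_linear_smul[OF assms(1) cinf_minus[OF cinf_one] assms(2)] by (simp add: smul.scale_minus_left)

lemma cinf_linear_diff:
  assumes "cinf_linear G \<xi>" "X \<in> vfields G" "Y \<in> vfields G" shows "\<xi> (X - Y) = \<xi> X - \<xi> Y"
  using cinf_linear_add[OF assms(1,2) vfields_minus[OF assms(3)]] cinf_linear_minus[OF assms(1,3)] by simp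

lemma cinf_linear_sum:
  assumes "cinf_linear G \<xi>" and "finite I" and "\<And>i. i \<in> I \<Longrightarrow> X i \<in> vfields G"
  shows "\<xi> (\<Sum>i\<in>I. X i) = (\<Sum>i\<in>I. \<xi> (X i))"
  using assms(2,3)
proof (induction I rule: finite_induct)
  case (insert i I)
  have "\<xi> (X i + (\<Sum>i\<in>I. X i)) = \<xi> (X i) + \<xi> (\<Sum>i\<in>I. X i)"
    by (intro cinf_linear_add[OF assms(1)] vfields_sum) (use insert.prems in auto)
  moreover note insert.IH[OF insert.prems, OF insertI2]
  ultimately show ?case using insert.hyps by (simp only: sum.insert not_False_eq_True)
qed (simp add: cinf_linear_zero[OF assms(1)])

lemma cinf_linear_plusI:
  assumes "cinf_linear G \<xi>" "cinf_linear G \<eta>" shows "cinf_linear G (\<lambda>X. \<xi> X + \<eta> X)"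
  using assms unfolding cinf_linear_def by (simp add: cinf_add distrib_left)

lemma cinf_linear_multI:
  assumes "cinf_linear G \<xi>" "h \<in> cinf G" shows "cinf_linear G (\<lambda>X. h * \<xi> X)"
  using assms unfolding cinf_linear_def by (simp add: cinf_mult distrib_left mult.left_commute)

lemma cinf_linear_diffI:
  assumes "cinf_linear G \<xi>" "cinf_linear G \<eta>" shows "cinf_linear G (\<lambda>X. \<xi> X - \<eta> X)"
  using cinf_linear_plusI[OF assms(1) cinf_linear_multI[OF assms(2) cinf_minus[OF cinf_one]]] by simp

lemma cinf_linear_df: "f \<in> cinf G \<Longrightarrow> cinf_linear G (\<lambda>X. X f)"
  unfolding cinf_linear_def by (simp add: vfield_cinf smul_def)

lemma form1_of_forms1: assumes "cinf_linear G \<xi>" shows "form1_of G \<xi> \<in> forms1 G"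
  using assms unfolding forms1_def cinf_linear_def form1_of_def
  by (simp add: vfields_add vfields_smul)

lemma forms1_zero: "0 \<in> forms1 G"
  by (simp add: forms1_def cinf_linear_def cinf_zero)

lemma forms1_add: "\<xi> \<in> forms1 G \<Longrightarrow> \<eta> \<in> forms1 G \<Longrightarrow> \<xi> + \<eta> \<in> forms1 G"
  using cinf_linear_plusI[of \<xi> \<eta>] by (simp add: forms1_def plus_fun_def[of \<xi> \<eta>])

lemma forms1_smul: "f \<in> cinf G \<Longrightarrow> \<xi> \<in> forms1 G \<Longrightarrow> smul f \<xi> \<in> forms1 G"
  using cinf_linear_multI[of \<xi> f] by (simp add: forms1_def smul_def)

lemma sections_zero: "0 \<in> sections G"
  and sections_add: "s \<in> sections G \<Longrightarrow> t \<in> sections G \<Longrightarrow> s + t \<in> sections G"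
  and sections_smul: "f \<in> cinf G \<Longrightarrow> s \<in> sections G \<Longrightarrow> smul_sect f s \<in> sections G"
  by (auto simp: sections_def zero_prod_def vfields_zero forms1_zero cinf_zero vfields_add forms1_add cinf_add
      vfields_smul forms1_smul cinf_mult)

lemma sections_minus: "s \<in> sections G \<Longrightarrow> - s \<in> sections G"
  using sections_smul[OF cinf_minus[OF cinf_one]] by (simp add: sect.scale_minus_left)

lemma sections_diff: "s \<in> sections G \<Longrightarrow> t \<in> sections G \<Longrightarrow> s - t \<in> sections G"
  using sections_add[OF _ sections_minus, of s t] by simp

lemma sections_sum: "(\<And>i. i \<in> I \<Longrightarrow> s i \<in> sections G) \<Longrightarrow> (\<Sum>i\<in>I. s i) \<in> sections G"
proof (induction I rule: infinite_finite_induct)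
  case (insert i I)
  have "s i + (\<Sum>i\<in>I. s i) \<in> sections G" by (rule sections_add) (use insert in blast)+
  with insert.hyps show ?case by (simp only: sum.insert not_False_eq_True)
qed (simp_all add: sections_zero)

lemma
  assumes F: "F \<in> forms2 G" and XZ: "X \<in> vfields G" "Z \<in> vfields G"
  shows forms2_add_left: "Y \<in> vfields G \<Longrightarrow> F (X + Y) Z = F X Z + F Y Z"
    and forms2_smul_left: "f \<in> cinf G \<Longrightarrow> F (smul f X) Z = f * F X Z"
proof -
  show "F (X + Y) Z = F X Z + F Y Z" if Y: "Y \<in> vfields G"
    unfolding forms2_anti[OF F vfields_add[OF XZ(1) Y] XZ(2)] forms2_anti[OF F XZ] forms2_anti[OF F Y XZ(2)]
    by (simp add: cinf_linear_add[OF forms2_linear[OF F XZ(2)]] XZ Y)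
  show "F (smul f X) Z = f * F X Z" if f: "f \<in> cinf G"
    unfolding forms2_anti[OF F vfields_smul[OF f XZ(1)] XZ(2)] forms2_anti[OF F XZ]
    by (simp add: cinf_linear_smul[OF forms2_linear[OF F XZ(2)]] XZ f)
qed

lemma pairing_commute: "pairing s t = pairing t s"
  by (cases s; cases t) (auto simp: algebra_simps)

lemma
  assumes "s \<in> sections G" "t \<in> sections G"
  shows pairing_cinf: "pairing s t \<in> cinf G"
    and pairing_smul_left: "f \<in> cinf G \<Longrightarrow> pairing (smul_sect f s) t = f * pairing s t"
    and pairing_add_left: "s' \<in> sections G \<Longrightarrow> pairing (s + s') t = pairing s t + pairing s' t"
proof -
  obtain X \<xi> l Y \<eta> m where st: "s = (X, \<xi>, l)" "t = (Y, \<eta>, m)" by (cases s; cases t)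
  have *: "X \<in> vfields G" "cinf_linear G \<xi>" "l \<in> cinf G" "Y \<in> vfields G" "cinf_linear G \<eta>" "m \<in> cinf G"
    using assms by (auto simp: st sections_def forms1_def)
  have "pairing s t = (\<lambda>_. 1/2) * (\<xi> Y + \<eta> X) + l * m" by (auto simp: st)
  also have "\<dots> \<in> cinf G" by (intro cinf_add cinf_mult cinf_const cinf_linear_cinf[OF *(2)] cinf_linear_cinf[OF *(5)] *)
  finally show "pairing s t \<in> cinf G" .
  show "pairing (smul_sect f s) t = f * pairing s t" if "f \<in> cinf G"
    using cinf_linear_smul[OF *(5) that *(1)] by (auto simp: st smul_apply field_simps)
  show "pairing (s + s') t = pairing s t + pairing s' t" if "s' \<in> sections G"
  proof -
    obtain X' \<xi>' l' where s': "s' = (X', \<xi>', l')" by (cases s')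
    with that have "X' \<in> vfields G" by (auto simp: sections_def)
    from cinf_linear_add[OF *(5,1) this] show ?thesis by (auto simp: st s' field_simps)
  qed
qed

lemma pairing_zero_left: "t \<in> sections G \<Longrightarrow> pairing 0 t = 0"
  using pairing_smul_left[OF sections_zero _ cinf_zero] by (simp add: sect.scale_zero_left)

lemma pairing_minus_left: "s \<in> sections G \<Longrightarrow> t \<in> sections G \<Longrightarrow> pairing (- s) t = - pairing s t"
  using pairing_smul_left[OF _ _ cinf_minus[OF cinf_one], of s t] by (simp add: sect.scale_minus_left)

lemma pairing_diff_left:
  "s \<in> sections G \<Longrightarrow> s' \<in> sections G \<Longrightarrow> t \<in> sections G \<Longrightarrow> pairing (s - s') t = pairing s t - pairing s' t"
  using pairing_add_left[OF _ _ sections_minus, of s t s'] by (simp add: pairing_minus_left)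

lemma pairing_sum_left:
  assumes "finite I" "t \<in> sections G" "\<And>i. i \<in> I \<Longrightarrow> s i \<in> sections G"
  shows "pairing (\<Sum>i\<in>I. s i) t = (\<Sum>i\<in>I. pairing (s i) t)"
  using assms(1,3)
proof (induction I rule: finite_induct)
  case (insert i I)
  have "pairing (s i + (\<Sum>i\<in>I. s i)) t = pairing (s i) t + pairing (\<Sum>i\<in>I. s i) t"
    by (intro pairing_add_left sections_sum assms(2)) (use insert.prems in auto)
  moreover note insert.IH[OF insert.prems, OF insertI2]
  ultimately show ?case using insert.hyps by (simp only: sum.insert not_False_eq_True)
qed (simp add: pairing_zero_left assms(2))

lemma lie_bracket_smul_right:
  assumes "X \<in> vfields G" "Y \<in> vfields G" "h \<in> cinf G"
  shows "lie_bracket G X (smul h Y) = smul h (lie_bracket G X Y) + smul (X h) Y"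
  using lie_bracket_smul_left[OF assms(2,1,3)] lie_bracket_anti[OF assms(1) vfields_smul[OF assms(3,2)]]
    lie_bracket_anti[OF assms(1,2)] by (simp add: smul.scale_minus_right)

lemma lie_bracket_add_right:
  assumes "X \<in> vfields G" "Y \<in> vfields G" "Z \<in> vfields G"
  shows "lie_bracket G X (Y + Z) = lie_bracket G X Y + lie_bracket G X Z"
  using lie_bracket_add_left[OF assms(2,1,3)] lie_bracket_anti[OF assms(1)] assms vfields_add
  by (metis minus_add_distrib)

end

context left_inv_frame
begin

lemma lie_alg_zero: "0 \<in> lie_alg G"
  using vfields_zero by (auto simp: lie_alg_def push_def fun_eq_iff)

text \<open>A form is determined by its values on the frame because it is tensorial.\<close>

lemma forms1_eqI:
  assumes "\<xi> \<in> forms1 G" "\<eta> \<in> forms1 G" "\<And>a. \<xi> (v a) = \<eta> (v a)"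
  shows "\<xi> = \<eta>"
proof
  fix X show "\<xi> X = \<eta> X"
  proof (cases "X \<in> vfields G")
    case True
    then obtain c where c: "\<And>a. c a \<in> cinf G" "X = (\<Sum>a\<in>UNIV. smul (c a) (v a))"
      using vfield_coeffs by blast
    have "\<zeta> X = (\<Sum>a\<in>UNIV. c a * \<zeta> (v a))" if "cinf_linear G \<zeta>" for \<zeta>
      unfolding c(2) by (simp add: cinf_linear_sum[OF that] cinf_linear_smul[OF that] vfields_smul c(1) v_vfield)
    with assms show ?thesis by (simp add: forms1_linear)
  qed (use assms in \<open>auto simp: forms1_def\<close>)
qed

lemma cinf_linear_lie_der1:
  assumes X: "X \<in> vfields G" and \<eta>: "cinf_linear G \<eta>"
  shows "cinf_linear G (lie_der1 G X \<eta>)"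
  unfolding cinf_linear_def lie_der1_def
proof (intro conjI ballI)
  fix Y Z f assume Y: "Y \<in> vfields G" and Z: "Z \<in> vfields G"
  note cl = cinf_linear_cinf[OF \<eta>] and br = lie_bracket_vfields[OF X]
  show "X (\<eta> Y) - \<eta> (lie_bracket G X Y) \<in> cinf G"
    by (intro cinf_diff vfield_cinf[OF X] cl br Y)
  show "X (\<eta> (Y + Z)) - \<eta> (lie_bracket G X (Y + Z)) =
      X (\<eta> Y) - \<eta> (lie_bracket G X Y) + (X (\<eta> Z) - \<eta> (lie_bracket G X Z))"
    by (simp add: lie_bracket_add_right X Y Z cinf_linear_add[OF \<eta>] br vfield_add[OF X] cl)
next
  fix Y f assume Y: "Y \<in> vfields G" and f: "f \<in> cinf G"
  note cl = cinf_linear_cinf[OF \<eta>] and br = lie_bracket_vfields[OF X]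
  show "X (\<eta> (smul f Y)) - \<eta> (lie_bracket G X (smul f Y)) = f * (X (\<eta> Y) - \<eta> (lie_bracket G X Y))"
    by (simp add: lie_bracket_smul_right X Y f cinf_linear_add[OF \<eta>] cinf_linear_smul[OF \<eta>] br
        vfield_mult[OF X] cl vfields_smul vfield_cinf algebra_simps)
qed

text \<open>The form component \<open>L\<^sub>X \<eta> - i\<^sub>Y d\<xi>\<close> equals \<open>L\<^sub>X \<eta> - L\<^sub>Y \<xi> + d(\<xi>(Y))\<close>, a sum of tensorial
  expressions.\<close>

lemma dorfman_sections:
  assumes H: "H \<in> forms3 G" and F: "F \<in> forms2 G" and s: "s \<in> sections G" and t: "t \<in> sections G"
  shows "dorfman G H F s t \<in> sections G"
proof -
  obtain X \<xi> l Y \<eta> m where st: "s = (X, \<xi>, l)" "t = (Y, \<eta>, m)" by (cases s; cases t)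
  have *: "X \<in> vfields G" "cinf_linear G \<xi>" "l \<in> cinf G" "Y \<in> vfields G" "cinf_linear G \<eta>" "m \<in> cinf G"
    using s t by (auto simp: st sections_def forms1_def)
  have "(\<lambda>Z. lie_der1 G X \<eta> Z - d1 G \<xi> Y Z + 2 * m * Z l + H Y X Z - 2 * (m * F X Z - l * F Y Z)) =
    (\<lambda>Z. lie_der1 G X \<eta> Z - (lie_der1 G Y \<xi> Z - Z (\<xi> Y)) + (m + m) * Z l + H Y X Z
       - (\<lambda>_. 2) * (m * F X Z - l * F Y Z))"
    by (intro ext) (simp add: d1_def lie_der1_def numeral_fun_apply)
  moreover have "cinf_linear G \<dots>"
    by (intro cinf_linear_plusI cinf_linear_diffI cinf_linear_multI cinf_linear_lie_der1 cinf_linear_df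
        cinf_linear_cinf[OF *(2)] cinf_add cinf_const * forms2_linear[OF F] forms2_linear[OF forms3_forms2[OF H]])
  ultimately have "form1_of G (\<lambda>Z. lie_der1 G X \<eta> Z - d1 G \<xi> Y Z + 2 * m * Z l + H Y X Z - 2 * (m * F X Z - l * F Y Z)) \<in> forms1 G"
    by (simp only: form1_of_forms1)
  moreover have "X m - Y l + F X Y \<in> cinf G"
    by (intro cinf_add cinf_diff vfield_cinf[OF *(1)] vfield_cinf[OF *(4)] * cinf_linear_cinf[OF forms2_linear[OF F]])
  ultimately show ?thesis by (simp add: st sections_def lie_bracket_vfields *)
qed

lemma dorfman_add_left:
  assumes H: "H \<in> forms3 G" and F: "F \<in> forms2 G"
    and s: "s \<in> sections G" and s': "s' \<in> sections G" and t: "t \<in> sections G"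
  shows "dorfman G H F (s + s') t = dorfman G H F s t + dorfman G H F s' t"
proof -
  obtain X \<xi> l X' \<xi>' l' Y \<eta> m where st: "s = (X, \<xi>, l)" "s' = (X', \<xi>', l')" "t = (Y, \<eta>, m)"
    by (cases s; cases s'; cases t)
  have *: "X \<in> vfields G" "cinf_linear G \<xi>" "l \<in> cinf G" "Y \<in> vfields G" "cinf_linear G \<eta>" "m \<in> cinf G"
    "X' \<in> vfields G" "cinf_linear G \<xi>'" "l' \<in> cinf G"
    using s s' t by (auto simp: st sections_def forms1_def)
  have F1: "F (X + X') Z = F X Z + F X' Z" if Z: "Z \<in> vfields G" for Z
    by (rule forms2_add_left[OF F *(1) Z *(7)])
  let ?f = "\<lambda>X \<xi> l Z. lie_der1 G X \<eta> Z - d1 G \<xi> Y Z + 2 * m * Z l + H Y X Z - 2 * (m * F X Z - l * F Y Z)"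
  have "?f (X + X') (\<xi> + \<xi>') (l + l') Z = ?f X \<xi> l Z + ?f X' \<xi>' l' Z" if Z: "Z \<in> vfields G" for Z
  proof -
    have H1: "H Y (X + X') Z = H Y X Z + H Y X' Z"
      by (rule forms2_add_left[OF forms3_forms2[OF H *(4)] *(1) Z *(7)])
    have L: "lie_der1 G (X + X') \<eta> Z = lie_der1 G X \<eta> Z + lie_der1 G X' \<eta> Z"
      by (simp add: lie_der1_def lie_bracket_add_left * Z cinf_linear_add[OF *(5)] lie_bracket_vfields)
    have d: "d1 G (\<xi> + \<xi>') Y Z = d1 G \<xi> Y Z + d1 G \<xi>' Y Z"
      by (intro ext) (simp add: d1_def vfield_add * Z cinf_linear_cinf[OF *(2)] cinf_linear_cinf[OF *(8)])
    show ?thesis unfolding H1 L d F1[OF Z] vfield_add[OF Z *(3,9)] by (simp add: algebra_simps)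
  qed
  then have "form1_of G (?f (X + X') (\<xi> + \<xi>') (l + l')) = form1_of G (?f X \<xi> l) + form1_of G (?f X' \<xi>' l')"
    by (intro ext) (simp add: form1_of_def)
  then show ?thesis
    by (simp add: st lie_bracket_add_left * F1 vfield_add[OF *(4)])
qed

text \<open>In general \<open>[f s, t] = f [s, t] - \<pi>(t)(f) s + 2 \<langle>s, t\<rangle> df\<close>. The last term makes the Dorfman
  bracket non-tensorial on arguments that are not orthogonal.\<close>

lemma dorfman_smul_left:
  assumes H: "H \<in> forms3 G" and F: "F \<in> forms2 G"
    and s: "s \<in> sections G" and t: "t \<in> sections G" and f: "f \<in> cinf G" and orth: "pairing s t = 0"
  shows "dorfman G H F (smul_sect f s) t = smul_sect f (dorfman G H F s t) - smul_sect (anchor t f) s"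
proof -
  obtain X \<xi> l Y \<eta> m where st: "s = (X, \<xi>, l)" "t = (Y, \<eta>, m)" by (cases s; cases t)
  have *: "X \<in> vfields G" "cinf_linear G \<xi>" "l \<in> cinf G" "Y \<in> vfields G" "cinf_linear G \<eta>" "m \<in> cinf G"
    using s t by (auto simp: st sections_def forms1_def)
  have sf: "smul f X h = f * X h" for h by (simp add: smul_def)
  have F1: "F (smul f X) Z = f * F X Z" if Z: "Z \<in> vfields G" for Z
    by (rule forms2_smul_left[OF F *(1) Z f])
  let ?f = "\<lambda>X \<xi> l Z. lie_der1 G X \<eta> Z - d1 G \<xi> Y Z + 2 * m * Z l + H Y X Z - 2 * (m * F X Z - l * F Y Z)"
  have "?f (smul f X) (smul f \<xi>) (f * l) Z = f * ?f X \<xi> l Z - Y f * \<xi> Z" if Z: "Z \<in> vfields G" for Z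
  proof -
    have H1: "H Y (smul f X) Z = f * H Y X Z"
      by (rule forms2_smul_left[OF forms3_forms2[OF H *(4)] *(1) Z f])
    have L: "lie_der1 G (smul f X) \<eta> Z = f * lie_der1 G X \<eta> Z + Z f * \<eta> X"
      by (simp add: lie_der1_def lie_bracket_smul_left * Z f cinf_linear_diff[OF *(5)] cinf_linear_smul[OF *(5)]
          lie_bracket_vfields vfields_smul vfield_cinf sf algebra_simps)
    have d: "d1 G (smul f \<xi>) Y Z = f * d1 G \<xi> Y Z + Y f * \<xi> Z - Z f * \<xi> Y"
      by (intro ext) (simp add: d1_def smul_def[of f \<xi>] vfield_mult * Z f cinf_linear_cinf[OF *(2)] algebra_simps)
    have "Z f * (\<xi> Y + \<eta> X) + 2 * (Z f * l * m) = 2 * Z f * pairing s t"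
      by (intro ext) (simp add: st numeral_fun_apply algebra_simps)
    then have 0: "Z f * (\<xi> Y + \<eta> X) + 2 * (Z f * l * m) = 0" by (simp add: orth)
    have "?f (smul f X) (smul f \<xi>) (f * l) Z =
        f * ?f X \<xi> l Z - Y f * \<xi> Z + (Z f * (\<xi> Y + \<eta> X) + 2 * (Z f * l * m))"
      unfolding H1 L d F1[OF Z] vfield_mult[OF Z f *(3)] by (simp add: algebra_simps)
    then show ?thesis unfolding 0 by simp
  qed
  then have "form1_of G (?f (smul f X) (smul f \<xi>) (f * l)) = smul f (form1_of G (?f X \<xi> l)) - smul (Y f) \<xi>"
    using s by (intro ext) (auto simp: form1_of_def smul_apply st sections_def forms1_def)
  then show ?thesis
    by (simp add: st lie_bracket_smul_left * f F1 vfield_mult[OF *(4)] sf algebra_simps)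
qed

lemma dorfman_sum_left:
  assumes H: "H \<in> forms3 G" and F: "F \<in> forms2 G" and t: "t \<in> sections G"
    and "finite I" "\<And>i. i \<in> I \<Longrightarrow> s i \<in> sections G"
  shows "dorfman G H F (\<Sum>i\<in>I. s i) t = (\<Sum>i\<in>I. dorfman G H F (s i) t)"
  using assms(4,5)
proof (induction I rule: finite_induct)
  case empty
  show ?case using dorfman_add_left[OF H F sections_zero sections_zero t] by simp
next
  case (insert i I)
  have "dorfman G H F (s i + (\<Sum>i\<in>I. s i)) t = dorfman G H F (s i) t + dorfman G H F (\<Sum>i\<in>I. s i) t"
    by (intro dorfman_add_left H F sections_sum t) (use insert.prems in auto)
  moreover note insert.IH[OF insert.prems, OF insertI2]
  ultimately show ?case using insert.hyps by (simp only: sum.insert not_False_eq_True)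
qed

end


section \<open>A pseudo-orthonormal frame of the Courant algebroid\<close>

text \<open>The frame of \<open>E\<close> is indexed as follows: \<open>Some (a, True)\<close> stands for \<open>v\<^sub>a + g(v\<^sub>a)\<close>, \<open>Some (a, False)\<close>
  for \<open>v\<^sub>a - g(v\<^sub>a)\<close> and \<open>None\<close> for the section \<open>1\<close> of the trivial line bundle. The first kind and \<open>None\<close>
  span \<open>E\<^sub>+\<close>.\<close>

type_synonym frame_index = "(3 \<times> bool) option"

definition side :: "bool \<Rightarrow> real" where
  "side s = (if s then 1 else - 1)"

definition plus_index :: "frame_index set" where
  "plus_index = insert None (range (\<lambda>a. Some (a, True)))"

lemma frame_index_cases:
  obtains "A = None" | a s where "A = Some (a :: 3, s :: bool)"
  by (cases A) auto

locale einstein_frame = left_inv_frame G v for G :: "'a::{t2_space, second_countable_topology} lie_data" and v +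
  fixes g :: "'a form2" and \<epsilon> :: "3 \<Rightarrow> real" and H :: "'a form3" and F :: "'a form2"
  assumes metric: "left_inv_metric G g"
    and eps: "\<And>a. \<epsilon> a = 1 \<or> \<epsilon> a = - 1"
    and orthonormal: "\<And>a b. g (v a) (v b) = (\<lambda>_. if a = b then \<epsilon> a else 0)"
    and H: "H \<in> forms3 G" "left_inv3 G H"
    and F: "F \<in> forms2 G" "left_inv2 G F"
begin

lemma g_linear: "X \<in> vfields G \<Longrightarrow> cinf_linear G (g X)"
  and g_sym: "X \<in> vfields G \<Longrightarrow> Y \<in> vfields G \<Longrightarrow> g X Y = g Y X"
  and g_left_inv: "left_inv2 G g"
  using metric unfolding left_inv_metric_def by blast+

lemma left_inv2_const:
  assumes "left_inv2 G B" "X \<in> lie_alg G" "Y \<in> lie_alg G" shows "B X Y p = B X Y (gone G)"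
proof -
  have "B (push G p X) (push G p Y) (gmult G p (gone G)) = B X Y (gone G)"
    using assms unfolding left_inv2_def lie_alg_def by blast
  then show ?thesis using assms(2,3) by (simp add: lie_alg_def)
qed

lemma left_inv3_const:
  assumes "left_inv3 G B" "X \<in> lie_alg G" "Y \<in> lie_alg G" "Z \<in> lie_alg G" shows "B X Y Z p = B X Y Z (gone G)"
proof -
  have "B (push G p X) (push G p Y) (push G p Z) (gmult G p (gone G)) = B X Y Z (gone G)"
    using assms unfolding left_inv3_def lie_alg_def by blast
  then show ?thesis using assms(2,3,4) by (simp add: lie_alg_def)
qed

definition bracket_const :: "3 \<Rightarrow> 3 \<Rightarrow> 3 \<Rightarrow> real" where
  "bracket_const a b d = g (lie_bracket G (v a) (v b)) (v d) (gone G)"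

definition H_const :: "3 \<Rightarrow> 3 \<Rightarrow> 3 \<Rightarrow> real" where
  "H_const a b d = H (v a) (v b) (v d) (gone G)"

definition F_const :: "3 \<Rightarrow> 3 \<Rightarrow> real" where
  "F_const a b = F (v a) (v b) (gone G)"

lemma g_bracket: "g (v d) (lie_bracket G (v a) (v b)) = (\<lambda>_. bracket_const a b d)"
  unfolding bracket_const_def g_sym[OF v_vfield lie_bracket_vfields[OF v_vfield v_vfield]]
  by (rule ext, rule left_inv2_const[OF g_left_inv bracket_closed v_lie_alg])

lemma H_frame: "H (v a) (v b) (v d) = (\<lambda>_. H_const a b d)"
  unfolding H_const_def by (rule ext, rule left_inv3_const[OF H(2) v_lie_alg v_lie_alg v_lie_alg])

lemma F_frame: "F (v a) (v b) = (\<lambda>_. F_const a b)"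
  unfolding F_const_def by (rule ext, rule left_inv2_const[OF F(2) v_lie_alg v_lie_alg])

lemma bracket_const_anti: "bracket_const a b d = - bracket_const b a d"
proof -
  have "g (v d) (lie_bracket G (v a) (v b)) = - g (v d) (lie_bracket G (v b) (v a))"
    unfolding lie_bracket_anti[OF v_vfield[of a] v_vfield[of b]]
    by (rule cinf_linear_minus[OF g_linear[OF v_vfield] lie_bracket_vfields[OF v_vfield v_vfield]])
  then show ?thesis by (simp add: g_bracket fun_eq_iff)
qed

lemma F_const_anti: "F_const a b = - F_const b a"
  using forms2_anti[OF F(1) v_vfield[of a] v_vfield[of b]] by (simp add: F_frame fun_eq_iff)

lemma H_const_anti: "H_const a b d = - H_const b a d" "H_const a b d = - H_const a d b"
  using forms3_anti[OF H(1) v_vfield[of a] v_vfield[of b] v_vfield[of d]] forms2_anti[OF forms3_forms2[OF H(1) v_vfield[of a]] v_vfield[of b] v_vfield[of d]]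
  by (simp_all add: H_frame fun_eq_iff)

fun e :: "frame_index \<Rightarrow> 'a sect" where
  "e None = (0, 0, 1)"
| "e (Some (a, s)) = (v a, form1_of G (\<lambda>X. (\<lambda>_. side s) * g (v a) X), 0)"

fun \<sigma> :: "frame_index \<Rightarrow> real" where
  "\<sigma> None = 1"
| "\<sigma> (Some (a, s)) = side s * \<epsilon> a"

text \<open>These are the numbers \<open>\<langle>[e\<^sub>A, e\<^sub>A'], e\<^sub>A''\<rangle>\<close>, as \<open>dorfman_frame_pairing\<close> shows. The factor \<open>2\<close> of the \<open>F\<close>-terms
  in the bracket cancels against the factor \<open>1/2\<close> of the scalar product.\<close>

fun dorfman_const :: "frame_index \<Rightarrow> frame_index \<Rightarrow> frame_index \<Rightarrow> real" where
  "dorfman_const (Some (a, s)) (Some (b, t)) (Some (d, r)) = (side r * bracket_const a b d + side s * bracket_const b d a + side t * bracket_const d a b - H_const a b d) / 2"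
| "dorfman_const None (Some (b, t)) (Some (d, r)) = F_const b d"
| "dorfman_const (Some (a, s)) None (Some (d, r)) = F_const d a"
| "dorfman_const (Some (a, s)) (Some (b, t)) None = F_const a b"
| "dorfman_const _ _ _ = 0"

lemma eps_square: "\<epsilon> a * \<epsilon> a = 1"
  using eps[of a] by auto

lemma \<sigma>_square: "\<sigma> A * \<sigma> A = 1"
  by (cases A rule: \<sigma>.cases) (auto simp: side_def eps_square)

text \<open>Total antisymmetry comes from that of \<open>H\<close> and \<open>F\<close> and, for the terms with the Lie bracket, from their
  cyclic arrangement.\<close>

lemma dorfman_const_anti: "dorfman_const A A' A'' = - dorfman_const A' A A''" "dorfman_const A A' A'' = - dorfman_const A A'' A'"
proof -
  have "dorfman_const A A' A'' = - dorfman_const A' A A'' \<and> dorfman_const A A' A'' = - dorfman_const A A'' A'"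
  proof (cases "A = None \<or> A' = None \<or> A'' = None")
    case True
    then show ?thesis
      by (cases A rule: frame_index_cases; cases A' rule: frame_index_cases; cases A'' rule: frame_index_cases)
        (simp_all add: F_const_anti[symmetric])
  next
    case False
    then obtain a s b t d r where A: "A = Some (a, s)" "A' = Some (b, t)" "A'' = Some (d, r)" by auto
    show ?thesis
      unfolding A dorfman_const.simps bracket_const_anti[of b a] bracket_const_anti[of a d] bracket_const_anti[of d b] H_const_anti(1)[of b a] H_const_anti(2)[of a d]
      by (simp add: algebra_simps add_divide_distrib diff_divide_distrib)
  qed
  then show "dorfman_const A A' A'' = - dorfman_const A' A A''" "dorfman_const A A' A'' = - dorfman_const A A'' A'" by auto
qed

lemma e_sections: "e A \<in> sections G"
proof (cases A rule: frame_index_cases)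
  case (2 a s)
  then show ?thesis
    by (simp add: sections_def v_vfield form1_of_forms1 cinf_linear_multI g_linear cinf_const cinf_zero)
qed (simp add: sections_def vfields_zero forms1_zero cinf_one)

lemma pairing_frame: "pairing (e A) (e A') = (\<lambda>_. if A = A' then \<sigma> A else 0)"
  by (cases A rule: frame_index_cases; cases A' rule: frame_index_cases)
    (auto simp: form1_of_def v_vfield vfields_zero orthonormal side_def fun_eq_iff cinf_linear_zero[OF g_linear[OF v_vfield]])

text \<open>The scalar product is non-degenerate: the pairings with \<open>v\<^sub>a + g(v\<^sub>a)\<close> and with \<open>v\<^sub>a - g(v\<^sub>a)\<close> separate the
  form component from the metric dual of the vector component.\<close>

lemma sections_eqI:
  assumes s: "s \<in> sections G" and t: "t \<in> sections G" and eq: "\<And>A. pairing s (e A) = pairing t (e A)"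
  shows "s = t"
proof -
  have w: "s - t \<in> sections G" by (rule sections_diff[OF s t])
  have "pairing (s - t) (e A) = 0" for A
    using pairing_diff_left[OF s t e_sections, of A] eq[of A] by simp
  moreover obtain X \<xi> l where X: "s - t = (X, \<xi>, l)" by (cases "s - t")
  ultimately have 0: "pairing (X, \<xi>, l) (e A) p = 0" for A p by simp
  have XX: "X \<in> vfields G" "\<xi> \<in> forms1 G" using w by (auto simp: X sections_def)
  have l: "l = 0" using 0[of None] cinf_linear_zero[OF forms1_linear[OF XX(2)]] by (auto simp: fun_eq_iff)
  have "\<xi> (v a) p + side r * g (v a) X p = 0" for a r p
    using 0[of "Some (a, r)" p] XX(1) by (simp add: form1_of_def)
  from this[of _ _ True] this[of _ _ False] have 1: "\<xi> (v a) p = 0" "g (v a) X p = 0" for a p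
    by (auto simp: side_def)
  have "\<xi> = 0" by (rule forms1_eqI[OF XX(2) forms1_zero]) (auto simp: 1 fun_eq_iff)
  moreover obtain k where k: "\<And>a. k a \<in> cinf G" "X = (\<Sum>a\<in>UNIV. smul (k a) (v a))"
    using vfield_coeffs[OF XX(1)] by blast
  have "k a = 0" for a
  proof
    fix p
    have "g (v a) X = (\<Sum>b\<in>UNIV. k b * g (v a) (v b))"
      unfolding k(2) by (simp add: cinf_linear_sum[OF g_linear[OF v_vfield]] cinf_linear_smul[OF g_linear[OF v_vfield]]
          vfields_smul k(1) v_vfield)
    then have "g (v a) X p = (\<Sum>b\<in>UNIV. if a = b then k b p * \<epsilon> a else 0)"
      by (simp add: sum_fun_apply orthonormal if_distrib[of "\<lambda>x. _ * x"] cong: if_cong)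
    then show "k a p = 0 p" using 1(2)[of a p] eps[of a] by auto
  qed
  then have "X = 0" using k(2) by simp
  ultimately show ?thesis using X l by (simp add: zero_prod_def[symmetric])
qed

lemma section_expand:
  assumes s: "s \<in> sections G"
  shows "s = (\<Sum>A\<in>UNIV. smul_sect ((\<lambda>_. \<sigma> A) * pairing s (e A)) (e A))"
proof (rule sections_eqI[OF s])
  note cinf = cinf_mult[OF cinf_const pairing_cinf[OF s e_sections]]
  show "(\<Sum>A\<in>UNIV. smul_sect ((\<lambda>_. \<sigma> A) * pairing s (e A)) (e A)) \<in> sections G"
    by (intro sections_sum sections_smul e_sections cinf)
  fix A'
  have "pairing (\<Sum>A\<in>UNIV. smul_sect ((\<lambda>_. \<sigma> A) * pairing s (e A)) (e A)) (e A') =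
      (\<Sum>A\<in>UNIV. (\<lambda>_. \<sigma> A) * pairing s (e A) * pairing (e A) (e A'))"
    by (simp add: pairing_sum_left e_sections sections_smul cinf pairing_smul_left)
  also have "\<dots> = (\<Sum>A\<in>UNIV. if A' = A then pairing s (e A) else 0)"
  proof (rule sum.cong[OF refl])
    fix A show "(\<lambda>_. \<sigma> A) * pairing s (e A) * pairing (e A) (e A') = (if A' = A then pairing s (e A) else 0)"
      using \<sigma>_square[of A] by (auto simp: pairing_frame fun_eq_iff mult.commute mult.left_commute)
  qed
  also have "\<dots> = pairing s (e A')" by simp
  finally show "pairing s (e A') = pairing (\<Sum>A\<in>UNIV. smul_sect ((\<lambda>_. \<sigma> A) * pairing s (e A)) (e A)) (e A')" ..
qed

lemma anchor_e: "anchor (e A) \<in> vfields G"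
  by (cases A rule: frame_index_cases) (simp_all add: v_vfield vfields_zero)

text \<open>Left-invariance of the frame makes its divergences constant.\<close>

lemma e_left_inv: "e A \<in> left_inv_sections G"
proof (cases A rule: frame_index_cases)
  case (2 a s)
  have "left_inv1 G (form1_of G (\<lambda>X. (\<lambda>_. side s) * g (v a) X))"
    unfolding left_inv1_def
  proof (intro allI ballI)
    fix b p X assume X: "X \<in> vfields G"
    have "g (push G b (v a)) (push G b X) (gmult G b p) = g (v a) X p"
      using metric X v_vfield unfolding left_inv_metric_def left_inv2_def by blast
    moreover have "push G b (v a) = v a" using v_lie_alg by (simp add: lie_alg_def)
    ultimately show "form1_of G (\<lambda>X. (\<lambda>_. side s) * g (v a) X) (push G b X) (gmult G b p) =
        form1_of G (\<lambda>X. (\<lambda>_. side s) * g (v a) X) X p"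
      by (simp add: form1_of_def X push_vfields)
  qed
  then show ?thesis using e_sections[of A] v_lie_alg by (simp add: 2 left_inv_sections_def)
next
  case 1
  then show ?thesis using e_sections[of A] by (simp add: left_inv_sections_def lie_alg_zero left_inv1_def)
qed

text \<open>All pairings of left-invariant fields and forms are constant, so every derivative in the bracket
  vanishes except for the terms with \<open>[X, Y]\<close>.\<close>

lemma dorfman_frame_pairing: "pairing (dorfman G H F (e A) (e A')) (e A'') = (\<lambda>_. dorfman_const A A' A'')"
proof -
  have vc: "v a (\<lambda>_. k) = 0" "v a 0 = 0" "v a 1 = 0" for a k
    using vfield_const[OF v_vfield] by (simp_all add: zero_fun_def one_fun_def)
  have F0: "F 0 X = 0" if "X \<in> vfields G" for X
    using forms2_smul_left[OF F(1) vfields_zero that cinf_zero] by simp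
  have F0': "F X 0 = 0" if "X \<in> vfields G" for X
    using cinf_linear_zero[OF forms2_linear[OF F(1) that]] .
  have H0: "H X 0 Y = 0" if "X \<in> vfields G" "Y \<in> vfields G" for X Y
    using forms2_smul_left[OF forms3_forms2[OF H(1) that(1)] vfields_zero that(2) cinf_zero] by simp
  have H0': "H 0 X Y = 0" if "X \<in> vfields G" "Y \<in> vfields G" for X Y
    using forms3_anti[OF H(1) vfields_zero that] H0[OF that] by simp
  have H0'': "H X Y 0 = 0" if "X \<in> vfields G" "Y \<in> vfields G" for X Y
    by (rule cinf_linear_zero[OF forms2_linear[OF forms3_forms2[OF H(1) that(1)] that(2)]])
  have br: "lie_bracket G (v a) (v b) \<in> vfields G" for a b by (rule lie_bracket_vfields[OF v_vfield v_vfield])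
  have g0: "g (v a) 0 = 0" for a by (rule cinf_linear_zero[OF g_linear[OF v_vfield]])
  note simps = fun_eq_iff form1_of_def lie_der1_def d1_def v_vfield vfields_zero br orthonormal vc F_frame H_frame
    F0 F0' H0 H0' g_bracket g0 lie_bracket_zero_left lie_bracket_zero_right numeral_fun_apply times_fun_def[of "\<lambda>_. side _"]
  show ?thesis
  proof (cases "A = None \<or> A' = None \<or> A'' = None")
    case True
    then show ?thesis
      by (cases A rule: frame_index_cases; cases A' rule: frame_index_cases; cases A'' rule: frame_index_cases) (simp_all add: simps H0'' F_const_anti[symmetric])
  next
    case False
    then obtain a s b t d r where A: "A = Some (a, s)" "A' = Some (b, t)" "A'' = Some (d, r)" by auto
    show ?thesis
      unfolding A using bracket_const_anti[of a d b] H_const_anti(1)[of b a d] by (simp add: simps field_simps)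
  qed
qed

end


section \<open>The Ricci tensors in the frame\<close>

context einstein_frame
begin

lemma cinf_linear_uminusI:
  assumes "cinf_linear G \<xi>" shows "cinf_linear G (- \<xi>)"
proof -
  have "- \<xi> = (\<lambda>X. - 1 * \<xi> X)" by (intro ext) simp
  with cinf_linear_multI[OF assms cinf_minus[OF cinf_one]] show ?thesis by simp
qed

text \<open>The submodule spanned by the frame sections with index in \<open>S\<close>, described as an orthogonal complement. This
  treats \<open>E\<close>, \<open>E\<^sub>+\<close> and \<open>E\<^sub>-\<close> uniformly.\<close>

definition frame_span :: "frame_index set \<Rightarrow> 'a sect set" where
  "frame_span S = {s \<in> sections G. \<forall>A. A \<notin> S \<longrightarrow> pairing s (e A) = 0}"

lemma frame_span_sections: "s \<in> frame_span S \<Longrightarrow> s \<in> sections G"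
  by (simp add: frame_span_def)

lemma e_frame_span: "A \<in> S \<Longrightarrow> e A \<in> frame_span S"
  by (auto simp: frame_span_def e_sections pairing_frame)

lemma frame_span_diff: "s \<in> frame_span S \<Longrightarrow> t \<in> frame_span S \<Longrightarrow> s - t \<in> frame_span S"
  by (auto simp: frame_span_def sections_diff pairing_diff_left e_sections)

lemma frame_span_expand:
  assumes s: "s \<in> frame_span S"
  shows "s = (\<Sum>A\<in>S. smul_sect ((\<lambda>_. \<sigma> A) * pairing s (e A)) (e A))"
proof -
  have "s = (\<Sum>A\<in>UNIV. smul_sect ((\<lambda>_. \<sigma> A) * pairing s (e A)) (e A))"
    by (rule section_expand[OF frame_span_sections[OF s]])
  also have "\<dots> = (\<Sum>A\<in>S. smul_sect ((\<lambda>_. \<sigma> A) * pairing s (e A)) (e A))"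
    using s by (intro sum.mono_neutral_right) (auto simp: frame_span_def)
  finally show ?thesis .
qed

lemma pairing_frame_sum:
  assumes "\<And>A. A \<in> S \<Longrightarrow> f A \<in> cinf G" and A: "A' \<in> S"
  shows "pairing (\<Sum>A\<in>S. smul_sect (f A) (e A)) (e A') = (\<lambda>_. \<sigma> A') * f A'"
proof -
  have "pairing (\<Sum>A\<in>S. smul_sect (f A) (e A)) (e A') = (\<Sum>A\<in>S. f A * pairing (e A) (e A'))"
    by (simp add: pairing_sum_left e_sections sections_smul assms pairing_smul_left)
  also have "\<dots> = (\<Sum>A\<in>S. if A = A' then (\<lambda>_. \<sigma> A') * f A' else 0)"
    by (rule sum.cong) (auto simp: pairing_frame fun_eq_iff)
  finally show ?thesis using A by simp
qed

lemma frame_span_basis: "is_basis smul_sect (cinf G) (frame_span S) S e"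
  unfolding is_basis_def
proof (intro conjI ballI)
  fix s assume s: "s \<in> frame_span S"
  let ?c = "\<lambda>A. (\<lambda>_. \<sigma> A) * pairing s (e A)"
  have cinf: "?c A \<in> cinf G" for A
    by (intro cinf_mult cinf_const pairing_cinf frame_span_sections[OF s] e_sections)
  show "\<exists>!f. f \<in> S \<rightarrow>\<^sub>E cinf G \<and> s = (\<Sum>A\<in>S. smul_sect (f A) (e A))"
  proof (rule ex1I)
    have "(\<Sum>A\<in>S. smul_sect (restrict ?c S A) (e A)) = (\<Sum>A\<in>S. smul_sect (?c A) (e A))"
      by (rule sum.cong) auto
    then show "restrict ?c S \<in> S \<rightarrow>\<^sub>E cinf G \<and> s = (\<Sum>A\<in>S. smul_sect (restrict ?c S A) (e A))"
      using cinf frame_span_expand[OF s] by (simp add: restrict_PiE_iff)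
  next
    fix f assume f: "f \<in> S \<rightarrow>\<^sub>E cinf G \<and> s = (\<Sum>A\<in>S. smul_sect (f A) (e A))"
    then have fS: "f \<in> S \<rightarrow>\<^sub>E cinf G" and fs: "s = (\<Sum>A\<in>S. smul_sect (f A) (e A))" by blast+
    show "f = restrict ?c S"
    proof
      fix A show "f A = restrict ?c S A"
      proof (cases "A \<in> S")
        case True
        have "pairing s (e A) = (\<lambda>_. \<sigma> A) * f A"
          unfolding fs by (rule pairing_frame_sum[OF PiE_mem[OF fS] True])
        then have "?c A = f A" using \<sigma>_square[of A] by (simp add: fun_eq_iff mult.assoc[symmetric])
        then show ?thesis using True by simp
      qed (use PiE_arb[OF fS] in simp)
    qed
  qed
qed (simp_all add: e_frame_span)

lemma frame_span_orthogonal: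
  assumes s: "s \<in> frame_span S" and t: "t \<in> frame_span (- S)"
  shows "pairing s t = 0"
proof -
  have "pairing s t = pairing (\<Sum>A\<in>S. smul_sect ((\<lambda>_. \<sigma> A) * pairing s (e A)) (e A)) t"
    using frame_span_expand[OF s] by simp
  also have "\<dots> = (\<Sum>A\<in>S. (\<lambda>_. \<sigma> A) * pairing s (e A) * pairing (e A) t)"
    by (simp add: pairing_sum_left e_sections sections_smul frame_span_sections[OF t] pairing_smul_left
        cinf_mult cinf_const pairing_cinf frame_span_sections[OF s])
  also have "\<dots> = 0"
    using t by (intro sum.neutral) (auto simp: frame_span_def pairing_commute[of "e _"])
  finally show ?thesis .
qed

lemma frame_span_UNIV: "frame_span UNIV = sections G"
  by (simp add: frame_span_def)

lemma E_minus_eq: "E_minus G g = frame_span (- plus_index)"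
proof (intro equalityI subsetI)
  fix s assume "s \<in> E_minus G g"
  then obtain X where s: "s = (X, form1_of G (- g X), 0)" and X: "X \<in> vfields G" by (auto simp: E_minus_def)
  have "cinf_linear G (- g X)"
    by (rule cinf_linear_uminusI[OF g_linear[OF X]])
  then have "s \<in> sections G" by (simp add: s sections_def X form1_of_forms1 cinf_zero)
  moreover have "pairing s (e A) = 0" if "A \<in> plus_index" for A
    using that g_sym[OF X v_vfield] cinf_linear_zero[OF g_linear[OF X]]
    by (auto simp: plus_index_def s form1_of_def X v_vfield vfields_zero side_def fun_eq_iff)
  ultimately show "s \<in> frame_span (- plus_index)" by (simp add: frame_span_def)
next
  fix s assume s: "s \<in> frame_span (- plus_index)"
  obtain X \<xi> l where st: "s = (X, \<xi>, l)" by (cases s)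
  have X: "X \<in> vfields G" and \<xi>: "\<xi> \<in> forms1 G" using frame_span_sections[OF s] by (auto simp: st sections_def)
  have orth: "pairing s (e A) p = 0" if "A \<in> plus_index" for A p using s that by (simp add: frame_span_def)
  have "l = 0"
    using orth[of None] cinf_linear_zero[OF forms1_linear[OF \<xi>]] by (auto simp: plus_index_def st fun_eq_iff)
  moreover have "\<xi> = form1_of G (- g X)"
  proof (rule forms1_eqI[OF \<xi>])
    have "cinf_linear G (- g X)"
      by (rule cinf_linear_uminusI[OF g_linear[OF X]])
    then show "form1_of G (- g X) \<in> forms1 G" by (rule form1_of_forms1)
    fix a
    show "\<xi> (v a) = form1_of G (- g X) (v a)"
    proof
      fix p show "\<xi> (v a) p = form1_of G (- g X) (v a) p"
        using orth[of "Some (a, True)" p] g_sym[OF X v_vfield]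
        by (simp add: plus_index_def st form1_of_def X v_vfield side_def)
    qed
  qed
  ultimately show "s \<in> E_minus G g" using X by (auto simp: E_minus_def st)
qed

lemma E_plus_eq: "E_plus G g = frame_span plus_index"
proof (intro equalityI subsetI)
  fix s assume "s \<in> E_plus G g"
  then show "s \<in> frame_span plus_index"
    unfolding E_plus_def E_minus_eq by (auto simp: frame_span_def[of plus_index] intro: e_frame_span)
next
  fix s assume "s \<in> frame_span plus_index"
  then show "s \<in> E_plus G g"
    unfolding E_plus_def E_minus_eq by (auto simp: frame_span_sections frame_span_orthogonal)
qed

end

locale einstein_connection = einstein_frame G v g \<epsilon> H F
  for G :: "'a::{t2_space, second_countable_topology} lie_data" and v g \<epsilon> H F +
  fixes D :: "'a sect \<Rightarrow> 'a sect \<Rightarrow> 'a sect" and \<delta> :: "'a sect \<Rightarrow> 'a \<Rightarrow> real"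
  assumes LC: "levi_civita G H F g D"
    and div: "\<And>u. u \<in> sections G \<Longrightarrow> div_of G D u = \<delta> u"
    and inv: "left_inv_divergence G \<delta>"
begin

lemma
  shows D_sections: "u \<in> sections G \<Longrightarrow> w \<in> sections G \<Longrightarrow> D u w \<in> sections G"
    and D_add_left: "u \<in> sections G \<Longrightarrow> u' \<in> sections G \<Longrightarrow> w \<in> sections G \<Longrightarrow> D (u + u') w = D u w + D u' w"
    and D_add_right: "u \<in> sections G \<Longrightarrow> w' \<in> sections G \<Longrightarrow> w \<in> sections G \<Longrightarrow> D u (w + w') = D u w + D u w'"
    and D_smul_left: "f \<in> cinf G \<Longrightarrow> u \<in> sections G \<Longrightarrow> w \<in> sections G \<Longrightarrow> D (smul_sect f u) w = smul_sect f (D u w)"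
    and D_smul_right: "f \<in> cinf G \<Longrightarrow> u \<in> sections G \<Longrightarrow> w \<in> sections G \<Longrightarrow>
      D u (smul_sect f w) = smul_sect (anchor u f) w + smul_sect f (D u w)"
    and D_metric: "u \<in> sections G \<Longrightarrow> w \<in> sections G \<Longrightarrow> w' \<in> sections G \<Longrightarrow>
      anchor u (pairing w w') = pairing (D u w) w' + pairing w (D u w')"
    and D_torsion: "u \<in> sections G \<Longrightarrow> w \<in> sections G \<Longrightarrow> w' \<in> sections G \<Longrightarrow> torsion G H F D u w w' = 0"
    and D_minus: "u \<in> sections G \<Longrightarrow> w \<in> frame_span (- plus_index) \<Longrightarrow> D u w \<in> frame_span (- plus_index)"
  using LC unfolding levi_civita_def gen_connection_def E_minus_eq by blast+

lemma D_zero_left: "w \<in> sections G \<Longrightarrow> D 0 w = 0"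
  using D_smul_left[OF cinf_zero sections_zero] by (simp add: sect.scale_zero_left)

lemma D_zero_right: "u \<in> sections G \<Longrightarrow> D u 0 = 0"
  using D_add_right[OF _ sections_zero sections_zero] by simp

lemma D_sum_left:
  assumes "finite I" "w \<in> sections G" "\<And>i. i \<in> I \<Longrightarrow> s i \<in> sections G"
  shows "D (\<Sum>i\<in>I. s i) w = (\<Sum>i\<in>I. D (s i) w)"
  using assms(1,3)
proof (induction I rule: finite_induct)
  case (insert i I)
  have "D (s i + (\<Sum>i\<in>I. s i)) w = D (s i) w + D (\<Sum>i\<in>I. s i) w"
    by (intro D_add_left sections_sum assms(2)) (use insert.prems in auto)
  moreover note insert.IH[OF insert.prems, OF insertI2]
  ultimately show ?case using insert.hyps by (simp only: sum.insert not_False_eq_True)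
qed (simp add: D_zero_left assms(2))

lemma D_sum_right:
  assumes "finite I" "u \<in> sections G" "\<And>i. i \<in> I \<Longrightarrow> s i \<in> sections G"
  shows "D u (\<Sum>i\<in>I. s i) = (\<Sum>i\<in>I. D u (s i))"
  using assms(1,3)
proof (induction I rule: finite_induct)
  case (insert i I)
  have "D u (s i + (\<Sum>i\<in>I. s i)) = D u (s i) + D u (\<Sum>i\<in>I. s i)"
    by (intro D_add_right sections_sum assms(2)) (use insert.prems in auto)
  moreover note insert.IH[OF insert.prems, OF insertI2]
  ultimately show ?case using insert.hyps by (simp only: sum.insert not_False_eq_True)
qed (simp add: D_zero_right assms(2))

lemma D_diff_left:
  assumes "u \<in> sections G" "u' \<in> sections G" "w \<in> sections G"
  shows "D (u - u') w = D u w - D u' w"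
  using D_add_left[OF sections_diff[OF assms(1,2)] assms(2,3)] by simp

text \<open>The arguments for \<open>Ric\<^sup>+\<close> and \<open>Ric\<^sup>-\<close> are the same up to the exchange of \<open>E\<^sub>+\<close> and \<open>E\<^sub>-\<close>. They are given once,
  for an index set \<open>S\<close> that spans one of the two.\<close>

definition pure :: "frame_index set \<Rightarrow> bool" where
  "pure S \<longleftrightarrow> S = plus_index \<or> S = - plus_index"

lemma pure_compl: "pure S \<Longrightarrow> pure (- S)"
  by (auto simp: pure_def)

text \<open>A metric connection that preserves \<open>E\<^sub>-\<close> preserves its orthogonal complement \<open>E\<^sub>+\<close>.\<close>

lemma D_frame_span:
  assumes S: "pure S" and u: "u \<in> sections G" and w: "w \<in> frame_span S"
  shows "D u w \<in> frame_span S"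
proof (cases "S = - plus_index")
  case False
  then have S: "S = plus_index" using S by (auto simp: pure_def)
  have "pairing (D u w) (e A) = 0" if "A \<notin> plus_index" for A
  proof -
    have "e A \<in> frame_span (- plus_index)" using that by (simp add: e_frame_span)
    then have "pairing w (e A) = 0" "pairing w (D u (e A)) = 0"
      using w frame_span_orthogonal D_minus[OF u] by (auto simp: S)
    moreover have "anchor u 0 = 0"
      using u vfield_const[of "anchor u" 0] by (cases u) (simp add: sections_def zero_fun_def)
    ultimately show ?thesis using D_metric[OF u frame_span_sections[OF w] e_sections[of A]] by simp
  qed
  then show ?thesis using D_sections[OF u frame_span_sections[OF w]] by (simp add: S frame_span_def)
qed (use D_minus u w in simp)

definition \<Gamma> :: "frame_index \<Rightarrow> frame_index \<Rightarrow> frame_index \<Rightarrow> 'a \<Rightarrow> real" where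
  "\<Gamma> A A' A'' = pairing (D (e A) (e A')) (e A'')"

lemma \<Gamma>_cinf: "\<Gamma> A A' A'' \<in> cinf G"
  unfolding \<Gamma>_def by (intro pairing_cinf D_sections e_sections)

lemma \<Gamma>_zero: "pure S \<Longrightarrow> A' \<in> S \<Longrightarrow> A'' \<notin> S \<Longrightarrow> \<Gamma> A A' A'' = 0"
  using D_frame_span[OF _ e_sections e_frame_span, of S A' A] by (simp add: \<Gamma>_def frame_span_def)

lemma \<Gamma>_torsion: "\<Gamma> A A' A'' - \<Gamma> A' A A'' - (\<lambda>_. dorfman_const A A' A'') + \<Gamma> A'' A A' = 0"
  using D_torsion[OF e_sections e_sections e_sections, of A A' A'']
  by (simp add: torsion_def pairing_diff_left sections_diff D_sections e_sections dorfman_sections H F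
      dorfman_frame_pairing \<Gamma>_def pairing_commute[of "e A'"])

text \<open>Of the three connection terms in the torsion two vanish because \<open>D\<close> preserves \<open>E\<^sub>+\<close> and \<open>E\<^sub>-\<close>; the third is
  then given by the Dorfman bracket.\<close>

lemma \<Gamma>_mixed:
  assumes S: "pure S" and "u \<notin> S" "x \<in> S" "k \<in> S"
  shows "\<Gamma> u x k = (\<lambda>_. dorfman_const u x k)"
proof -
  have "\<Gamma> x u k = 0" "\<Gamma> k u x = 0" using \<Gamma>_zero[OF pure_compl[OF S]] assms by auto
  with \<Gamma>_torsion[of u x k] show ?thesis by (simp add: fun_eq_iff)
qed

lemma module_trace_frame:
  assumes A: "\<And>w. w \<in> frame_span S \<Longrightarrow> T w \<in> frame_span S"
    and lin: "\<And>f. (\<And>i. i \<in> S \<Longrightarrow> f i \<in> cinf G) \<Longrightarrow>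
      T (\<Sum>i\<in>S. smul_sect (f i) (e i)) = (\<Sum>i\<in>S. smul_sect (f i) (T (e i)))"
  shows "module_trace smul_sect (cinf G) (frame_span S) T = (\<Sum>i\<in>S. (\<lambda>_. \<sigma> i) * pairing (T (e i)) (e i))"
proof (rule module_trace_eq[where A = "\<lambda>i j. (\<lambda>_. \<sigma> i) * pairing (T (e j)) (e i)", OF module_smul_sect
      cinf_zero cinf_one cinf_add cinf_mult frame_span_basis])
  show "T (e j) = (\<Sum>i\<in>S. smul_sect ((\<lambda>_. \<sigma> i) * pairing (T (e j)) (e i)) (e i))" if "j \<in> S" for j
    by (rule frame_span_expand[OF A[OF e_frame_span[OF that]]])
  show "(\<lambda>_. \<sigma> i) * pairing (T (e j)) (e i) \<in> cinf G" if "i \<in> S" "j \<in> S" for i j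
    by (intro cinf_mult cinf_const pairing_cinf e_sections frame_span_sections[OF A[OF e_frame_span[OF that(2)]]])
qed (use A lin in auto)

definition div_const :: "frame_index \<Rightarrow> real" where
  "div_const A = \<delta> (e A) (gone G)"

lemma \<delta>_frame: "\<delta> (e A) = (\<lambda>_. div_const A)"
  using inv e_left_inv[of A] unfolding left_inv_divergence_def div_const_def by fastforce

lemma divergence_frame: "(\<lambda>_. div_const A) = (\<Sum>C\<in>UNIV. (\<lambda>_. \<sigma> C) * \<Gamma> C A C)"
proof -
  have "(\<lambda>_. div_const A) = module_trace smul_sect (cinf G) (frame_span UNIV) (\<lambda>w. D w (e A))"
    using div[OF e_sections[of A]] by (simp add: div_of_def frame_span_UNIV \<delta>_frame)
  also have "\<dots> = (\<Sum>C\<in>UNIV. (\<lambda>_. \<sigma> C) * pairing (D (e C) (e A)) (e C))"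
    by (rule module_trace_frame)
      (simp_all add: frame_span_UNIV D_sections e_sections D_sum_left sections_smul D_smul_left)
  finally show ?thesis by (simp add: \<Gamma>_def)
qed

text \<open>The trace over \<open>E\<close> reduces to the half that contains \<open>e\<^sub>A\<close>, since \<open>D\<close> does not leave it.\<close>

lemma divergence_pure:
  assumes S: "pure S" and A: "A \<in> S"
  shows "(\<lambda>_. div_const A) = (\<Sum>C\<in>S. (\<lambda>_. \<sigma> C) * \<Gamma> C A C)"
  unfolding divergence_frame using \<Gamma>_zero[OF S A] by (intro sum.mono_neutral_right) auto

lemma D_frame_expand: "D (e A) (e A') = (\<Sum>k\<in>UNIV. smul_sect ((\<lambda>_. \<sigma> k) * \<Gamma> A A' k) (e k))"
  unfolding \<Gamma>_def by (rule section_expand[OF D_sections[OF e_sections e_sections]])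

lemma pairing_DD:
  "pairing (D (e i) (D (e u) (e x))) (e j) =
    anchor (e i) (\<Gamma> u x j) + (\<Sum>k\<in>UNIV. (\<lambda>_. \<sigma> k) * \<Gamma> u x k * \<Gamma> i k j)"
proof -
  have cinf: "(\<lambda>_. \<sigma> k) * \<Gamma> u x k \<in> cinf G" for k
    by (intro cinf_mult cinf_const \<Gamma>_cinf)
  have "pairing (D (e i) (D (e u) (e x))) (e j) =
      (\<Sum>k\<in>UNIV. anchor (e i) ((\<lambda>_. \<sigma> k) * \<Gamma> u x k) * pairing (e k) (e j) + (\<lambda>_. \<sigma> k) * \<Gamma> u x k * \<Gamma> i k j)"
    unfolding D_frame_expand[of u x] \<Gamma>_def[of i]
    by (simp add: D_sum_right sections_smul e_sections cinf D_smul_right pairing_sum_left D_sections sections_add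
        pairing_add_left pairing_smul_left vfield_cinf[OF anchor_e])
  also have "\<dots> = (\<Sum>k\<in>UNIV. if k = j then anchor (e i) (\<Gamma> u x j) else 0) +
      (\<Sum>k\<in>UNIV. (\<lambda>_. \<sigma> k) * \<Gamma> u x k * \<Gamma> i k j)"
  proof -
    have "anchor (e i) ((\<lambda>_. \<sigma> k) * \<Gamma> u x k) * pairing (e k) (e j) = (if k = j then anchor (e i) (\<Gamma> u x j) else 0)" for k
      using \<sigma>_square[of k] by (auto simp: vfield_mult[OF anchor_e cinf_const \<Gamma>_cinf] vfield_const[OF anchor_e]
          pairing_frame fun_eq_iff mult.commute mult.left_commute)
    then show ?thesis by (simp add: sum.distrib)
  qed
  finally show ?thesis by simp
qed

lemma pairing_D_dorfman:
  "pairing (D (dorfman G H F (e i) (e u)) (e x)) (e j) = (\<Sum>k\<in>UNIV. (\<lambda>_. \<sigma> k * dorfman_const i u k) * \<Gamma> k x j)"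
proof -
  have "dorfman G H F (e i) (e u) = (\<Sum>k\<in>UNIV. smul_sect (\<lambda>_. \<sigma> k * dorfman_const i u k) (e k))"
    using section_expand[OF dorfman_sections[OF H(1) F(1) e_sections e_sections], of i u]
    by (simp add: dorfman_frame_pairing times_fun_def)
  then show ?thesis
    by (simp add: D_sum_left sections_smul e_sections cinf_const D_smul_left pairing_sum_left D_sections
        pairing_smul_left \<Gamma>_def)
qed

lemma curvature_frame_span:
  assumes S: "pure S" and "w \<in> sections G" "x \<in> frame_span S" "u \<in> sections G"
  shows "curvature G H F D w u x \<in> frame_span S"
  unfolding curvature_def by (intro frame_span_diff D_frame_span[OF S] assms dorfman_sections H(1) F(1))

text \<open>The derivatives of the coefficients that arise from \<open>D\<^sub>u(f D\<^sub>w x)\<close> cancel those from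
  \<open>[f w, u] = f [w, u] - \<pi>(u)(f) w\<close>; the latter formula requires \<open>w\<close> and \<open>u\<close> to be orthogonal.\<close>

lemma curvature_linear:
  assumes u: "u \<notin> S" and x: "x \<in> sections G" and f: "\<And>i. i \<in> S \<Longrightarrow> f i \<in> cinf G"
  shows "curvature G H F D (\<Sum>i\<in>S. smul_sect (f i) (e i)) (e u) x =
    (\<Sum>i\<in>S. smul_sect (f i) (curvature G H F D (e i) (e u) x))"
proof -
  let ?w = "\<Sum>i\<in>S. smul_sect (f i) (e i)" and ?a = "anchor (e u)"
  note sec = sections_smul[OF f e_sections] e_sections D_sections[OF e_sections x]
    dorfman_sections[OF H(1) F(1) e_sections e_sections]
  have a: "?a (f i) \<in> cinf G" if "i \<in> S" for i by (rule vfield_cinf[OF anchor_e f[OF that]])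
  have Dw: "D ?w y = (\<Sum>i\<in>S. smul_sect (f i) (D (e i) y))" if "y \<in> sections G" for y
    using that by (simp add: D_sum_left sec D_smul_left f)
  have 2: "D (e u) (D ?w x) = (\<Sum>i\<in>S. smul_sect (?a (f i)) (D (e i) x) + smul_sect (f i) (D (e u) (D (e i) x)))"
    unfolding Dw[OF x] by (simp add: D_sum_right sec sections_smul f D_smul_right)
  have "dorfman G H F ?w (e u) = (\<Sum>i\<in>S. smul_sect (f i) (dorfman G H F (e i) (e u)) - smul_sect (?a (f i)) (e i))"
  proof -
    have "pairing (e i) (e u) = 0" if "i \<in> S" for i using that u by (auto simp: pairing_frame)
    then show ?thesis by (simp add: dorfman_sum_left[OF H(1) F(1)] sec dorfman_smul_left[OF H(1) F(1)] f)
  qed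
  then have 3: "D (dorfman G H F ?w (e u)) x =
      (\<Sum>i\<in>S. smul_sect (f i) (D (dorfman G H F (e i) (e u)) x) - smul_sect (?a (f i)) (D (e i) x))"
    by (simp add: D_sum_left sections_diff sections_smul sec f a x D_diff_left D_smul_left)
  show ?thesis
    unfolding curvature_def 2 3 Dw[OF D_sections[OF e_sections x]]
    by (simp add: sect.scale_right_diff_distrib sum_subtractf sum.distrib)
qed

text \<open>The three terms of \<open>R(e\<^sub>i, u) x\<close> are expanded and summed over \<open>i\<close>. In the first, \<open>D\<^sub>u x\<close> has constant
  coefficients by \<open>\<Gamma>_mixed\<close>, and the sum is a combination of divergences. The second contributes the
  derivative of the constant divergence of \<open>x\<close> and a double sum over \<open>S\<close>, which cancels the part of
  \<open>D([e\<^sub>i, u]) x\<close> where \<open>[e\<^sub>i, u]\<close> is projected to the half of \<open>x\<close>. The other part of the third term is again of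
  mixed type and gives the quadratic expression.\<close>

lemma ricci_frame:
  assumes S: "pure S" and u: "u \<notin> S" and x: "x \<in> S"
  shows "module_trace smul_sect (cinf G) (frame_span S) (\<lambda>w. curvature G H F D w (e u) (e x)) p =
    (\<Sum>k\<in>S. \<sigma> k * dorfman_const u x k * div_const k) - (\<Sum>i\<in>S. \<Sum>j\<in>- S. \<sigma> i * \<sigma> j * dorfman_const i u j * dorfman_const j x i)"
proof -
  let ?R = "\<lambda>w. curvature G H F D w (e u) (e x)"
  let ?a = "anchor (e u)"
  have dS: "div_const k = (\<Sum>i\<in>S. \<sigma> i * \<Gamma> i k i p)" if "k \<in> S" for k
    using fun_cong[OF divergence_pure[OF S that], of p] by (simp add: sum_fun_apply)
  have div_term: "(\<Sum>i\<in>S. \<sigma> i * ?a (\<Gamma> i x i) p) = 0"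
  proof -
    have "(\<Sum>i\<in>S. (\<lambda>_. \<sigma> i) * ?a (\<Gamma> i x i)) = ?a (\<Sum>i\<in>S. (\<lambda>_. \<sigma> i) * \<Gamma> i x i)"
      by (simp add: vfield_sum[OF anchor_e] cinf_mult cinf_const \<Gamma>_cinf vfield_mult[OF anchor_e] vfield_const[OF anchor_e])
    also have "\<dots> = 0" unfolding divergence_pure[OF S x, symmetric] by (rule vfield_const[OF anchor_e])
    finally have "(\<Sum>i\<in>S. (\<lambda>_. \<sigma> i) * ?a (\<Gamma> i x i)) p = 0 p" by simp
    then show ?thesis by (simp add: sum_fun_apply)
  qed
  have summand: "pairing (?R (e i)) (e i) p =
      (\<Sum>k\<in>S. \<sigma> k * dorfman_const u x k * \<Gamma> i k i p) - ?a (\<Gamma> i x i) p - (\<Sum>k\<in>S. \<sigma> k * \<Gamma> i x k p * dorfman_const u k i)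
      - (\<Sum>k\<in>S. \<sigma> k * dorfman_const i u k * \<Gamma> k x i p) - (\<Sum>j\<in>- S. \<sigma> j * dorfman_const i u j * dorfman_const j x i)" if i: "i \<in> S" for i
  proof -
    have restrict: "(\<Sum>k\<in>UNIV. f k) = (\<Sum>k\<in>S. f k)" if "\<And>k. k \<notin> S \<Longrightarrow> f k = 0" for f :: "frame_index \<Rightarrow> real"
      using that by (intro sum.mono_neutral_right) auto
    have "anchor (e i) (\<Gamma> u x i) = 0"
      unfolding \<Gamma>_mixed[OF S u x i] by (rule vfield_const[OF anchor_e])
    then have "pairing (D (e i) (D (e u) (e x))) (e i) p = (\<Sum>k\<in>UNIV. \<sigma> k * \<Gamma> u x k p * \<Gamma> i k i p)"
      by (simp add: pairing_DD sum_fun_apply)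
    also have "\<dots> = (\<Sum>k\<in>S. \<sigma> k * \<Gamma> u x k p * \<Gamma> i k i p)"
      by (rule restrict) (simp add: \<Gamma>_zero[OF S x])
    also have "\<dots> = (\<Sum>k\<in>S. \<sigma> k * dorfman_const u x k * \<Gamma> i k i p)"
      by (rule sum.cong) (simp_all add: \<Gamma>_mixed[OF S u x])
    finally have 1: "pairing (D (e i) (D (e u) (e x))) (e i) p = (\<Sum>k\<in>S. \<sigma> k * dorfman_const u x k * \<Gamma> i k i p)" .
    have "(\<Sum>k\<in>UNIV. \<sigma> k * \<Gamma> i x k p * \<Gamma> u k i p) = (\<Sum>k\<in>S. \<sigma> k * \<Gamma> i x k p * \<Gamma> u k i p)"
      by (rule restrict) (simp add: \<Gamma>_zero[OF S x])
    also have "\<dots> = (\<Sum>k\<in>S. \<sigma> k * \<Gamma> i x k p * dorfman_const u k i)"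
      by (rule sum.cong) (simp_all add: \<Gamma>_mixed[OF S u _ i])
    finally have 2: "pairing (D (e u) (D (e i) (e x))) (e i) p =
        ?a (\<Gamma> i x i) p + (\<Sum>k\<in>S. \<sigma> k * \<Gamma> i x k p * dorfman_const u k i)"
      by (simp add: pairing_DD sum_fun_apply)
    have "pairing (D (dorfman G H F (e i) (e u)) (e x)) (e i) p = (\<Sum>k\<in>UNIV. \<sigma> k * dorfman_const i u k * \<Gamma> k x i p)"
      by (simp add: pairing_D_dorfman sum_fun_apply)
    also have "\<dots> = (\<Sum>k\<in>S. \<sigma> k * dorfman_const i u k * \<Gamma> k x i p) + (\<Sum>j\<in>- S. \<sigma> j * dorfman_const i u j * \<Gamma> j x i p)"
      by (subst sum.union_disjoint[symmetric]) auto
    finally have 3: "pairing (D (dorfman G H F (e i) (e u)) (e x)) (e i) p =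
        (\<Sum>k\<in>S. \<sigma> k * dorfman_const i u k * \<Gamma> k x i p) + (\<Sum>j\<in>- S. \<sigma> j * dorfman_const i u j * dorfman_const j x i)"
      by (simp add: \<Gamma>_mixed[OF S _ x i])
    have "pairing (?R (e i)) (e i) = pairing (D (e i) (D (e u) (e x))) (e i) - pairing (D (e u) (D (e i) (e x))) (e i)
        - pairing (D (dorfman G H F (e i) (e u)) (e x)) (e i)"
      unfolding curvature_def
      by (simp add: pairing_diff_left sections_diff D_sections e_sections dorfman_sections H F)
    then show ?thesis by (simp add: 1 2 3)
  qed
  have cancel: "(\<Sum>i\<in>S. \<Sum>k\<in>S. \<sigma> i * (\<sigma> k * \<Gamma> i x k p * dorfman_const u k i)) + (\<Sum>i\<in>S. \<Sum>k\<in>S. \<sigma> i * (\<sigma> k * dorfman_const i u k * \<Gamma> k x i p)) = 0"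
  proof -
    have "(\<Sum>i\<in>S. \<Sum>k\<in>S. \<sigma> i * (\<sigma> k * dorfman_const i u k * \<Gamma> k x i p)) = (\<Sum>k\<in>S. \<Sum>i\<in>S. \<sigma> i * (\<sigma> k * dorfman_const i u k * \<Gamma> k x i p))"
      by (rule sum.swap)
    also have "\<dots> = (\<Sum>i\<in>S. \<Sum>k\<in>S. - (\<sigma> i * (\<sigma> k * \<Gamma> i x k p * dorfman_const u k i)))"
      by (intro sum.cong refl) (subst dorfman_const_anti(1), simp)
    finally show ?thesis by (simp add: sum_negf)
  qed
  have first: "(\<Sum>i\<in>S. \<Sum>k\<in>S. \<sigma> i * (\<sigma> k * dorfman_const u x k * \<Gamma> i k i p)) = (\<Sum>k\<in>S. \<sigma> k * dorfman_const u x k * div_const k)"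
    by (subst sum.swap) (simp add: dS sum_distrib_left mult.left_commute)
  have "module_trace smul_sect (cinf G) (frame_span S) ?R = (\<Sum>i\<in>S. (\<lambda>_. \<sigma> i) * pairing (?R (e i)) (e i))"
    by (rule module_trace_frame)
      (simp_all add: curvature_frame_span[OF S] frame_span_sections e_sections e_frame_span x curvature_linear[OF u])
  then have "module_trace smul_sect (cinf G) (frame_span S) ?R p = (\<Sum>i\<in>S. \<sigma> i * pairing (?R (e i)) (e i) p)"
    by (simp add: sum_fun_apply)
  also have "\<dots> = (\<Sum>i\<in>S. \<Sum>k\<in>S. \<sigma> i * (\<sigma> k * dorfman_const u x k * \<Gamma> i k i p)) - (\<Sum>i\<in>S. \<sigma> i * ?a (\<Gamma> i x i) p)
      - ((\<Sum>i\<in>S. \<Sum>k\<in>S. \<sigma> i * (\<sigma> k * \<Gamma> i x k p * dorfman_const u k i)) + (\<Sum>i\<in>S. \<Sum>k\<in>S. \<sigma> i * (\<sigma> k * dorfman_const i u k * \<Gamma> k x i p)))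
      - (\<Sum>i\<in>S. \<Sum>j\<in>- S. \<sigma> i * \<sigma> j * dorfman_const i u j * dorfman_const j x i)"
    by (simp add: summand right_diff_distrib sum_subtractf sum_distrib_left mult.assoc)
  finally show ?thesis unfolding cancel div_term first by simp
qed

end


section \<open>The Einstein equations of the second class\<close>

text \<open>The variables stand for the following: \<open>E = \<epsilon>\<^sub>1\<close>; \<open>\<phi>a\<close>, \<open>\<phi>b\<close>, \<open>\<phi>c\<close> are \<open>F\<^sub>2\<^sub>3\<close>, \<open>F\<^sub>3\<^sub>1\<close>, \<open>F\<^sub>1\<^sub>2\<close>; \<open>ma\<close>, \<open>mb\<close>, \<open>mc\<close> are the
  divergences of \<open>v\<^sub>a - g(v\<^sub>a)\<close>; \<open>dz\<close> and \<open>da\<close> those of \<open>1\<close> and \<open>v\<^sub>1 + g(v\<^sub>1)\<close>. With \<open>\<kappa> = H(v\<^sub>1,v\<^sub>2,v\<^sub>3)\<close> the numbers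
  \<open>2 r\<close>, \<open>2 s\<close>, \<open>2 x\<close>, \<open>2 y\<close> are \<open>\<gamma> - \<kappa>\<close>, \<open>- \<gamma> - \<kappa>\<close>, \<open>2 \<alpha> - \<gamma> - \<kappa>\<close>, \<open>\<gamma> - 2 \<alpha> - \<kappa>\<close>; they are the constants
  \<open>\<langle>[e\<^sub>A, e\<^sub>A'], e\<^sub>A''\<rangle>\<close> with three different basis vectors that are not all of the same kind. The hypotheses \<open>e\<^sub>a\<^sub>b\<close>
  and \<open>n1\<close> come from \<open>Ric\<^sup>-\<close>, the hypotheses \<open>p\<^sub>a\<^sub>b\<close> from \<open>Ric\<^sup>+\<close>, and \<open>K\<close> is the entry \<open>(2,3)\<close> of the symmetric
  matrix \<open>Q\<close>.\<close>

lemma second_class_equations: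
  fixes E \<beta> r s x y \<phi>a \<phi>b \<phi>c ma mb mc dz da K W :: real
  assumes E: "E = 1 \<or> E = - 1" and \<beta>: "\<beta> \<noteq> 0"
    and e11: "E * (\<phi>c\<^sup>2 - \<phi>b\<^sup>2) = 2 * r * s - 2 * \<beta>\<^sup>2"
    and W: "W = y * r + s * x"
    and e22: "E * (\<phi>c\<^sup>2 - \<phi>a\<^sup>2) - W = E * \<beta> * ma"
    and e33: "E * (\<phi>b\<^sup>2 + \<phi>a\<^sup>2) + W = E * \<beta> * ma"
    and e23: "K = E * s * ma" and e32: "K = - (E * s * ma)"
    and e12: "s * mc + \<beta> * mb = - (\<phi>a * \<phi>b)" and e21: "y * mc = \<phi>a * \<phi>b"
    and e13: "s * mb - \<beta> * mc = \<phi>a * \<phi>c" and e31: "- (y * mb) = \<phi>a * \<phi>c"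
    and n1: "2 * s * \<phi>a = E * (\<phi>c * mb + \<phi>b * mc)"
    and p22: "E * (\<phi>c\<^sup>2 - \<phi>a\<^sup>2) - W = E * \<beta> * da"
    and p23: "E * r * da + \<phi>a * dz = K"
  shows "\<phi>a = 0 \<and> \<phi>b = 0 \<and> \<phi>c = 0"
proof (cases "ma = 0")
  case True
  \<comment> \<open>The two diagonal equations have opposite terms \<open>W\<close> and \<open>\<phi>a\<^sup>2\<close>; their sum is definite.\<close>
  have "E * (\<phi>c\<^sup>2 + \<phi>b\<^sup>2) = 0" using e22 e33 True by (simp add: algebra_simps)
  then have 0: "\<phi>b = 0" "\<phi>c = 0" using E sum_power2_eq_zero_iff by auto
  have "\<phi>a = 0"
  proof (rule ccontr)
    assume "\<phi>a \<noteq> 0"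
    then have "s = 0" using n1 0 by simp
    then show False using e11 0 \<beta> by simp
  qed
  with 0 show ?thesis by simp
next
  case False
  have E0: "E \<noteq> 0" using E by auto
  have s: "s = 0" using e23 e32 E0 False by simp
  have da: "da = ma" using e22 p22 E0 \<beta> by simp
  have "\<phi>a = 0"
  proof (rule ccontr)
    assume 1: "\<phi>a \<noteq> 0"
    have "\<phi>a * (\<beta> * \<phi>b) = y * (\<beta> * mc)" using e21 by (simp add: mult.left_commute)
    also have "\<beta> * mc = - (\<phi>a * \<phi>c)" using e13 s by simp
    also have "y * - (\<phi>a * \<phi>c) = \<phi>a * - (y * \<phi>c)" by simp
    finally have a: "\<beta> * \<phi>b = - (y * \<phi>c)" by (simp only: mult_left_cancel[OF 1])
    have "\<phi>a * (\<beta> * \<phi>c) = \<beta> * (\<phi>a * \<phi>c)" by simp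
    also have "\<dots> = - (y * (\<beta> * mb))" unfolding e31[symmetric] by simp
    also have "\<beta> * mb = - (\<phi>a * \<phi>b)" using e12 s by simp
    also have "- (y * - (\<phi>a * \<phi>b)) = \<phi>a * (y * \<phi>b)" by simp
    finally have b: "\<beta> * \<phi>c = y * \<phi>b" by (simp only: mult_left_cancel[OF 1])
    \<comment> \<open>The vector \<open>(\<phi>b, \<phi>c)\<close> is in the kernel of a matrix with determinant \<open>\<beta>\<^sup>2 + y\<^sup>2\<close>.\<close>
    have "(\<beta>\<^sup>2 + y\<^sup>2) * \<phi>b = \<beta> * (\<beta> * \<phi>b) + y * (y * \<phi>b)" by (simp add: power2_eq_square algebra_simps)
    also have "\<dots> = 0" by (simp add: a b[symmetric])
    finally have "\<phi>b = 0" using \<beta> by (simp add: sum_power2_eq_zero_iff)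
    moreover from this b \<beta> have "\<phi>c = 0" by simp
    ultimately show False using e11 s \<beta> by simp
  qed
  moreover have "r = 0" using p23 e23 s da \<open>\<phi>a = 0\<close> E0 False by simp
  ultimately have "E * \<phi>c\<^sup>2 = E * \<phi>b\<^sup>2" using e22 e33 W s by auto
  then have False using e11 \<open>r = 0\<close> \<beta> E0 by auto
  then show ?thesis ..
qed

lemma sum_plus_index: "(\<Sum>A\<in>plus_index. f A) = f None + f (Some (1, True)) + f (Some (2, True)) + f (Some (3, True))"
  for f :: "frame_index \<Rightarrow> real"
proof -
  have "(\<Sum>A\<in>plus_index. f A) = f None + (\<Sum>a\<in>UNIV. f (Some (a, True)))"
    unfolding plus_index_def by (subst sum.insert) (auto simp: sum.reindex inj_on_def)
  then show ?thesis by (simp add: sum_3)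
qed

lemma sum_minus_index: "(\<Sum>A\<in>- plus_index. f A) = f (Some (1, False)) + f (Some (2, False)) + f (Some (3, False))"
  for f :: "frame_index \<Rightarrow> real"
proof -
  have "- plus_index = range (\<lambda>a. Some (a, False))"
  proof (intro equalityI subsetI)
    fix A :: frame_index assume "A \<in> - plus_index" then show "A \<in> range (\<lambda>a. Some (a, False))"
      by (cases A rule: frame_index_cases) (auto simp: plus_index_def)
  qed (auto simp: plus_index_def)
  then show ?thesis by (simp add: sum.reindex inj_on_def sum_3)
qed

context einstein_connection
begin

lemma einstein_equations:
  assumes plus: "\<And>u x. u \<in> E_minus G g \<Longrightarrow> x \<in> E_plus G g \<Longrightarrow> ric_plus G H F g D u x = 0"
    and minus: "\<And>u x. u \<in> E_plus G g \<Longrightarrow> x \<in> E_minus G g \<Longrightarrow> ric_minus G H F g D u x = 0"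
    and S: "pure S" and u: "u \<notin> S" and x: "x \<in> S"
  shows "(\<Sum>k\<in>S. \<sigma> k * dorfman_const u x k * div_const k) = (\<Sum>i\<in>S. \<Sum>j\<in>- S. \<sigma> i * \<sigma> j * dorfman_const i u j * dorfman_const j x i)"
proof -
  have "module_trace smul_sect (cinf G) (frame_span S) (\<lambda>w. curvature G H F D w (e u) (e x)) = 0"
  proof (cases "S = plus_index")
    case True
    with plus[of "e u" "e x"] u x show ?thesis by (simp add: ric_plus_def E_plus_eq E_minus_eq e_frame_span)
  next
    case False
    with S have "S = - plus_index" by (simp add: pure_def)
    with minus[of "e u" "e x"] u x show ?thesis by (simp add: ric_minus_def E_plus_eq E_minus_eq e_frame_span)
  qed
  with ricci_frame[OF S u x, of undefined] show ?thesis by simp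
qed

text \<open>The components of the bracket are those of \<open>[v\<^sub>1,v\<^sub>2] = \<epsilon>\<^sub>3 L(v\<^sub>3)\<close> and its cyclic permutations for
  \<open>L = L2 \<alpha> \<beta> \<gamma>\<close>.\<close>

lemma second_class_F_zero:
  assumes plus: "\<And>u x. u \<in> E_minus G g \<Longrightarrow> x \<in> E_plus G g \<Longrightarrow> ric_plus G H F g D u x = 0"
    and minus: "\<And>u x. u \<in> E_plus G g \<Longrightarrow> x \<in> E_minus G g \<Longrightarrow> ric_minus G H F g D u x = 0"
    and eps2: "\<epsilon> 2 = \<epsilon> 1" and eps3: "\<epsilon> 3 = - \<epsilon> 1" and \<beta>: "\<beta> \<noteq> 0"
    and c12: "bracket_const 1 2 1 = 0" "bracket_const 1 2 2 = \<beta>" "bracket_const 1 2 3 = \<alpha>"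
    and c23: "bracket_const 2 3 1 = \<gamma>" "bracket_const 2 3 2 = 0" "bracket_const 2 3 3 = 0"
    and c31: "bracket_const 3 1 1 = 0" "bracket_const 3 1 2 = \<alpha>" "bracket_const 3 1 3 = - \<beta>"
  shows "F_const a b = 0"
proof -
  let ?E = "\<epsilon> 1" and ?H_const = "H_const 1 2 3"
  have c0: "bracket_const a a b = 0" for a b using bracket_const_anti[of a a b] by simp
  have c21: "bracket_const 2 1 1 = 0" "bracket_const 2 1 2 = - \<beta>" "bracket_const 2 1 3 = - \<alpha>"
    and c32: "bracket_const 3 2 1 = - \<gamma>" "bracket_const 3 2 2 = 0" "bracket_const 3 2 3 = 0"
    and c13: "bracket_const 1 3 1 = 0" "bracket_const 1 3 2 = - \<alpha>" "bracket_const 1 3 3 = \<beta>"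
    using bracket_const_anti[of 2 1] bracket_const_anti[of 3 2] bracket_const_anti[of 1 3] c12 c23 c31 by simp_all
  have h0: "H_const a a b = 0" "H_const b a a = 0" "H_const a b a = 0" for a b
    using H_const_anti(1)[of a a b] H_const_anti(2)[of b a a] H_const_anti(1)[of a b a] H_const_anti(2)[of b a a] by simp_all
  have h1: "H_const 1 3 2 = - ?H_const" "H_const 2 1 3 = - ?H_const" "H_const 2 3 1 = ?H_const" "H_const 3 1 2 = ?H_const" "H_const 3 2 1 = - ?H_const"
    using H_const_anti(2)[of 1 3 2] H_const_anti(1)[of 2 1 3] H_const_anti(2)[of 2 3 1] H_const_anti(1)[of 3 1 2] H_const_anti(2)[of 3 2 1] by simp_all
  have F0: "F_const a a = 0" for a using F_const_anti[of a a] by simp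
  have F1: "F_const 2 1 = - F_const 1 2" "F_const 3 2 = - F_const 2 3" "F_const 1 3 = - F_const 3 1"
    by (rule F_const_anti)+
  note val = c0 c12 c21 c23 c32 c31 c13 h0 h1 F0 F1 eps2 eps3 sum_plus_index sum_minus_index side_def
  note eqp = einstein_equations[OF plus minus, of plus_index]
  note eqm = einstein_equations[OF plus minus, of "- plus_index"]
  have pure: "pure plus_index" "pure (- plus_index)" by (simp_all add: pure_def)
  have frame_index: "None \<in> plus_index" "Some (a, True) \<in> plus_index" "Some (a, False) \<notin> plus_index" for a
    by (auto simp: plus_index_def)
  let ?r = "(\<gamma> - ?H_const) / 2" and ?s = "- (\<gamma> + ?H_const) / 2" and ?y = "- (2 * \<alpha> - \<gamma> + ?H_const) / 2" and ?x = "(2 * \<alpha> - \<gamma> - ?H_const) / 2"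
  let ?K = "- ?E * F_const 1 2 * F_const 3 1 - \<beta> * (?x - ?y)"
  let ?m = "\<lambda>a. div_const (Some (a, False))"
  have E2: "?E * ?E = 1" "?E * (?E * z) = z" for z using eps_square[of 1] by (simp_all add: mult.assoc[symmetric])
  have "F_const 2 3 = 0 \<and> F_const 3 1 = 0 \<and> F_const 1 2 = 0"
  proof (rule second_class_equations[where E = ?E and \<beta> = \<beta> and r = ?r and s = ?s and x = ?x and y = ?y and K = ?K
        and W = "?y * ?r + ?s * ?x" and ma = "?m 1" and mb = "?m 2" and mc = "?m 3"
        and dz = "div_const None" and da = "div_const (Some (1, True))"])
    \<comment> \<open>For each of the two signs \<open>\<epsilon>\<^sub>1\<close> the sums over the frame become polynomials in the constants.\<close>
    show "?E * ((F_const 1 2)\<^sup>2 - (F_const 3 1)\<^sup>2) = 2 * ?r * ?s - 2 * \<beta>\<^sup>2"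
      using eqm[of "Some (1, True)" "Some (1, False)"] eps[of 1]
      by (elim disjE; simp add: val pure frame_index power2_eq_square field_simps)
    show "?E * ((F_const 1 2)\<^sup>2 - (F_const 2 3)\<^sup>2) - (?y * ?r + ?s * ?x) = ?E * \<beta> * ?m 1"
      using eqm[of "Some (2, True)" "Some (2, False)"] eps[of 1]
      by (elim disjE; simp add: val pure frame_index power2_eq_square field_simps)
    show "?E * ((F_const 3 1)\<^sup>2 + (F_const 2 3)\<^sup>2) + (?y * ?r + ?s * ?x) = ?E * \<beta> * ?m 1"
      using eqm[of "Some (3, True)" "Some (3, False)"] eps[of 1]
      by (elim disjE; simp add: val pure frame_index power2_eq_square field_simps)
    show "?K = ?E * ?s * ?m 1"
      using eqm[of "Some (3, True)" "Some (2, False)"] eps[of 1]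
      by (elim disjE; simp add: val pure frame_index power2_eq_square field_simps)
    show "?K = - (?E * ?s * ?m 1)"
      using eqm[of "Some (2, True)" "Some (3, False)"] eps[of 1]
      by (elim disjE; simp add: val pure frame_index power2_eq_square field_simps)
    show "?s * ?m 3 + \<beta> * ?m 2 = - (F_const 2 3 * F_const 3 1)"
      using eqm[of "Some (2, True)" "Some (1, False)"] eps[of 1]
      by (elim disjE; simp add: val pure frame_index power2_eq_square field_simps)
    show "?y * ?m 3 = F_const 2 3 * F_const 3 1"
      using eqm[of "Some (1, True)" "Some (2, False)"] eps[of 1]
      by (elim disjE; simp add: val pure frame_index power2_eq_square field_simps)
    show "?s * ?m 2 - \<beta> * ?m 3 = F_const 2 3 * F_const 1 2"
      using eqm[of "Some (3, True)" "Some (1, False)"] eps[of 1]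
      by (elim disjE; simp add: val pure frame_index power2_eq_square field_simps)
    show "- (?y * ?m 2) = F_const 2 3 * F_const 1 2"
      using eqm[of "Some (1, True)" "Some (3, False)"] eps[of 1]
      by (elim disjE; simp add: val pure frame_index power2_eq_square field_simps)
    show "2 * ?s * F_const 2 3 = ?E * (F_const 1 2 * ?m 2 + F_const 3 1 * ?m 3)"
      using eqm[of "None" "Some (1, False)"] eps[of 1]
      by (elim disjE; simp add: val pure frame_index power2_eq_square field_simps)
    show "?E * ((F_const 1 2)\<^sup>2 - (F_const 2 3)\<^sup>2) - (?y * ?r + ?s * ?x) = ?E * \<beta> * div_const (Some (1, True))"
      using eqp[of "Some (2, False)" "Some (2, True)"] eps[of 1]
      by (elim disjE; simp add: val pure frame_index power2_eq_square field_simps)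
    show "?E * ?r * div_const (Some (1, True)) + F_const 2 3 * div_const None = ?K"
      using eqp[of "Some (2, False)" "Some (3, True)"] eps[of 1]
      by (elim disjE; simp add: val pure frame_index power2_eq_square field_simps)
  qed (use eps \<beta> in auto)
  then show ?thesis using exhaust_3[of a] exhaust_3[of b] by (auto simp: F0 F1)
qed

end

context einstein_frame
begin

lemma bracket_const_eq:
  assumes "lie_bracket G (v a) (v b) = rscl t (\<Sum>k\<in>UNIV. rscl (M k) (v k))"
  shows "bracket_const a b d = t * M d * \<epsilon> d"
proof -
  let ?X = "\<Sum>k\<in>UNIV. smul (\<lambda>_. M k) (v k)"
  have X: "?X \<in> vfields G" by (intro vfields_sum vfields_smul cinf_const v_vfield)
  have "g (v d) (lie_bracket G (v a) (v b)) = (\<lambda>_. t) * (\<Sum>k\<in>UNIV. (\<lambda>_. M k) * g (v d) (v k))"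
    unfolding assms rscl_def
    by (simp add: cinf_linear_smul[OF g_linear[OF v_vfield] cinf_const X] cinf_linear_sum[OF g_linear[OF v_vfield]]
        cinf_linear_smul[OF g_linear[OF v_vfield]] vfields_smul cinf_const v_vfield)
  then have "bracket_const a b d = t * (\<Sum>k\<in>UNIV. if d = k then M k * \<epsilon> d else 0)"
    unfolding g_bracket by (simp add: fun_eq_iff sum_fun_apply orthonormal if_distrib[of "\<lambda>x. _ * x"] cong: if_cong)
  then show ?thesis by simp
qed

lemma F_zero:
  assumes "\<And>a b. F_const a b = 0" and X: "X \<in> vfields G" and Y: "Y \<in> vfields G"
  shows "F X Y = 0"
proof -
  have zero: "\<xi> Z = 0" if "cinf_linear G \<xi>" "\<And>a. \<xi> (v a) = 0" "Z \<in> vfields G" for \<xi> Z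
  proof -
    have "form1_of G \<xi> = 0"
      by (rule forms1_eqI[OF form1_of_forms1[OF that(1)] forms1_zero]) (simp add: form1_of_def v_vfield that(2))
    from fun_cong[OF this, of Z] show ?thesis by (simp add: form1_of_def that(3))
  qed
  have 1: "F (v a) (v b) = 0" for a b by (simp add: F_frame assms(1) zero_fun_def)
  have "F (v a) Y = 0" for a by (rule zero[OF forms2_linear[OF F(1) v_vfield] 1 Y])
  then have 2: "F Y (v a) = 0" for a using forms2_anti[OF F(1) Y v_vfield[of a]] by simp
  have "F Y X = 0" by (rule zero[OF forms2_linear[OF F(1) Y] 2 X])
  then show ?thesis using forms2_anti[OF F(1) X Y] by simp
qed

end

section \<open>Orientations\<close>

lemma rscl_apply: "rscl k X f p = k * X f p"
  by (simp add: rscl_def smul_apply)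

context smooth_manifold
begin

lemma lie_alg_rscl: "X \<in> lie_alg G \<Longrightarrow> rscl k X \<in> lie_alg G"
  unfolding lie_alg_def rscl_def
  by (auto simp: vfields_smul cinf_const push_def fun_eq_iff smul_apply)

lemma lie_alg_add: "X \<in> lie_alg G \<Longrightarrow> Y \<in> lie_alg G \<Longrightarrow> X + Y \<in> lie_alg G"
  unfolding lie_alg_def by (auto simp: vfields_add push_def fun_eq_iff)

text \<open>A determinant form that vanishes on a basis vanishes identically.\<close>

lemma orientation_form_basis:
  fixes v :: "3 \<Rightarrow> 'a vfield"
  assumes \<omega>: "orientation_form G \<omega>" and v: "is_basis rscl UNIV (lie_alg G) UNIV v"
  shows "\<omega> (v 1) (v 2) (v 3) \<noteq> 0"
proof
  assume 0: "\<omega> (v 1) (v 2) (v 3) = 0"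
  have va: "v a \<in> lie_alg G" for a using v by (simp add: is_basis_def)
  have add: "\<omega> x y (z + z') = \<omega> x y z + \<omega> x y z'"
    if "x \<in> lie_alg G" "y \<in> lie_alg G" "z \<in> lie_alg G" "z' \<in> lie_alg G" for x y z z'
    using \<omega> that unfolding orientation_form_def by blast
  have scale: "\<omega> x y (rscl k z) = k * \<omega> x y z"
    and anti: "\<omega> x y z = - \<omega> y x z" "\<omega> x y z = - \<omega> x z y"
    if "x \<in> lie_alg G" "y \<in> lie_alg G" "z \<in> lie_alg G" for x y z k
    using \<omega> that unfolding orientation_form_def by blast+
  have expand: "\<omega> x y z = 0" if xyz: "x \<in> lie_alg G" "y \<in> lie_alg G" "z \<in> lie_alg G" "\<And>a. \<omega> x y (v a) = 0" for x y z
  proof -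
    obtain k where "z = (\<Sum>a\<in>UNIV. rscl (k a) (v a))" using is_basis_coeffs[OF v xyz(3)] by blast
    then have "z = rscl (k 1) (v 1) + rscl (k 2) (v 2) + rscl (k 3) (v 3)" by (simp only: sum_3)
    then show ?thesis
      using xyz(4) by (simp add: add[OF xyz(1,2)] scale[OF xyz(1,2)] lie_alg_add lie_alg_rscl va)
  qed
  have "\<omega> (v a) (v b) (v d) = 0" for a b d
  proof -
    have eq: "\<omega> (v a) (v a) (v b) = 0" "\<omega> (v b) (v a) (v a) = 0" for a b
      using anti(1)[OF va va va, of a a b] anti(2)[OF va va va, of b a a] by simp_all
    have "\<omega> (v a) (v b) (v a) = 0" for a b
      using anti(2)[OF va va va, of a b a] eq(1) by simp
    moreover have "\<omega> (v 2) (v 1) (v 3) = 0" "\<omega> (v 1) (v 3) (v 2) = 0"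
      using anti(1)[OF va va va, of 2 1 3] anti(2)[OF va va va, of 1 3 2] 0 by simp_all
    moreover from this have "\<omega> (v 2) (v 3) (v 1) = 0" "\<omega> (v 3) (v 1) (v 2) = 0"
      using anti(2)[OF va va va, of 2 3 1] anti(1)[OF va va va, of 3 1 2] by simp_all
    moreover from this have "\<omega> (v 3) (v 2) (v 1) = 0"
      using anti(2)[OF va va va, of 3 2 1] by simp
    ultimately show ?thesis using exhaust_3[of a] exhaust_3[of b] exhaust_3[of d] eq 0 by auto
  qed
  then have 1: "\<omega> (v a) (v b) z = 0" if "z \<in> lie_alg G" for a b z by (rule expand[OF va va that])
  have 2: "\<omega> (v a) y (v b) = 0" if "y \<in> lie_alg G" for a b y
    using anti(2)[OF va that va] 1[OF that] by simp
  have 3: "\<omega> (v a) y z = 0" if "y \<in> lie_alg G" "z \<in> lie_alg G" for a y z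
    by (rule expand[OF va that 2[OF that(1)]])
  have 4: "\<omega> x y (v a) = 0" if "x \<in> lie_alg G" "y \<in> lie_alg G" for a x y
    using anti(2)[OF that va] anti(1)[OF that(1) va that(2)] 3[OF that] by simp
  have "\<omega> x y z = 0" if "x \<in> lie_alg G" "y \<in> lie_alg G" "z \<in> lie_alg G" for x y z
    by (rule expand[OF that 4[OF that(1,2)]])
  then show False using \<omega> unfolding orientation_form_def by blast
qed

end

lemma orthonormal_basis_flip:
  assumes "smooth_manifold G" and metric: "left_inv_metric G g" and v: "orthonormal_basis G g v \<epsilon>"
  shows "orthonormal_basis G g (\<lambda>a. rscl (- 1) (v a)) \<epsilon>"
proof -
  interpret smooth_manifold G by fact
  have basis: "is_basis rscl UNIV (lie_alg G) UNIV v" using v by (simp add: orthonormal_basis_def)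
  have va: "v a \<in> lie_alg G" for a using basis by (simp add: is_basis_def)
  have vv: "v a \<in> vfields G" for a using va by (simp add: lie_alg_def)
  have flip: "rscl k (rscl (- 1) X) = rscl (- k) X" for k and X :: "'a vfield"
    by (intro ext) (simp add: rscl_apply)
  have "is_basis rscl UNIV (lie_alg G) UNIV (\<lambda>a. rscl (- 1) (v a))"
    unfolding is_basis_def
  proof (intro conjI ballI)
    fix x assume x: "x \<in> lie_alg G"
    then have "\<exists>!k. k \<in> UNIV \<rightarrow>\<^sub>E UNIV \<and> x = (\<Sum>i\<in>UNIV. rscl (k i) (v i))"
      using basis by (simp add: is_basis_def)
    then obtain k where k: "x = (\<Sum>i\<in>UNIV. rscl (k i) (v i))"
      and uniq: "\<And>k'. x = (\<Sum>i\<in>UNIV. rscl (k' i) (v i)) \<Longrightarrow> k' = k" by auto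
    show "\<exists>!k. k \<in> UNIV \<rightarrow>\<^sub>E UNIV \<and> x = (\<Sum>i\<in>UNIV. rscl (k i) (rscl (- 1) (v i)))"
    proof (rule ex1I[of _ "\<lambda>i. - k i"])
      fix k' assume k': "k' \<in> UNIV \<rightarrow>\<^sub>E UNIV \<and> x = (\<Sum>i\<in>UNIV. rscl (k' i) (rscl (- 1) (v i)))"
      have "(\<lambda>i. - k' i) = k" by (rule uniq) (use k' in \<open>simp add: flip\<close>)
      then show "k' = (\<lambda>i. - k i)" by auto
    qed (simp add: flip k)
  qed (simp_all add: lie_alg_rscl va)
  moreover have "g (rscl (- 1) (v a)) (rscl (- 1) (v b)) = g (v a) (v b)" for a b
  proof -
    have lin: "cinf_linear G (g X)" if "X \<in> vfields G" for X
      using metric that unfolding left_inv_metric_def by blast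
    have sym: "g X Y = g Y X" if "X \<in> vfields G" "Y \<in> vfields G" for X Y
      using metric that unfolding left_inv_metric_def by blast
    have w: "rscl (- 1) (v a) \<in> vfields G" for a using lie_alg_rscl[OF va] by (simp add: lie_alg_def)
    have "g (rscl (- 1) (v a)) (rscl (- 1) (v b)) = (\<lambda>_. - 1) * g (rscl (- 1) (v a)) (v b)"
      using cinf_linear_smul[OF lin[OF w] cinf_const vv] by (simp add: rscl_def)
    also have "g (rscl (- 1) (v a)) (v b) = (\<lambda>_. - 1) * g (v b) (v a)"
      unfolding sym[OF w vv] using cinf_linear_smul[OF lin[OF vv] cinf_const vv] by (simp add: rscl_def)
    finally show ?thesis using sym[OF vv vv, of a b] by (simp add: fun_eq_iff)
  qed
  ultimately show ?thesis using v by (simp add: orthonormal_basis_def)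
qed

text \<open>Both \<open>v\<close> and \<open>- v\<close> bring \<open>L\<close> into the same normal form, so the basis may be taken to be
  positively oriented.\<close>

lemma second_class_oriented:
  assumes M: "smooth_manifold G" and metric: "left_inv_metric G g"
    and \<omega>: "orientation_form G \<omega>" and L: "endo G L" and "second_class G g L"
  shows "\<exists>v \<epsilon> \<alpha> \<beta> \<gamma>. orthonormal_basis G g v \<epsilon> \<and> \<epsilon> 1 = \<epsilon> 2 \<and> \<epsilon> 2 = - \<epsilon> 3 \<and> \<beta> \<noteq> 0 \<and>
    (\<forall>a. L (v a) = (\<Sum>b\<in>UNIV. rscl (L2 \<alpha> \<beta> \<gamma> $ b $ a) (v b))) \<and> \<omega> (v 1) (v 2) (v 3) > 0"
proof -
  interpret smooth_manifold G by (rule M)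
  from assms(5) obtain v \<epsilon> \<alpha> \<beta> \<gamma> where v: "orthonormal_basis G g v \<epsilon>" "\<epsilon> 1 = \<epsilon> 2" "\<epsilon> 2 = - \<epsilon> 3" "\<beta> \<noteq> 0"
    and Lv: "\<And>a. L (v a) = (\<Sum>b\<in>UNIV. rscl (L2 \<alpha> \<beta> \<gamma> $ b $ a) (v b))"
    unfolding second_class_def by blast
  have basis: "is_basis rscl UNIV (lie_alg G) UNIV v" using v by (simp add: orthonormal_basis_def)
  have va: "v a \<in> lie_alg G" for a using basis by (simp add: is_basis_def)
  show ?thesis
  proof (cases "\<omega> (v 1) (v 2) (v 3) > 0")
    case True
    then show ?thesis using v Lv by blast
  next
    case False
    let ?w = "\<lambda>a. rscl (- 1) (v a)"
    have w: "?w a \<in> lie_alg G" for a by (rule lie_alg_rscl[OF va])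
    have scale: "\<omega> x y (rscl k z) = k * \<omega> x y z" and anti: "\<omega> x y z = - \<omega> y x z" "\<omega> x y z = - \<omega> x z y"
      if "x \<in> lie_alg G" "y \<in> lie_alg G" "z \<in> lie_alg G" for x y z k
      using \<omega> that unfolding orientation_form_def by blast+
    have "\<omega> (?w 1) (?w 2) (?w 3) = - \<omega> (?w 1) (?w 2) (v 3)" by (simp add: scale[OF w w va])
    also have "\<omega> (?w 1) (?w 2) (v 3) = - \<omega> (?w 1) (v 3) (?w 2)" by (rule anti(2)[OF w w va])
    also have "\<omega> (?w 1) (v 3) (?w 2) = - \<omega> (?w 1) (v 3) (v 2)" by (simp add: scale[OF w va va])
    also have "\<omega> (?w 1) (v 3) (v 2) = \<omega> (v 3) (v 2) (?w 1)"
      using anti(1)[OF w va va] anti(2)[OF va w va] by simp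
    also have "\<omega> (v 3) (v 2) (?w 1) = - \<omega> (v 3) (v 2) (v 1)" by (simp add: scale[OF va va va])
    also have "\<omega> (v 3) (v 2) (v 1) = - \<omega> (v 2) (v 3) (v 1)" by (rule anti(1)[OF va va va])
    also have "\<omega> (v 2) (v 3) (v 1) = - \<omega> (v 2) (v 1) (v 3)" by (rule anti(2)[OF va va va])
    also have "\<omega> (v 2) (v 1) (v 3) = - \<omega> (v 1) (v 2) (v 3)" by (rule anti(1)[OF va va va])
    finally have "\<omega> (?w 1) (?w 2) (?w 3) > 0"
      using False orientation_form_basis[OF \<omega> basis] by simp
    moreover have "L (?w a) = (\<Sum>b\<in>UNIV. rscl (L2 \<alpha> \<beta> \<gamma> $ b $ a) (?w b))" for a
    proof -
      have "L (?w a) = rscl (- 1) (L (v a))" using L va unfolding endo_def by blast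
      then show ?thesis unfolding Lv by (intro ext) (simp add: rscl_apply sum_fun_apply sum_negf)
    qed
    ultimately show ?thesis using orthonormal_basis_flip[OF M metric v(1)] v by blast
  qed
qed

theorem theorem29:
  fixes G :: "'a::{t2_space, second_countable_topology} lie_data"
  assumes "lie_group3 G" and "unimodular G"
  shows "\<not> (\<exists>g H F \<delta> \<omega> L.
    left_inv_metric G g \<and>
    H \<in> forms3 G \<and> left_inv3 G H \<and>
    F \<in> forms2 G \<and> left_inv2 G F \<and>
    (\<forall>X\<in>vfields G. \<forall>Y\<in>vfields G. \<forall>Z\<in>vfields G. d2 G F X Y Z = 0) \<and>
    (\<exists>X\<in>vfields G. \<exists>Y\<in>vfields G. F X Y \<noteq> 0) \<and>
    left_inv_divergence G \<delta> \<and>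
    orientation_form G \<omega> \<and> bracket_operator G g \<omega> L \<and> second_class G g L \<and>
    odd_generalized_einstein G H F g \<delta>)"
proof clarify
  fix g H F \<delta> \<omega> L X Y
  assume metric: "left_inv_metric G g" and H: "H \<in> forms3 G" "left_inv3 G H" and F: "F \<in> forms2 G" "left_inv2 G F"
    and XY: "X \<in> vfields G" "Y \<in> vfields G" "F X Y \<noteq> 0"
    and inv: "left_inv_divergence G \<delta>" and \<omega>: "orientation_form G \<omega>" and L: "bracket_operator G g \<omega> L"
    and second: "second_class G g L" and einstein: "odd_generalized_einstein G H F g \<delta>"
  have group: "group (gmult G) (gone G) (ginv G)" and M: "smooth_manifold G"
    using assms(1) by (auto simp: lie_group3_def smooth_manifold_def)
  have endo: "endo G L" using L by (simp add: bracket_operator_def)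
  obtain v \<epsilon> \<alpha> \<beta> \<gamma> where *: "orthonormal_basis G g v \<epsilon> \<and> \<epsilon> 1 = \<epsilon> 2 \<and> \<epsilon> 2 = - \<epsilon> 3 \<and> \<beta> \<noteq> 0 \<and>
      (\<forall>a. L (v a) = (\<Sum>b\<in>UNIV. rscl (L2 \<alpha> \<beta> \<gamma> $ b $ a) (v b))) \<and> \<omega> (v 1) (v 2) (v 3) > 0"
    using second_class_oriented[OF M metric \<omega> endo second] by (elim exE)
  then have ob: "orthonormal_basis G g v \<epsilon>" and signs: "\<epsilon> 1 = \<epsilon> 2" "\<epsilon> 2 = - \<epsilon> 3" and \<beta>: "\<beta> \<noteq> 0"
    and Lv: "\<And>a. L (v a) = (\<Sum>b\<in>UNIV. rscl (L2 \<alpha> \<beta> \<gamma> $ b $ a) (v b))" and pos: "\<omega> (v 1) (v 2) (v 3) > 0"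
    by simp_all
  obtain cr where cr: "cross_product G g \<omega> cr"
    and bracket: "\<And>X Y. X \<in> lie_alg G \<Longrightarrow> Y \<in> lie_alg G \<Longrightarrow> lie_bracket G X Y = L (cr X Y)"
    using L unfolding bracket_operator_def by blast
  obtain D where D: "levi_civita G H F g D" "\<forall>u\<in>sections G. div_of G D u = \<delta> u"
    and plus: "\<forall>u\<in>E_minus G g. \<forall>x\<in>E_plus G g. ric_plus G H F g D u x = 0"
    and minus: "\<forall>u\<in>E_plus G g. \<forall>x\<in>E_minus G g. ric_minus G H F g D u x = 0"
    using einstein unfolding odd_generalized_einstein_def by blast
  have va: "v a \<in> lie_alg G" for a using ob by (simp add: orthonormal_basis_def is_basis_def)
  have closed: "lie_bracket G (v a) (v b) \<in> lie_alg G" for a b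
    using cr endo va unfolding bracket[OF va va] cross_product_def endo_def by blast
  interpret einstein_connection G v g \<epsilon> H F D \<delta>
    using M group ob closed metric H F D inv
    by (auto simp: einstein_connection_def einstein_connection_axioms_def einstein_frame_def einstein_frame_axioms_def
        left_inv_frame_def left_inv_frame_axioms_def orthonormal_basis_def)
  have "cr (v 1) (v 2) = rscl (\<epsilon> 3) (v 3)" "cr (v 2) (v 3) = rscl (\<epsilon> 1) (v 1)" "cr (v 3) (v 1) = rscl (\<epsilon> 2) (v 2)"
    using cr ob pos unfolding cross_product_def by blast+
  moreover have "L (rscl k (v a)) = rscl k (L (v a))" for k a using endo va unfolding endo_def by blast
  ultimately have br: "lie_bracket G (v 1) (v 2) = rscl (\<epsilon> 3) (\<Sum>b\<in>UNIV. rscl (L2 \<alpha> \<beta> \<gamma> $ b $ 3) (v b))"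
    "lie_bracket G (v 2) (v 3) = rscl (\<epsilon> 1) (\<Sum>b\<in>UNIV. rscl (L2 \<alpha> \<beta> \<gamma> $ b $ 1) (v b))"
    "lie_bracket G (v 3) (v 1) = rscl (\<epsilon> 2) (\<Sum>b\<in>UNIV. rscl (L2 \<alpha> \<beta> \<gamma> $ b $ 2) (v b))"
    by (simp_all add: bracket[OF va va] Lv)
  have signs': "\<epsilon> 2 = \<epsilon> 1" "\<epsilon> 3 = - \<epsilon> 1" using signs by simp_all
  have cs: "bracket_const 1 2 1 = 0" "bracket_const 1 2 2 = \<beta>" "bracket_const 1 2 3 = \<alpha>" "bracket_const 2 3 1 = \<gamma>" "bracket_const 2 3 2 = 0" "bracket_const 2 3 3 = 0"
    "bracket_const 3 1 1 = 0" "bracket_const 3 1 2 = \<alpha>" "bracket_const 3 1 3 = - \<beta>"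
    using eps_square[of 1]
    by (simp_all add: bracket_const_eq[OF br(1)] bracket_const_eq[OF br(2)] bracket_const_eq[OF br(3)] L2_def signs')
  have "F_const a b = 0" for a b
    by (rule second_class_F_zero[OF _ _ signs' \<beta> cs]) (use plus minus in auto)
  with F_zero XY show False by blast
qed

end
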